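(* Let $X$ be an Oka manifold, and fix a distance function $d$ on $X$ inducing its topology. Let $E \subset \partial\mathbb{D}$ be a closed set of measure zero and let $K \subset \mathbb{D}$ be a compact set without any holes, that is, such that $\mathbb{D} \setminus K$ has no connected component that is relatively compact in $\mathbb{D}$. Let $c \in \mathbb{D}$. Let $\varphi : \overline{\mathbb{D}} \to X$ be a continuous map that is holomorphic on a neighbourhood of $K$. Then for every $\epsilon > 0$ there exists a continuous map $F : \overline{\mathbb{D}} \to X$, holomorphic on $\mathbb{D}$, such that $d(F(z), \varphi(z)) < \epsilon$ for all $z \in K$, $F(z) = \varphi(z)$ for all $z \in E$, and $F(c) = \varphi(c)$.
   Context: $\mathbb{D} = \{z \in \mathbb{C} : |z| < 1\}$ is the open unit disc, $\overline{\mathbb{D}}$ its closure, $\partial\mathbb{D}$ the unit circle. "Measure zero" for subsets of $\partial\mathbb{D}$ refers to arc-length (Lebesgue) measure on the circle. A complex manifold $X$ is called Oka if it satisfies the basic Oka property with approximation and interpolation: for every Stein manifold $Y$, every holomorphically convex compact subset $K' \subset Y$ and every closed complex submanifold $L \subset Y$, every continuous map $f : Y \to X$ which is holomorphic on a neighbourhood of $K'$ and holomorphic on $L$ can be uniformly approximated on $K'$ and interpolated on $L$ by a holomorphic map $F : Y \to X$ (that is, for every $\epsilon>0$ there is a holomorphic $F : Y \to X$ with $F|_L = f|_L$ that is within $\epsilon$ of $f$ on $K'$ with respect to a distance inducing the topology of $X$). *)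

theory Defs
  imports "HOL-Analysis.Analysis"
begin

(* Since the dimension has to be quantified over inside definitions, C^n is the set of sequences
   that vanish from index n on, with the product topology; thus C^k is literally the coordinate
   subspace C^k x {0} of C^n for k \<le> n. *)
definition cspace :: "nat \<Rightarrow> (nat \<Rightarrow> complex) set" where
  "cspace n = {z. \<forall>i\<ge>n. z i = 0}"

(* Continuous and holomorphic in each of the n variables separately; only meant for V open in C^n. *)
definition cn_holomorphic_on :: "nat \<Rightarrow> (nat \<Rightarrow> complex) set \<Rightarrow> ((nat \<Rightarrow> complex) \<Rightarrow> complex) \<Rightarrow> bool" where
  "cn_holomorphic_on n V f \<longleftrightarrow>
     continuous_on V f \<and> (\<forall>z\<in>V. \<forall>i<n. (\<lambda>t. f (z(i := t))) field_differentiable at (z i))"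

definition cn_holomorphic_map ::
  "nat \<Rightarrow> nat \<Rightarrow> (nat \<Rightarrow> complex) set \<Rightarrow> ((nat \<Rightarrow> complex) \<Rightarrow> nat \<Rightarrow> complex) \<Rightarrow> bool" where
  "cn_holomorphic_map n m V g \<longleftrightarrow>
     g ` V \<subseteq> cspace m \<and> (\<forall>j<m. cn_holomorphic_on n V (\<lambda>z. g z j))"


(* A chart is a triple of its dimension, its domain and the coordinate map, whose values outside
   the domain are irrelevant. *)
type_synonym 'a cchart = "nat \<times> 'a set \<times> ('a \<Rightarrow> nat \<Rightarrow> complex)"

record 'a cmfd =
  cm_top :: "'a topology"
  cm_atlas :: "'a cchart set"

abbreviation points :: "'a cmfd \<Rightarrow> 'a set" where
  "points M \<equiv> topspace (cm_top M)"

definition chart_on :: "'a topology \<Rightarrow> 'a cchart \<Rightarrow> bool" where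
  "chart_on T = (\<lambda>(n, U, \<phi>). openin T U \<and> openin (top_of_set (cspace n)) (\<phi> ` U) \<and>
     homeomorphic_map (subtopology T U) (top_of_set (\<phi> ` U)) \<phi>)"

(* If the domains meet, compatibility forces n = m, by the chain rule. *)
definition compatible :: "'a cchart \<Rightarrow> 'a cchart \<Rightarrow> bool" where
  "compatible = (\<lambda>(n, U, \<phi>) (m, V, \<psi>).
     cn_holomorphic_map n m (\<phi> ` (U \<inter> V)) (\<psi> \<circ> inv_into U \<phi>) \<and>
     cn_holomorphic_map m n (\<psi> ` (U \<inter> V)) (\<phi> \<circ> inv_into V \<psi>))"

(* The dimension is locally constant, but different connected components may have
   different dimensions; the same holds for submanifolds below. *)
definition complex_manifold :: "'a cmfd \<Rightarrow> bool" where
  "complex_manifold M \<longleftrightarrow>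
     Hausdorff_space (cm_top M) \<and> second_countable (cm_top M) \<and>
     (\<forall>C\<in>cm_atlas M. chart_on (cm_top M) C) \<and>
     (\<forall>C\<in>cm_atlas M. \<forall>C'\<in>cm_atlas M. compatible C C') \<and>
     (\<Union>(n, U, \<phi>)\<in>cm_atlas M. U) = points M"

definition maximal_atlas :: "'a cmfd \<Rightarrow> 'a cchart set" where
  "maximal_atlas M = {C. chart_on (cm_top M) C \<and> (\<forall>C'\<in>cm_atlas M. compatible C C')}"

definition holomorphic_map_on :: "'a cmfd \<Rightarrow> 'b cmfd \<Rightarrow> 'a set \<Rightarrow> ('a \<Rightarrow> 'b) \<Rightarrow> bool" where
  "holomorphic_map_on M N S f \<longleftrightarrow>
     openin (cm_top M) S \<and> continuous_map (subtopology (cm_top M) S) (cm_top N) f \<and>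
     (\<forall>(n, U, \<phi>)\<in>cm_atlas M. \<forall>(m, V, \<psi>)\<in>cm_atlas N.
        cn_holomorphic_map n m (\<phi> ` (U \<inter> S \<inter> f -` V)) (\<psi> \<circ> f \<circ> inv_into U \<phi>))"

abbreviation holomorphic_map :: "'a cmfd \<Rightarrow> 'b cmfd \<Rightarrow> ('a \<Rightarrow> 'b) \<Rightarrow> bool" where
  "holomorphic_map M N f \<equiv> holomorphic_map_on M N (points M) f"

definition holomorphic_near :: "'a cmfd \<Rightarrow> 'b cmfd \<Rightarrow> 'a set \<Rightarrow> ('a \<Rightarrow> 'b) \<Rightarrow> bool" where
  "holomorphic_near M N K f \<longleftrightarrow> (\<exists>W. K \<subseteq> W \<and> holomorphic_map_on M N W f)"

definition complex_plane :: "complex cmfd" where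
  "complex_plane = \<lparr>cm_top = euclidean, cm_atlas = {(1, UNIV, \<lambda>z i. if i = 0 then z else 0)}\<rparr>"

abbreviation holomorphic_functions :: "'a cmfd \<Rightarrow> ('a \<Rightarrow> complex) set" where
  "holomorphic_functions M \<equiv> {f. holomorphic_map M complex_plane f}"


(* Charts of M that flatten L, paired with the dimension k of L there. *)
definition adapted_chart :: "'a cmfd \<Rightarrow> 'a set \<Rightarrow> nat \<Rightarrow> 'a cchart \<Rightarrow> bool" where
  "adapted_chart M L k = (\<lambda>(n, U, \<phi>). (n, U, \<phi>) \<in> maximal_atlas M \<and> k \<le> n \<and>
     \<phi> ` (U \<inter> L) = \<phi> ` U \<inter> cspace k)"

definition closed_submanifold :: "'a cmfd \<Rightarrow> 'a set \<Rightarrow> bool" where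
  "closed_submanifold M L \<longleftrightarrow>
     closedin (cm_top M) L \<and> (\<forall>p\<in>L. \<exists>k n U \<phi>. p \<in> U \<and> adapted_chart M L k (n, U, \<phi>))"

definition induced_structure :: "'a cmfd \<Rightarrow> 'a set \<Rightarrow> 'a cmfd" where
  "induced_structure M L =
     \<lparr>cm_top = subtopology (cm_top M) L,
      cm_atlas = {(k, U \<inter> L, \<phi>) |k n U \<phi>. adapted_chart M L k (n, U, \<phi>)}\<rparr>"


(* The bound B replaces the supremum of |f| over K so that the hull of the empty set is empty. *)
definition holomorphic_hull :: "'a cmfd \<Rightarrow> 'a set \<Rightarrow> 'a set" where
  "holomorphic_hull M K =
     {p \<in> points M. \<forall>f\<in>holomorphic_functions M. \<forall>B. (\<forall>x\<in>K. cmod (f x) \<le> B) \<longrightarrow> cmod (f p) \<le> B}"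

definition stein_manifold :: "'a cmfd \<Rightarrow> bool" where
  "stein_manifold M \<longleftrightarrow>
     complex_manifold M \<and>
     (\<forall>K. compactin (cm_top M) K \<longrightarrow> compactin (cm_top M) (holomorphic_hull M K)) \<and>
     (\<forall>p\<in>points M. \<forall>q\<in>points M. p \<noteq> q \<longrightarrow> (\<exists>f\<in>holomorphic_functions M. f p \<noteq> f q)) \<and>
     (\<forall>p\<in>points M. \<exists>n U f. p \<in> U \<and> (\<forall>i<n. f i \<in> holomorphic_functions M) \<and>
        (n, U, \<lambda>x i. if i < n then f i x else 0) \<in> maximal_atlas M)"

definition holomorphically_convex_compact :: "'a cmfd \<Rightarrow> 'a set \<Rightarrow> bool" where
  "holomorphically_convex_compact M K \<longleftrightarrow> compactin (cm_top M) K \<and> holomorphic_hull M K = K"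

definition induces_topology :: "('a \<Rightarrow> 'a \<Rightarrow> real) \<Rightarrow> 'a topology \<Rightarrow> bool" where
  "induces_topology d T \<longleftrightarrow> Metric_space (topspace T) d \<and> Metric_space.mtopology (topspace T) d = T"

(* The Stein manifold Y ranges over the manifolds whose points are of type nat \<Rightarrow> complex, with an
   arbitrary topology and atlas. No Stein manifold is lost: a second countable manifold
   has at most the cardinality of the continuum, so it is biholomorphic to one of these. *)
definition oka_manifold :: "'a cmfd \<Rightarrow> bool" where
  "oka_manifold X \<longleftrightarrow>
     complex_manifold X \<and>
     (\<exists>d. induces_topology d (cm_top X) \<and>
        (\<forall>(Y :: (nat \<Rightarrow> complex) cmfd) K L f.
           stein_manifold Y \<longrightarrow> holomorphically_convex_compact Y K \<longrightarrow> closed_submanifold Y L \<longrightarrow>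
           continuous_map (cm_top Y) (cm_top X) f \<longrightarrow>
           holomorphic_near Y X K f \<longrightarrow> holomorphic_map (induced_structure Y L) X f \<longrightarrow>
           (\<forall>\<epsilon>>0. \<exists>F. holomorphic_map Y X F \<and> (\<forall>y\<in>L. F y = f y) \<and>
                    (\<forall>y\<in>K. d (F y) (f y) < \<epsilon>))))"


definition arc_length :: "complex measure" where
  "arc_length = distr (restrict_space lborel {0..<2 * pi}) borel cis"

end

(* Idea.  F is obtained as a composition F' o G, where G is a continuous map of the closed disc into a
   polydisc Y, holomorphic inside, and F' : Y -> X comes from the Oka property applied to the Stein
   manifold Y.

   E is totally disconnected, hence a finite disjoint union of closed pieces A_i that phi maps into
   coordinate polydiscs of X.  By a Rudin-Carleson theorem, disc algebra functions G_1, ..., G_M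
   extend the coordinates of phi along the pieces, and a further one, p, equals a constant s_i on A_i
   and is small on K and at c.  Put G(z) = (z, G_1(z), ..., G_M(z), p(z)).

   On Y, with points (z, w, s), let f be the inverse i-th chart, as a function of w, on the slice
   s = s_i, and let f = phi(z) when s is away from the s_i; an explicit homotopy through constants
   interpolates.  Then f o G = phi on E, on K and at c; f is holomorphic on the submanifold consisting
   of the slices and the point G(c), and near the holomorphically convex compact set of points with
   z in K and s small.  The map F' given by the Oka property agrees with f on the former and is close
   to f on the latter. *)

theory Submission
  imports Defs "HOL-Complex_Analysis.Complex_Analysis"
begin

section \<open>Null sets on the circle and compact sets without holes\<close>

text \<open>The Oka property interpolates only along closed submanifolds of a Stein manifold on
  which the map is already holomorphic, whereas \<open>E\<close> lies on the boundary of the disc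
  and \<phi> is merely continuous there. The detour through \<open>Y\<close> removes this obstacle:
  the continuous data on \<open>E\<close> are absorbed by the inner map \<open>G\<close>, and the
  outer map need only be an inverse chart. As charts are local, each piece needs its own slice. The
  polydisc has radius 2, so \<open>G\<close> sends the closed disc, boundary included, into the open
  manifold \<open>Y\<close>; continuity up to the boundary then requires nothing of
  \<open>F'\<close> beyond continuity on \<open>Y\<close>. The homotopy exists because both maps
  contract to the same constant: \<phi> along segments of the disc, the inverse chart along rays of
  the polydisc. Measure zero enters through covers of \<open>E\<close> by finitely many discs of
  equal radius and small total radius; these yield the peak functions and the partition alike. The
  absence of holes enters as separation of points from \<open>K\<close> by entire functions, which
  gives holomorphic convexity.\<close>

lemma dist_cis_le: "dist (cis a) (cis b) \<le> \<bar>a - b\<bar>"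
proof -
  have "cis a - cis b = cis b * (exp (\<i> * of_real (a - b)) - 1)"
    by (simp add: cis_mult cis_conv_exp algebra_simps flip: exp_add)
  then have "dist (cis a) (cis b) = norm (exp (\<i> * of_real (a - b)) - 1)"
    unfolding dist_norm by (simp only: norm_mult norm_cis mult_1)
  also have "\<dots> = 2 * \<bar>sin ((a - b) / 2)\<bar>" by (rule dist_exp_i_1)
  also have "\<dots> \<le> 2 * \<bar>(a - b) / 2\<bar>" using abs_sin_x_le_abs_x[of "(a-b)/2"] by linarith
  finally show ?thesis by simp
qed

definition circle_null :: "complex set \<Rightarrow> bool" where
  "circle_null E \<longleftrightarrow> closed E \<and> E \<subseteq> sphere 0 1 \<and> E \<in> null_sets arc_length"

lemma circle_null_subset:
  assumes "circle_null E" "A \<subseteq> E" "closed A"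
  shows "circle_null A"
proof -
  have "A \<in> sets arc_length" using assms(3) by (simp add: arc_length_def borel_closed)
  then have "A \<in> null_sets arc_length"
    using assms null_sets_subset circle_null_def by blast
  then show ?thesis using assms by (auto simp: circle_null_def)
qed

lemma circle_null_compact: "circle_null E \<Longrightarrow> compact E"
  unfolding circle_null_def using bounded_subset[OF bounded_sphere] compact_eq_bounded_closed by blast

text \<open>The angles of \<open>E\<close> form a compact null set, contained in an open set of
  length at most \<open>\<eta>/2\<close>. If the mesh \<open>d\<close> of a grid is at most the
  distance from the angles to the complement of that set, every cell meeting the angles lies inside
  it, and disjointness bounds the number of such cells times \<open>d\<close>. Equal radii matter
  later, where each disc contributes a kernel of mass equal to its radius.\<close>

lemma circle_null_cover:
  assumes E: "circle_null E" and "\<eta> > 0"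
  obtains Z \<delta> where "finite Z" "Z \<subseteq> E" "\<delta> > 0" "E \<subseteq> (\<Union>\<zeta>\<in>Z. ball \<zeta> \<delta>)" "real (card Z) * \<delta> < \<eta>"
proof -
  \<comment> \<open>\<open>arc_length\<close> parametrises by a half-open interval; adding the
    endpoint \<open>2*pi\<close> makes \<open>A\<close> compact and costs only one further null
    point.\<close>
  define A where "A = {t \<in> {0..2*pi}. cis t \<in> E}"
  have [measurable]: "cis \<in> borel \<rightarrow>\<^sub>M borel"
    by (intro borel_measurable_continuous_onI) (auto intro!: continuous_intros)
  have Eb: "E \<in> sets borel" using E by (auto simp: circle_null_def)
  have "emeasure arc_length E = 0" using E by (auto simp: circle_null_def)
  then have "emeasure (restrict_space lborel {0..<2*pi}) (cis -` E \<inter> {0..<2*pi}) = 0"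
    using Eb unfolding arc_length_def
    by (subst (asm) emeasure_distr) (auto simp: measurable_restrict_space1 space_restrict_space)
  then have "emeasure lborel (cis -` E \<inter> {0..<2*pi}) = 0"
    by (subst (asm) emeasure_restrict_space) auto
  moreover have "cis -` E \<inter> {0..<2*pi} = {t \<in> {0..<2*pi}. cis t \<in> E}" by auto
  ultimately have *: "emeasure lborel {t \<in> {0..<2*pi}. cis t \<in> E} = 0" by simp
  have Ac: "closed A"
  proof -
    have "A = {0..2*pi} \<inter> cis -` E" by (auto simp: A_def)
    moreover have "closed ({0..2*pi} \<inter> cis -` E)" using E
      by (intro continuous_closed_preimage) (auto simp: circle_null_def intro!: continuous_intros)
    ultimately show ?thesis by simp
  qed
  have "{t \<in> {0..<2*pi}. cis t \<in> E} \<in> null_sets lborel"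
    using * Eb by (auto intro!: null_setsI)
  moreover have "{2*pi} \<in> null_sets lborel" by (auto intro!: null_setsI)
  ultimately have "{t \<in> {0..<2*pi}. cis t \<in> E} \<union> {2*pi} \<in> null_sets lborel" by (rule null_sets.Un)
  moreover have "A \<subseteq> {t \<in> {0..<2*pi}. cis t \<in> E} \<union> {2*pi}" by (auto simp: A_def)
  moreover have "A \<in> sets lborel" using Ac by simp
  ultimately have A0: "A \<in> null_sets lborel" by (metis null_sets_subset)
  obtain U where U: "open U" "A \<subseteq> U" "emeasure lborel (U - A) \<le> ennreal (\<eta>/2)"
    using outer_regular_lborel_le[of A "\<eta>/2"] Ac \<open>\<eta> > 0\<close> by auto
  have Um: "emeasure lborel U \<le> ennreal (\<eta>/2)"
  proof -
    have "emeasure lborel U \<le> emeasure lborel (U - A)"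
      using A0 U(1) by (simp add: emeasure_Diff_null_set)
    then show ?thesis using U by auto
  qed
  have Abd: "compact A"
    using Ac compact_Icc[of 0 "2*pi"] by (metis (no_types, lifting) A_def closed_Int_compact inf.absorb_iff2 inf_commute mem_Collect_eq subsetI)
  obtain d where d: "d > 0" "\<And>x y. x \<in> A \<Longrightarrow> y \<in> - U \<Longrightarrow> d \<le> dist x y"
    using separate_compact_closed[of A "-U"] Abd U(1,2) closed_Compl[OF U(1)] by blast
  define I where "I k = {real k * d ..< real (Suc k) * d}" for k
  define J where "J = {k. I k \<inter> A \<noteq> {}}"
  have Jfin: "finite J"
  proof (rule finite_subset)
    show "J \<subseteq> {k. k \<le> nat \<lfloor>2*pi/d\<rfloor>}"
    proof
      fix k assume "k \<in> J"
      then obtain t where "t \<in> I k" "t \<in> A" by (auto simp: J_def)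
      then have "real k * d \<le> 2*pi" by (auto simp: I_def A_def)
      then have "real k \<le> 2*pi/d" using d by (simp add: field_simps)
      then show "k \<in> {k. k \<le> nat \<lfloor>2*pi/d\<rfloor>}" by (simp add: le_nat_floor)
    qed
  qed auto
  have IU: "I k \<subseteq> U" if kJ: "k \<in> J" for k
  proof
    fix t assume t: "t \<in> I k"
    obtain a where a: "a \<in> I k" "a \<in> A" using kJ by (auto simp: J_def)
    then have "dist a t < d" using t by (auto simp: I_def dist_real_def algebra_simps)
    then show "t \<in> U" using d(2)[OF a(2), of t] by force
  qed
  have dis: "disjoint_family_on I J"
  proof (unfold disjoint_family_on_def, intro ballI impI)
    fix i j assume "i \<in> J" "j \<in> J" "i \<noteq> j"
    have "I i \<inter> I j = {}" if "i < j" for i j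
    proof -
      have "real (Suc i) * d \<le> real j * d" using that d by (intro mult_right_mono) auto
      then show ?thesis by (auto simp: I_def)
    qed
    then show "I i \<inter> I j = {}" using \<open>i \<noteq> j\<close> by (metis inf_commute linorder_neqE_nat)
  qed
  have "ennreal (real (card J) * d) = (\<Sum>k\<in>J. emeasure lborel (I k))"
    using d by (simp add: I_def algebra_simps ennreal_mult ennreal_of_nat_eq_real_of_nat)
  also have "\<dots> = emeasure lborel (\<Union>k\<in>J. I k)"
    by (rule sum_emeasure[OF _ dis Jfin]) (auto simp: I_def)
  also have "\<dots> \<le> emeasure lborel U" using IU U by (intro emeasure_mono) auto
  also have "\<dots> \<le> ennreal (\<eta>/2)" by (rule Um)
  finally have Jd: "real (card J) * d \<le> \<eta>/2" using \<open>\<eta> > 0\<close> by simp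
  have "\<forall>k\<in>J. \<exists>t. t \<in> I k \<inter> A" by (auto simp: J_def)
  from bchoice[OF this] obtain a where a: "\<And>k. k \<in> J \<Longrightarrow> a k \<in> I k \<inter> A" by blast
  show thesis
  proof
    show "finite ((\<lambda>k. cis (a k)) ` J)" using Jfin by simp
    show "(\<lambda>k. cis (a k)) ` J \<subseteq> E" using a by (auto simp: A_def)
    show "d > 0" by fact
    have "real (card ((\<lambda>k. cis (a k)) ` J)) * d \<le> real (card J) * d"
      using d Jfin by (intro mult_right_mono) (auto simp: card_image_le)
    then show "real (card ((\<lambda>k. cis (a k)) ` J)) * d < \<eta>" using Jd \<open>\<eta> > 0\<close> by simp
    show "E \<subseteq> (\<Union>\<zeta>\<in>(\<lambda>k. cis (a k)) ` J. ball \<zeta> d)"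
    proof
      fix z assume z: "z \<in> E"
      then have "cmod z = 1" using E by (auto simp: circle_null_def)
      define t where "t = Arg2pi z"
      have t: "0 \<le> t" "t < 2*pi" "z = cis t"
        using complex_norm_eq_1_exp[of z] \<open>cmod z = 1\<close> Arg2pi_ge_0[of z] Arg2pi_lt_2pi[of z]
        by (simp_all add: t_def cis_conv_exp)
      define k where "k = nat \<lfloor>t/d\<rfloor>"
      have "real k = of_int \<lfloor>t/d\<rfloor>" using t d by (simp add: k_def)
      then have "real k \<le> t/d" "t/d < real k + 1" by linarith+
      then have tk: "t \<in> I k" using d by (simp add: I_def field_simps)
      moreover have "t \<in> A" using t z by (auto simp: A_def)
      ultimately have kJ: "k \<in> J" by (auto simp: J_def)
      have "\<bar>a k - t\<bar> < d" using a[OF kJ] tk by (auto simp: I_def algebra_simps)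
      then have "dist (cis (a k)) z < d" using dist_cis_le[of "a k" t] t by simp
      then show "z \<in> (\<Union>\<zeta>\<in>(\<lambda>k. cis (a k)) ` J. ball \<zeta> d)" using kJ by auto
    qed
  qed
qed

text \<open>The radii to avoid are the distances from \<open>x\<close> to points of
  \<open>E\<close>. Distance is 1-Lipschitz, so a cover of \<open>E\<close> covers these radii by
  intervals of total length below \<open>r/2\<close>, which cannot fill an interval of length
  \<open>r\<close>.\<close>

lemma circle_null_avoiding_radius:
  assumes E: "circle_null E" and "r > 0"
  obtains \<rho> where "0 < \<rho>" "\<rho> < r" "sphere x \<rho> \<inter> E = {}"
proof -
  obtain Z \<delta> where Z: "finite Z" "\<delta> > 0" "E \<subseteq> (\<Union>\<zeta>\<in>Z. ball \<zeta> \<delta>)" "real (card Z) * \<delta> < r/4"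
    using circle_null_cover[OF E, of "r/4"] \<open>r > 0\<close> by (metis zero_less_divide_iff zero_less_numeral)
  define B where "B = (\<Union>\<zeta>\<in>Z. {dist x \<zeta> - \<delta>..dist x \<zeta> + \<delta>})"
  have "emeasure lborel B \<le> (\<Sum>\<zeta>\<in>Z. emeasure lborel {dist x \<zeta> - \<delta>..dist x \<zeta> + \<delta>})"
    unfolding B_def using Z by (intro emeasure_subadditive_finite) auto
  also have "\<dots> = ennreal (real (card Z) * (2*\<delta>))"
    using Z by (simp add: ennreal_mult ennreal_of_nat_eq_real_of_nat algebra_simps)
  also have "\<dots> < ennreal r" using Z \<open>r > 0\<close> by (intro ennreal_lessI) auto
  also have "\<dots> = emeasure lborel {0<..<r}" using \<open>r > 0\<close> by simp
  finally have *: "emeasure lborel B < emeasure lborel {0<..<r}" .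
  have "B \<in> sets lborel" using Z by (auto simp: B_def)
  then have "\<not> {0<..<r} \<subseteq> B" using * emeasure_mono[of "{0<..<r}" B lborel] by (meson not_le)
  then obtain \<rho> where "\<rho> \<in> {0<..<r}" "\<rho> \<notin> B" by blast
  then have r: "0 < \<rho>" "\<rho> < r" "\<rho> \<notin> B" by auto
  have "sphere x \<rho> \<inter> E = {}"
  proof (rule ccontr)
    assume "sphere x \<rho> \<inter> E \<noteq> {}"
    then obtain y where "y \<in> sphere x \<rho>" "y \<in> E" by blast
    then have y: "dist x y = \<rho>" "y \<in> E" by auto
    then obtain \<zeta> where "\<zeta> \<in> Z" "dist \<zeta> y < \<delta>" using Z by auto
    then have "\<rho> \<in> {dist x \<zeta> - \<delta>..dist x \<zeta> + \<delta>}"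
      using y dist_triangle[of x \<zeta> y] dist_triangle[of x y \<zeta>] by (auto simp: dist_commute)
    then show False using r \<open>\<zeta> \<in> Z\<close> by (auto simp: B_def)
  qed
  then show thesis using that r by blast
qed

text \<open>A ball whose bounding sphere misses \<open>E\<close> cuts out a part of \<open>E\<close>
  that is both closed and relatively open, so removing the earlier balls of a finite subcover from
  each ball leaves closed sets.\<close>

lemma circle_null_partition:
  assumes E: "circle_null E" and N: "\<And>x. x \<in> E \<Longrightarrow> open (N x) \<and> x \<in> N x"
  obtains n :: nat and y A where "\<And>i. i < n \<Longrightarrow> y i \<in> E" "\<And>i. i < n \<Longrightarrow> A i \<subseteq> N (y i)"
    "\<And>i. i < n \<Longrightarrow> closed (A i)" "disjoint_family_on A {..<n}" "E = (\<Union>i<n. A i)"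
proof -
  have "\<exists>\<rho>>0. ball x \<rho> \<subseteq> N x \<and> sphere x \<rho> \<inter> E = {}" if xE: "x \<in> E" for x
  proof -
    obtain r where r: "r > 0" "ball x r \<subseteq> N x" using N[OF xE] open_contains_ball by blast
    moreover obtain \<rho> where "0 < \<rho>" "\<rho> < r" "sphere x \<rho> \<inter> E = {}"
      using circle_null_avoiding_radius[OF E r(1)] by blast
    ultimately show ?thesis using r by (meson less_imp_le subset_ball subset_trans)
  qed
  then have "\<forall>x\<in>E. \<exists>\<rho>. \<rho> > 0 \<and> ball x \<rho> \<subseteq> N x \<and> sphere x \<rho> \<inter> E = {}" by blast
  from bchoice[OF this] obtain \<rho> where
    \<rho>: "\<And>x. x \<in> E \<Longrightarrow> \<rho> x > 0 \<and> ball x (\<rho> x) \<subseteq> N x \<and> sphere x (\<rho> x) \<inter> E = {}"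
    by blast
  obtain Y where Y: "Y \<subseteq> E" "finite Y" "E \<subseteq> (\<Union>x\<in>Y. ball x (\<rho> x))"
  proof (rule compactE_image[OF circle_null_compact[OF E], of E "\<lambda>x. ball x (\<rho> x)"])
    show "E \<subseteq> (\<Union>x\<in>E. ball x (\<rho> x))" using \<rho> by force
  qed auto
  obtain n y where y: "Y = y ` {..<n::nat}" "inj_on y {..<n}"
    using finite_imp_nat_seg_image_inj_on[OF Y(2)] by (auto simp: lessThan_def)
  define A where "A i = E \<inter> ball (y i) (\<rho> (y i)) - (\<Union>j<i. ball (y j) (\<rho> (y j)))" for i
  have yE: "y i \<in> E" if "i < n" for i using that y Y by auto
  show thesis
  proof
    fix i assume i: "i < n"
    show "y i \<in> E" using yE[OF i] .
    show "A i \<subseteq> N (y i)" using \<rho>[OF yE[OF i]] by (auto simp: A_def)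
    have "A i = E \<inter> cball (y i) (\<rho> (y i)) - (\<Union>j<i. ball (y j) (\<rho> (y j)))"
      using \<rho>[OF yE[OF i]] unfolding A_def by (auto simp: sphere_def order_less_le)
    moreover have "closed E" using E by (auto simp: circle_null_def)
    ultimately show "closed (A i)" by (auto intro!: closed_Diff)
  next
    show "disjoint_family_on A {..<n}"
    proof (unfold disjoint_family_on_def, intro ballI impI)
      fix i j :: nat assume "i \<noteq> j"
      then consider "i < j" | "j < i" by linarith
      then show "A i \<inter> A j = {}" by cases (auto simp: A_def)
    qed
    show "E = (\<Union>i<n. A i)"
    proof (intro equalityI subsetI)
      fix x assume x: "x \<in> E"
      define P where "P i \<longleftrightarrow> i < n \<and> x \<in> ball (y i) (\<rho> (y i))" for i
      obtain w where "w \<in> Y" "x \<in> ball w (\<rho> w)" using x Y(3) by blast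
      then have "\<exists>i. P i" unfolding P_def y(1) by blast
      define m where "m = (LEAST i. P i)"
      from \<open>\<exists>i. P i\<close> have "P m" unfolding m_def by (rule LeastI_ex)
      then have m: "m < n" "x \<in> ball (y m) (\<rho> (y m))" by (simp_all only: P_def)
      have "x \<notin> ball (y j) (\<rho> (y j))" if "j < m" for j
      proof -
        have "\<not> P j" using not_less_Least[of j P] that by (simp add: m_def)
        then show ?thesis using that m(1) by (simp add: P_def)
      qed
      then have "x \<in> A m" using x m(2) unfolding A_def by blast
      with m(1) have "\<exists>i<n. x \<in> A i" by blast
      then show "x \<in> (\<Union>i<n. A i)" by blast
    qed (auto simp: A_def)
  qed
qed

text \<open>Pole pushing as in Runge's theorem, phrased for separation by entire functions. A high
  power \<open>u\<close> of \<open>g / g p\<close> is 1 at \<open>p\<close> and tiny on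
  \<open>K\<close>. Either \<open>u\<close> still separates \<open>q\<close>, or \<open>u q\<close>
  is far from 1; then the divided difference of \<open>u\<close> at \<open>p\<close>, times
  \<open>q - p\<close>, is large at \<open>q\<close> and damped on \<open>K\<close> by the factor
  \<open>dist p q / dist z p\<close>, which is at most 1/2.\<close>

lemma separation_moves_pole:
  assumes g: "g holomorphic_on UNIV" "\<And>z. z \<in> K \<Longrightarrow> cmod (g z) \<le> B" "B < cmod (g p)"
    and q: "\<And>z. z \<in> K \<Longrightarrow> 2 * dist p q \<le> dist z p"
  obtains h B' where "h holomorphic_on UNIV" "\<And>z. z \<in> K \<Longrightarrow> cmod (h z) \<le> B'" "B' < cmod (h q)"
proof (cases "p = q")
  case True
  then show thesis using that g by blast
next
  case False
  define b where "b = max B 0"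
  have b: "0 \<le> b" "B \<le> b" "b < cmod (g p) \<or> K = {}"
    using g(2,3) by (auto simp: b_def) (smt (verit) norm_ge_zero ex_in_conv)
  show thesis
  proof (cases "K = {}")
    case True
    then show thesis by (intro that[of "\<lambda>_. 1" 0]) auto
  next
    case Kne: False
    with b have bp: "b < cmod (g p)" by blast
    then have gp: "g p \<noteq> 0" using b by auto
    have "(b / cmod (g p)) < 1" "0 \<le> b / cmod (g p)" using bp b gp by (auto simp: divide_less_eq)
    then obtain m where m: "(b / cmod (g p)) ^ m < 1/8" by (metis real_arch_pow_inv zero_less_divide_1_iff zero_less_numeral)
    define u where "u z = (g z / g p) ^ m" for z
    have u: "u holomorphic_on UNIV" unfolding u_def using g gp by (intro holomorphic_intros) auto
    have up: "u p = 1" using gp by (simp add: u_def)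
    have uK: "cmod (u z) \<le> 1/8" if "z \<in> K" for z
    proof -
      have "cmod (u z) = (cmod (g z) / cmod (g p)) ^ m" by (simp add: u_def norm_power norm_divide)
      also have "\<dots> \<le> (b / cmod (g p)) ^ m"
        using g(2)[OF that] b by (intro power_mono divide_right_mono) auto
      finally show ?thesis using m by simp
    qed
    show thesis
    proof (cases "cmod (u q) > 1/8")
      case True
      then show thesis using that u uK by blast
    next
      case uq: False
      define F where "F z = (if z = p then deriv u p else (u z - u p) / (z - p))" for z
      have F: "F holomorphic_on UNIV" unfolding F_def using pole_lemma_open[OF u] by simp
      show thesis
      proof (rule that)
        show "(\<lambda>z. (q - p) * F z) holomorphic_on UNIV" using F by (intro holomorphic_intros)
        \<comment> \<open>The modulus is at least 7/8 at \<open>q\<close> and at most half of 9/8 on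
          \<open>K\<close>; 5/8 lies between these two.\<close>
        have "(q - p) * F q = u q - 1" using False up by (simp add: F_def)
        moreover have "cmod (u q - 1) \<ge> 7/8" using uq norm_triangle_ineq2[of 1 "u q"] by (simp add: norm_minus_commute)
        ultimately show "5/8 < cmod ((q - p) * F q)" by simp
        fix z assume z: "z \<in> K"
        have zp: "z \<noteq> p" using q[OF z] False by auto
        have "cmod (u z - 1) \<le> 9/8" using uK[OF z] norm_triangle_ineq4[of "u z" 1] by simp
        then have "cmod (u z - 1) / dist z p \<le> (9/8) / dist z p" by (rule divide_right_mono) simp
        then have "dist p q * (cmod (u z - 1) / dist z p) \<le> dist p q * ((9/8) / dist z p)"
          by (rule mult_left_mono) simp
        moreover have "cmod ((q - p) * F z) = dist p q * (cmod (u z - 1) / dist z p)"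
          using zp up by (simp add: F_def norm_mult norm_divide dist_norm norm_minus_commute[of q])
        ultimately have "cmod ((q - p) * F z) \<le> dist p q * ((9/8) / dist z p)" by simp
        also have "\<dots> \<le> 5/8" using q[OF z] zp zero_le_dist[of z p] by (simp add: divide_le_eq del: zero_le_dist)
        finally show "cmod ((q - p) * F z) \<le> 5/8" .
      qed
    qed
  qed
qed

text \<open>This is polynomial convexity of \<open>K\<close>, the form in which the absence of holes
  is used. Far from the origin the identity function separates. A component of the complement of
  \<open>K\<close> in the disc that stayed inside \<open>cball 0 r\<close> would be relatively
  compact, so every component contains a separable point, and pole pushing makes the set
  \<open>S\<close> of separable points clopen in it.\<close>

lemma no_holes_separation:
  assumes K: "compact K" "K \<subseteq> ball 0 1"
    and holes: "\<forall>C \<in> components (ball 0 1 - K).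
           \<not> compactin (top_of_set (ball 0 1)) (top_of_set (ball 0 1) closure_of C)"
    and p: "p \<notin> K"
  obtains g B where "g holomorphic_on UNIV" "\<And>z. z \<in> K \<Longrightarrow> cmod (g z) \<le> B" "B < cmod (g p)"
proof -
  define S where "S = {p. \<exists>g B. g holomorphic_on UNIV \<and> (\<forall>z\<in>K. cmod (g z) \<le> B) \<and> B < cmod (g p)}"
  have move: "q \<in> S" if pq: "p \<in> S" "\<And>z. z \<in> K \<Longrightarrow> 2 * dist p q \<le> dist z p" for p q
  proof -
    obtain g B where g: "g holomorphic_on UNIV" "\<forall>z\<in>K. cmod (g z) \<le> B" "B < cmod (g p)"
      using pq(1) unfolding S_def mem_Collect_eq by (elim exE conjE)
    then obtain h B' where "h holomorphic_on UNIV" "\<forall>z\<in>K. cmod (h z) \<le> B'" "B' < cmod (h q)"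
      using separation_moves_pole[of g K B p q] pq(2) by metis
    then show ?thesis unfolding S_def by blast
  qed
  obtain r where r: "0 < r" "r < 1" "K \<subseteq> cball 0 r"
  proof (cases "K = {}")
    case True
    then show thesis using that[of "1/2"] by auto
  next
    case False
    obtain x where x: "x \<in> K" "\<And>y. y \<in> K \<Longrightarrow> cmod y \<le> cmod x"
      using continuous_attains_sup[OF K(1) False, of cmod] by (auto intro: continuous_intros)
    then have "cmod x < 1" using K by auto
    moreover have "K \<subseteq> cball 0 (max (1/2) (cmod x))" using x by (auto simp: le_max_iff_disj)
    ultimately show thesis by (intro that[of "max (1/2) (cmod x)"]) auto
  qed
  have far: "p \<in> S" if "cmod p > r" for p
    unfolding S_def mem_Collect_eq using that r
    by (intro exI[of _ "\<lambda>z. z"] exI[of _ r] conjI) (auto intro: holomorphic_intros)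
  have "p \<in> S"
  proof (cases "p \<in> ball 0 1")
    case False
    then show ?thesis using far r by auto
  next
    case True
    define C where "C = connected_component_set (ball 0 1 - K) p"
    have pD: "p \<in> ball 0 1 - K" using True p by auto
    have C: "C \<in> components (ball 0 1 - K)" unfolding C_def components_def using pD by blast
    have Csub: "C \<subseteq> ball 0 1 - K" using C in_components_subset by blast
    have Ccon: "connected C" using C in_components_connected by blast
    have Cop: "open C" using open_components[OF _ C] K(1) by (simp add: compact_imp_closed open_Diff)
    have "\<not> C \<subseteq> cball 0 r"
    proof
      assume "C \<subseteq> cball 0 r"
      then have cl: "closure C \<subseteq> cball 0 r" by (simp add: closure_minimal)
      then have "closure C \<subseteq> ball 0 1" using r by auto
      moreover have "top_of_set (ball 0 1) closure_of C = ball 0 1 \<inter> closure C"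
        using Csub by (simp add: closure_of_subtopology inf.absorb2 le_infI1 subset_trans[OF Csub])
      ultimately have "top_of_set (ball 0 1) closure_of C = closure C" by auto
      moreover have "compact (closure C)" using cl by (meson bounded_cball bounded_subset closed_closure compact_eq_bounded_closed)
      ultimately have "compactin (top_of_set (ball 0 1)) (top_of_set (ball 0 1) closure_of C)"
        using \<open>closure C \<subseteq> ball 0 1\<close> by (simp add: compactin_subtopology)
      then show False using bspec[OF holes C] by simp
    qed
    then obtain x where "x \<in> C" "x \<notin> cball 0 r" by blast
    with far have x: "x \<in> C" "x \<in> S" by auto
    have rad: "\<exists>e>0. \<forall>z\<in>K. e \<le> dist z y" if yC: "y \<in> C" for y
    proof -
      have "y \<in> - K" "open (-K)" using yC Csub K(1) by (auto simp: compact_imp_closed open_Compl)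
      then obtain e where "e > 0" "ball y e \<subseteq> - K" using open_contains_ball by blast
      moreover from this have "e \<le> dist z y" if "z \<in> K" for z
        using that by (force simp: dist_commute subset_iff linorder_not_less[symmetric])
      ultimately show ?thesis by blast
    qed
    have o1: "open (C \<inter> S)"
      unfolding open_dist
    proof
      fix y assume y: "y \<in> C \<inter> S"
      obtain e where e: "e > 0" "\<forall>z\<in>K. e \<le> dist z y" using rad y by blast
      obtain e' where e': "e' > 0" "ball y e' \<subseteq> C" using Cop y open_contains_ball by blast
      show "\<exists>e>0. \<forall>w. dist w y < e \<longrightarrow> w \<in> C \<inter> S"
      proof (intro exI[of _ "min (e/2) e'"] conjI allI impI)
        fix w assume w: "dist w y < min (e/2) e'"
        then have "w \<in> C" using e' by (auto simp: dist_commute)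
        moreover have "w \<in> S"
        proof (rule move[of y w])
          fix z assume "z \<in> K"
          then have "e \<le> dist z y" using e by blast
          then show "2 * dist y w \<le> dist z y" using w by (simp add: dist_commute)
        qed (use y in blast)
        ultimately show "w \<in> C \<inter> S" by blast
      qed (use e e' in auto)
    qed
    have o2: "open (C - S)"
      unfolding open_dist
    proof
      fix y assume y: "y \<in> C - S"
      obtain e where e: "e > 0" "\<forall>z\<in>K. e \<le> dist z y" using rad y by blast
      obtain e' where e': "e' > 0" "ball y e' \<subseteq> C" using Cop y open_contains_ball by blast
      show "\<exists>e>0. \<forall>w. dist w y < e \<longrightarrow> w \<in> C - S"
      \<comment> \<open>Now the pole is \<open>w\<close>, whose distance from \<open>K\<close> is
        only known to be at least \<open>e - e/3\<close>; this still exceeds twice its distance from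
        \<open>y\<close>.\<close>
      proof (intro exI[of _ "min (e/3) e'"] conjI allI impI)
        fix w assume w: "dist w y < min (e/3) e'"
        then have "w \<in> C" using e' by (auto simp: dist_commute)
        moreover have "w \<notin> S"
        proof
          assume "w \<in> S"
          have "2 * dist w y \<le> dist z w" if "z \<in> K" for z
          proof -
            have "e \<le> dist z y" using e that by blast
            then show ?thesis using w dist_triangle[of z y w] by simp
          qed
          then show False using move[OF \<open>w \<in> S\<close>] y by blast
        qed
        ultimately show "w \<in> C - S" by blast
      qed (use e e' in auto)
    qed
    have "C - S = {}"
      using connectedD[OF Ccon o1 o2] x by blast
    moreover have "p \<in> C" unfolding C_def using pD by simp
    ultimately show ?thesis by blast
  qed
  then obtain g B where "g holomorphic_on UNIV" "\<forall>z\<in>K. cmod (g z) \<le> B" "B < cmod (g p)"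
    unfolding S_def mem_Collect_eq by (elim exE conjE)
  then show thesis by (intro that[of g B]) auto
qed

section \<open>Interpolation in the disc algebra\<close>

definition disc_algebra :: "(complex \<Rightarrow> complex) set" where
  "disc_algebra = {f. continuous_on (cball 0 1) f \<and> f holomorphic_on ball 0 1}"

lemma disc_algebra_const: "(\<lambda>_. c) \<in> disc_algebra"
  by (auto simp: disc_algebra_def)

lemma disc_algebra_mult: "f \<in> disc_algebra \<Longrightarrow> g \<in> disc_algebra \<Longrightarrow> (\<lambda>z. f z * g z) \<in> disc_algebra"
  by (auto simp: disc_algebra_def intro!: continuous_intros holomorphic_intros)

lemma disc_algebra_add: "f \<in> disc_algebra \<Longrightarrow> g \<in> disc_algebra \<Longrightarrow> (\<lambda>z. f z + g z) \<in> disc_algebra"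
  by (auto simp: disc_algebra_def intro!: continuous_intros holomorphic_intros)

lemma disc_algebra_diff: "f \<in> disc_algebra \<Longrightarrow> g \<in> disc_algebra \<Longrightarrow> (\<lambda>z. f z - g z) \<in> disc_algebra"
  by (auto simp: disc_algebra_def intro!: continuous_intros holomorphic_intros)

lemma disc_algebra_power: "f \<in> disc_algebra \<Longrightarrow> (\<lambda>z. f z ^ n) \<in> disc_algebra"
  by (auto simp: disc_algebra_def intro!: continuous_intros holomorphic_intros)

lemma disc_algebra_divide:
  "f \<in> disc_algebra \<Longrightarrow> g \<in> disc_algebra \<Longrightarrow> (\<And>z. z \<in> cball 0 1 \<Longrightarrow> g z \<noteq> 0) \<Longrightarrow> (\<lambda>z. f z / g z) \<in> disc_algebra"
  by (auto simp: disc_algebra_def intro!: continuous_intros holomorphic_intros)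

lemma disc_algebra_sum:
  "(\<And>i. i \<in> I \<Longrightarrow> f i \<in> disc_algebra) \<Longrightarrow> (\<lambda>z. \<Sum>i\<in>I. f i z) \<in> disc_algebra"
  by (auto simp: disc_algebra_def intro!: continuous_intros holomorphic_intros)

lemma disc_algebra_uniform_limit:
  assumes "\<And>n. f n \<in> disc_algebra" and u: "uniform_limit (cball 0 1) f g sequentially"
  shows "g \<in> disc_algebra"
proof -
  have "continuous_on (cball 0 1) g"
    using assms by (intro uniform_limit_theorem[OF _ u]) (auto simp: disc_algebra_def)
  moreover have "g holomorphic_on ball 0 1"
  proof (rule holomorphic_uniform_sequence)
    show "f n holomorphic_on ball 0 1" for n using assms(1)[of n] by (simp add: disc_algebra_def)
    fix x :: complex assume x: "x \<in> ball 0 1"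
    then obtain d where d: "d > 0" "cball x d \<subseteq> ball 0 1" using open_contains_cball[of "ball 0 1"] open_ball by blast
    moreover have "cball x d \<subseteq> cball 0 1" using d ball_subset_cball by blast
    ultimately show "\<exists>d>0. cball x d \<subseteq> ball 0 1 \<and> uniform_limit (cball x d) f g sequentially"
      using uniform_limit_on_subset[OF u] by blast
  qed auto
  ultimately show ?thesis by (simp add: disc_algebra_def)
qed

text \<open>The building block is \<open>\<delta> / (1 + \<delta> - z * cnj \<zeta>)\<close>, which has its pole just outside the disc:
  its real part is at least 1/4 near \<open>\<zeta>\<close>, whereas it is of size \<open>\<delta>\<close> away from \<open>\<zeta>\<close>.\<close>

lemma boundary_kernel:
  assumes \<zeta>: "cmod \<zeta> = 1" and z: "cmod z \<le> 1" and \<delta>: "\<delta> > 0"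
  defines "w \<equiv> 1 + of_real \<delta> - z * cnj \<zeta>"
  shows "w \<noteq> 0" "Re (of_real \<delta> / w) \<ge> 0" "dist z \<zeta> < \<delta> \<Longrightarrow> Re (of_real \<delta> / w) \<ge> 1/4"
    "0 < d \<Longrightarrow> d \<le> dist z \<zeta> \<Longrightarrow> cmod (of_real \<delta> / w) \<le> \<delta> / d"
proof -
  define a where "a = 1 - z * cnj \<zeta>"
  have "cmod (z * cnj \<zeta>) \<le> 1" using \<zeta> z by (simp add: norm_mult)
  then have Rea: "Re a \<ge> 0" using complex_Re_le_cmod[of "z * cnj \<zeta>"] by (simp add: a_def)
  have cz: "\<zeta> * cnj \<zeta> = 1" using \<zeta> complex_norm_square[of \<zeta>] by simp
  have "a = (\<zeta> - z) * cnj \<zeta>" by (simp add: a_def algebra_simps cz)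
  then have ca: "cmod a = dist z \<zeta>" using \<zeta> by (simp add: norm_mult dist_norm norm_minus_commute)
  have w: "w = a + of_real \<delta>" by (simp add: w_def a_def)
  have Rew: "Re w \<ge> \<delta>" using Rea w by simp
  then show w0: "w \<noteq> 0" using \<delta> by auto
  have Rediv: "Re (of_real \<delta> / w) = \<delta> * Re w / (cmod w)\<^sup>2"
    by (simp add: Re_divide cmod_power2)
  show "Re (of_real \<delta> / w) \<ge> 0" unfolding Rediv using Rew \<delta> by simp
  {
    assume "dist z \<zeta> < \<delta>"
    then have "cmod w \<le> 2 * \<delta>" using norm_triangle_ineq[of a "of_real \<delta>"] ca w \<delta> by simp
    then have "(cmod w)\<^sup>2 \<le> (2*\<delta>)\<^sup>2" by (intro power_mono) auto
    also have "\<dots> = 4 * (\<delta> * \<delta>)" by (simp add: power2_eq_square)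
    also have "\<dots> \<le> 4 * (\<delta> * Re w)" using Rew \<delta> by simp
    finally show "Re (of_real \<delta> / w) \<ge> 1/4" unfolding Rediv using w0 by (simp add: le_divide_eq)
  }
  assume d: "0 < d" "d \<le> dist z \<zeta>"
  have "(Re a)\<^sup>2 \<le> (Re w)\<^sup>2" using Rea \<delta> w by (intro power_mono) auto
  then have "cmod a \<le> cmod w" by (simp add: cmod_def w)
  then show "cmod (of_real \<delta> / w) \<le> \<delta> / d"
    using d \<delta> w0 ca by (simp add: norm_divide frac_le)
qed

text \<open>Sum of the kernels centred at a cover of \<open>E\<close>. Their real parts are
  nonnegative, so one nearby centre already gives 1/4, while at distance \<open>d\<close> from
  \<open>E\<close> they add up to at most \<open>card Z * \<delta> / d\<close>. Measure zero makes
  this arbitrarily small although the lower bound near \<open>E\<close> stays fixed.\<close>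

lemma boundary_layer:
  assumes E: "circle_null E" and "\<eta> > 0"
  obtains h U where "h \<in> disc_algebra" "\<And>z. z \<in> cball 0 1 \<Longrightarrow> Re (h z) \<ge> 0"
    "open U" "E \<subseteq> U" "\<And>z. z \<in> cball 0 1 \<Longrightarrow> z \<in> U \<Longrightarrow> Re (h z) \<ge> 1/4"
    "\<And>z d. z \<in> cball 0 1 \<Longrightarrow> 0 < d \<Longrightarrow> (\<And>\<zeta>. \<zeta> \<in> E \<Longrightarrow> d \<le> dist z \<zeta>) \<Longrightarrow> cmod (h z) \<le> \<eta> / d"
proof -
  obtain Z \<delta> where Z: "finite Z" "Z \<subseteq> E" "\<delta> > 0" "E \<subseteq> (\<Union>\<zeta>\<in>Z. ball \<zeta> \<delta>)" "real (card Z) * \<delta> < \<eta>"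
    using circle_null_cover[OF assms] by blast
  define k where "k \<zeta> z = of_real \<delta> / (1 + of_real \<delta> - z * cnj \<zeta>)" for \<zeta> z :: complex
  have nZ: "cmod \<zeta> = 1" if "\<zeta> \<in> Z" for \<zeta> using that Z(2) E unfolding circle_null_def by auto
  have kd: "k \<zeta> \<in> disc_algebra" if "\<zeta> \<in> Z" for \<zeta>
    using boundary_kernel(1)[OF nZ[OF that] _ Z(3)] unfolding k_def disc_algebra_def
    by (auto intro!: continuous_intros holomorphic_intros)
  show thesis
  proof
    show "(\<lambda>z. \<Sum>\<zeta>\<in>Z. k \<zeta> z) \<in> disc_algebra" using kd by (rule disc_algebra_sum)
    have pos: "Re (k \<zeta> z) \<ge> 0" if "\<zeta> \<in> Z" "z \<in> cball 0 1" for \<zeta> z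
      using boundary_kernel(2)[OF nZ[OF that(1)] _ Z(3), of z] that by (simp add: k_def)
    show "Re (\<Sum>\<zeta>\<in>Z. k \<zeta> z) \<ge> 0" if "z \<in> cball 0 1" for z
      using pos that by (auto intro!: sum_nonneg)
    show "open (\<Union>\<zeta>\<in>Z. ball \<zeta> \<delta>)" by auto
    show "E \<subseteq> (\<Union>\<zeta>\<in>Z. ball \<zeta> \<delta>)" by fact
    show "Re (\<Sum>\<zeta>\<in>Z. k \<zeta> z) \<ge> 1/4" if z: "z \<in> cball 0 1" "z \<in> (\<Union>\<zeta>\<in>Z. ball \<zeta> \<delta>)" for z
    proof -
      obtain \<xi> where \<xi>: "\<xi> \<in> Z" "z \<in> ball \<xi> \<delta>" using z(2) by blast
      have "1/4 \<le> Re (k \<xi> z)"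
        using boundary_kernel(3)[OF nZ[OF \<xi>(1)] _ Z(3), of z] z \<xi> by (simp add: k_def dist_commute)
      also have "\<dots> \<le> (\<Sum>\<zeta>\<in>Z. Re (k \<zeta> z))"
        using \<xi>(1) Z(1) pos[OF _ z(1)] by (intro member_le_sum) auto
      finally show ?thesis by simp
    qed
    fix z :: complex and d :: real
    assume z: "z \<in> cball 0 1" "0 < d" and dz: "\<And>\<zeta>. \<zeta> \<in> E \<Longrightarrow> d \<le> dist z \<zeta>"
    have "cmod (k \<zeta> z) \<le> \<delta> / d" if "\<zeta> \<in> Z" for \<zeta>
      using boundary_kernel(4)[OF nZ[OF that] _ Z(3), of z d] z dz[of \<zeta>] that Z(2) by (auto simp: k_def)
    then have "cmod (\<Sum>\<zeta>\<in>Z. k \<zeta> z) \<le> (\<Sum>\<zeta>\<in>Z. \<delta> / d)" by (intro order_trans[OF norm_sum] sum_mono)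
    also have "\<dots> = real (card Z) * \<delta> / d" by simp
    also have "\<dots> \<le> \<eta> / d" using Z z by (intro divide_right_mono) auto
    finally show "cmod (\<Sum>\<zeta>\<in>Z. k \<zeta> z) \<le> \<eta> / d" .
  qed
qed

text \<open>With \<open>h\<close> the sum of layers of rapidly decreasing mass, \<open>1 + h\<close> has real part at least 1 and
  tends to infinity at \<open>E\<close>, so that \<open>1 / (1 + h)\<close> vanishes precisely on \<open>E\<close>.  The partial sums of
  \<open>h\<close> give functions in the disc algebra converging uniformly.\<close>

lemma peak_function:
  assumes E: "circle_null E"
  obtains P where "P \<in> disc_algebra" "\<And>z. z \<in> E \<Longrightarrow> P z = 1" "\<And>z. z \<in> cball 0 1 \<Longrightarrow> z \<notin> E \<Longrightarrow> cmod (P z) < 1"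
proof -
  define layer where "layer n h U \<longleftrightarrow> h \<in> disc_algebra \<and> (\<forall>z\<in>cball 0 1. Re (h z) \<ge> 0) \<and> open U \<and> E \<subseteq> U \<and>
      (\<forall>z\<in>cball 0 1. z \<in> U \<longrightarrow> Re (h z) \<ge> 1/4) \<and>
      (\<forall>z\<in>cball 0 1. \<forall>d>0. (\<forall>\<zeta>\<in>E. d \<le> dist z \<zeta>) \<longrightarrow> cmod (h z) \<le> (1/2)^n / d)" for n :: nat and h U
  have "\<forall>n. \<exists>h U. layer n h U"
  proof
    fix n :: nat
    have "(1/2::real)^n > 0" by simp
    from boundary_layer[OF E this] obtain h U where
      "h \<in> disc_algebra" and 1: "\<And>z. z \<in> cball 0 1 \<Longrightarrow> Re (h z) \<ge> 0" and
      "open U" "E \<subseteq> U" and 2: "\<And>z. z \<in> cball 0 1 \<Longrightarrow> z \<in> U \<Longrightarrow> Re (h z) \<ge> 1/4" and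
      3: "\<And>z d. z \<in> cball 0 1 \<Longrightarrow> 0 < d \<Longrightarrow> (\<And>\<zeta>. \<zeta> \<in> E \<Longrightarrow> d \<le> dist z \<zeta>) \<Longrightarrow> cmod (h z) \<le> (1/2)^n / d"
      by blast
    then show "\<exists>h U. layer n h U"
      unfolding layer_def by (intro exI[of _ h] exI[of _ U] conjI ballI allI impI 1 2 3) auto
  qed
  from choice[OF this] obtain h where "\<forall>n. \<exists>U. layer n (h n) U" ..
  from choice[OF this] obtain U where "\<forall>n. layer n (h n) (U n)" ..
  then have
    h: "\<And>n. h n \<in> disc_algebra" and hpos: "\<And>n z. z \<in> cball 0 1 \<Longrightarrow> Re (h n z) \<ge> 0" and
    U: "\<And>n::nat. open (U n)" "\<And>n. E \<subseteq> U n" and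
    hU: "\<And>n z. z \<in> cball 0 1 \<Longrightarrow> z \<in> U n \<Longrightarrow> Re (h n z) \<ge> 1/4" and
    hd: "\<And>n z d. z \<in> cball 0 1 \<Longrightarrow> d > 0 \<Longrightarrow> (\<forall>\<zeta>\<in>E. d \<le> dist z \<zeta>) \<Longrightarrow> cmod (h n z) \<le> (1/2)^n / d"
    unfolding layer_def by blast+
  define H where "H n z = 1 + (\<Sum>i<n. h i z)" for n z
  have HR: "Re (H n z) = 1 + (\<Sum>i<n. Re (h i z))" for n z by (simp add: H_def)
  have H1: "Re (H n z) \<ge> 1" if "z \<in> cball 0 1" for n z
    unfolding HR using hpos[OF that] by (simp add: sum_nonneg)
  have H0: "H n z \<noteq> 0" if "z \<in> cball 0 1" for n z using H1[OF that, of n] by auto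
  define e where "e n z = 1 / H n z" for n z
  have eda: "e n \<in> disc_algebra" for n
    unfolding e_def using H0 unfolding H_def
    by (intro disc_algebra_divide disc_algebra_add disc_algebra_const disc_algebra_sum h) auto
  have enorm: "cmod (e n z) \<le> 1" if "z \<in> cball 0 1" for n z
  proof -
    have "1 \<le> cmod (H n z)" using H1[OF that, of n] complex_Re_le_cmod[of "H n z"] by linarith
    then show ?thesis using H0[OF that, of n] by (simp add: e_def norm_divide divide_le_eq)
  qed
  have tail: "cmod (H m z - H n z) \<le> 2 * (1/2)^n / d"
    if "n \<le> m" and z: "z \<in> cball 0 1" "d > 0" "\<forall>\<zeta>\<in>E. d \<le> dist z \<zeta>" for m n z d
  proof -
    have "(\<Sum>i<m. h i z) = (\<Sum>i<n. h i z) + (\<Sum>i=n..<m. h i z)"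
      using sum.atLeastLessThan_concat[of 0 n m "\<lambda>i. h i z"] that(1) by (simp add: lessThan_atLeast0)
    then have "cmod (H m z - H n z) = cmod (\<Sum>i=n..<m. h i z)" by (simp add: H_def)
    also have "\<dots> \<le> (\<Sum>i=n..<m. (1/2)^i / d)" by (intro sum_norm_le hd z)
    also have "\<dots> = (\<Sum>i=n..<m. (1/2)^i) / d" by (simp add: sum_divide_distrib)
    also have "\<dots> \<le> 2 * (1/2)^n / d"
    proof (intro divide_right_mono)
      have "(\<Sum>i=n..<m. (1/2::real)^i) = 2 * (1/2)^n - 2 * (1/2)^m"
        using that(1) by (induction m rule: dec_induct) simp_all
      then show "(\<Sum>i=n..<m. (1/2::real)^i) \<le> 2 * (1/2)^n" by simp
    qed (use z in simp)
    finally show ?thesis .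
  qed
  have ucauchy: "uniformly_Cauchy_on (cball 0 1) e"
  proof (rule uniformly_Cauchy_onI')
    fix \<epsilon> :: real assume \<epsilon>: "\<epsilon> > 0"
    \<comment> \<open>On \<open>V\<close> the first \<open>k\<close> layers, each contributing at
      least 1/4, push \<open>Re (H n z)\<close> above \<open>2 / \<epsilon>\<close>, so all later
      \<open>e n\<close> are below \<open>\<epsilon> / 2\<close> there. Off \<open>V\<close> the
      distance to \<open>E\<close> is bounded below and the tail estimate is uniform.\<close>
    obtain k :: nat where k: "real k > 8 / \<epsilon>" using reals_Archimedean2 by blast
    define V where "V = (\<Inter>i<k. U i)"
    have V: "open V" "E \<subseteq> V" unfolding V_def using U by auto
    have eV: "cmod (e n z) < \<epsilon> / 2" if z: "z \<in> cball 0 1" "z \<in> V" and n: "n \<ge> k" for n z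
    proof -
      have "real k / 4 = (\<Sum>i<k. 1/4)" by simp
      also have "\<dots> \<le> (\<Sum>i<k. Re (h i z))" using z by (intro sum_mono hU) (auto simp: V_def)
      also have "\<dots> \<le> (\<Sum>i<n. Re (h i z))" using n hpos[OF z(1)] by (intro sum_mono2) auto
      finally have "real k / 4 < Re (H n z)" unfolding HR by simp
      moreover have "2 / \<epsilon> = (8 / \<epsilon>) / 4" by simp
      ultimately have "2 / \<epsilon> < Re (H n z)" using k by linarith
      then have "2 / \<epsilon> < cmod (H n z)" using complex_Re_le_cmod[of "H n z"] by linarith
      then show ?thesis using \<epsilon> H0[OF z(1), of n] by (simp add: e_def norm_divide field_simps)
    qed
    obtain d where d: "d > 0" "\<And>x y. x \<in> E \<Longrightarrow> y \<in> - V \<Longrightarrow> d \<le> dist x y"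
      using separate_compact_closed[OF circle_null_compact[OF E] closed_Compl[OF V(1)]] V(2) by blast
    obtain l where l: "(1/2::real) ^ l < \<epsilon> * d / 2"
      using real_arch_pow_inv[of "\<epsilon> * d / 2" "1/2"] \<epsilon> d by auto
    show "\<exists>M. \<forall>x\<in>cball 0 1. \<forall>m\<ge>M. \<forall>n>m. dist (e m x) (e n x) < \<epsilon>"
    proof (intro exI[of _ "max k l"] ballI allI impI)
      fix z :: complex and m n assume z: "z \<in> cball 0 1" and m: "max k l \<le> m" and n: "m < n"
      show "dist (e m z) (e n z) < \<epsilon>"
      proof (cases "z \<in> V")
        case True
        have "cmod (e m z) < \<epsilon> / 2" "cmod (e n z) < \<epsilon> / 2"
          using eV[OF z True] m n by auto
        then show ?thesis using norm_triangle_ineq4[of "e m z" "e n z"] by (simp add: dist_norm)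
      next
        case False
        have "\<forall>\<zeta>\<in>E. d \<le> dist z \<zeta>" using d(2) False by (auto simp: dist_commute)
        then have t: "cmod (H n z - H m z) \<le> 2 * (1/2)^m / d" using tail[of m n z d] n z d by simp
        have "(1/2::real)^m \<le> (1/2)^l" using m by (intro power_decreasing) auto
        then have "2 * (1/2)^m < \<epsilon> * d" using l by linarith
        then have "2 * (1/2)^m / d < \<epsilon>" using d(1) pos_divide_less_eq by blast
        have "e m z - e n z = (H n z - H m z) * (e m z * e n z)"
          using H0[OF z, of m] H0[OF z, of n] by (simp add: e_def field_simps)
        then have "dist (e m z) (e n z) = cmod (H n z - H m z) * (cmod (e m z) * cmod (e n z))"
          by (simp add: dist_norm norm_mult)
        also have "\<dots> \<le> cmod (H n z - H m z) * (1 * 1)"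
          using enorm[OF z] by (intro mult_left_mono mult_mono) auto
        finally show ?thesis using t \<open>2 * (1/2)^m / d < \<epsilon>\<close> by simp
      qed
    qed
  qed
  then obtain g where g: "uniform_limit (cball 0 1) e g sequentially"
    using uniformly_convergent_eq_Cauchy[of "cball 0 1" e] unfolding uniformly_convergent_on_def by blast
  have gz: "(\<lambda>n. e n z) \<longlonglongrightarrow> g z" if "z \<in> cball 0 1" for z
    using tendsto_uniform_limitI[OF g that] .
  show thesis
  proof (rule that[of "\<lambda>z. 1 - g z"])
    show "(\<lambda>z. 1 - g z) \<in> disc_algebra"
      by (intro disc_algebra_diff disc_algebra_const disc_algebra_uniform_limit[OF eda g])
  next
    fix z assume z: "z \<in> E"
    then have zb: "z \<in> cball 0 1" using E by (auto simp: circle_null_def)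
    have "cmod (e n z) \<le> 4 / real n" if "n > 0" for n
    proof -
      have "real n / 4 = (\<Sum>i<n. 1/4)" by simp
      also have "\<dots> \<le> (\<Sum>i<n. Re (h i z))" using z U(2) zb by (intro sum_mono hU) auto
      finally have "real n / 4 \<le> cmod (H n z)" using complex_Re_le_cmod[of "H n z"] unfolding HR by linarith
      then show ?thesis using that H0[OF zb, of n] by (simp add: e_def norm_divide field_simps)
    qed
    then have "eventually (\<lambda>n. cmod (e n z) \<le> 4 / real n) sequentially"
      by (intro eventually_sequentiallyI[of 1]) simp
    moreover have "(\<lambda>n. 4 / real n) \<longlonglongrightarrow> 0" by (rule lim_const_over_n)
    ultimately have "(\<lambda>n. e n z) \<longlonglongrightarrow> 0" by (rule Lim_null_comparison)
    then show "1 - g z = 1" using LIMSEQ_unique[OF gz[OF zb]] by simp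
  next
    fix z :: complex assume zb: "z \<in> cball 0 1" and zE: "z \<notin> E"
    have "open (-E)" using E by (auto simp: circle_null_def)
    then obtain d where d: "d > 0" "ball z d \<subseteq> - E" using zE open_contains_ball[of "-E"] by auto
    then have dz: "\<forall>\<zeta>\<in>E. d \<le> dist z \<zeta>" by (force simp: linorder_not_less[symmetric] subset_iff)
    have Hb: "cmod (H n z) \<le> 1 + 2 / d" for n
    proof -
      have "cmod (H n z - 1) \<le> 2 / d" using tail[of 0 n z d] zb d dz by (simp add: H_def)
      then show ?thesis using norm_triangle_ineq2[of "H n z" 1] by simp
    qed
    \<comment> \<open>the map \<open>w \<mapsto> 1/w\<close> sends \<open>Re w \<ge> 1\<close> into the disc with diameter from 0 to 1\<close>
    define C where "C = 1 + 2 / d"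
    have C: "C > 0" using d by (simp add: C_def add_pos_pos)
    have "(cmod (1 - e n z))\<^sup>2 \<le> 1 - 1 / C\<^sup>2" for n
    proof -
      have "Re (e n z) = Re (H n z) / (cmod (H n z))\<^sup>2" by (simp add: e_def Re_divide cmod_power2)
      moreover have "(cmod (e n z))\<^sup>2 = 1 / (cmod (H n z))\<^sup>2" by (simp add: e_def norm_divide power_divide)
      moreover have "(cmod (1 - e n z))\<^sup>2 = 1 - 2 * Re (e n z) + (cmod (e n z))\<^sup>2"
        unfolding cmod_power2 by (simp add: power2_eq_square algebra_simps)
      ultimately have "(cmod (1 - e n z))\<^sup>2 = 1 - (2 * Re (H n z) - 1) / (cmod (H n z))\<^sup>2"
        by (simp add: diff_divide_distrib)
      moreover have "1 / C\<^sup>2 \<le> (2 * Re (H n z) - 1) / (cmod (H n z))\<^sup>2"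
      proof (rule frac_le)
        show "1 \<le> 2 * Re (H n z) - 1" using H1[OF zb, of n] by simp
        show "(cmod (H n z))\<^sup>2 \<le> C\<^sup>2" using Hb[of n] by (intro power_mono) (auto simp: C_def)
        show "0 < (cmod (H n z))\<^sup>2" using H0[OF zb, of n] by simp
      qed (use H1[OF zb, of n] in simp)
      ultimately show ?thesis by simp
    qed
    moreover have "(\<lambda>n. (cmod (1 - e n z))\<^sup>2) \<longlonglongrightarrow> (cmod (1 - g z))\<^sup>2"
      using gz[OF zb] by (intro tendsto_intros)
    ultimately have "(cmod (1 - g z))\<^sup>2 \<le> 1 - 1 / C\<^sup>2" by (intro LIMSEQ_le_const2) auto
    also have "\<dots> < 1\<^sup>2" using C by simp
    finally show "cmod (1 - g z) < 1" by (rule power2_less_imp_less) simp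
  qed
qed

text \<open>With peak functions \<open>P\<close> of \<open>A\<close> and \<open>Q\<close> of
  \<open>B\<close>, both \<open>1 - P\<close> and \<open>1 - Q\<close> have nonnegative real part on
  the closed disc, positive off \<open>A\<close> and off \<open>B\<close> respectively. As
  \<open>A\<close> and \<open>B\<close> are disjoint, the sum has no zero, and dividing
  \<open>1 - Q\<close> by it gives 1 where \<open>P\<close> is 1 and 0 where \<open>Q\<close> is
  1.\<close>

lemma disc_algebra_indicator:
  assumes A: "circle_null A" and B: "circle_null B" and AB: "A \<inter> B = {}"
  obtains p where "p \<in> disc_algebra" "\<And>z. z \<in> A \<Longrightarrow> p z = 1" "\<And>z. z \<in> B \<Longrightarrow> p z = 0"
proof -
  obtain P where P: "P \<in> disc_algebra" "\<And>z. z \<in> A \<Longrightarrow> P z = 1" "\<And>z. z \<in> cball 0 1 \<Longrightarrow> z \<notin> A \<Longrightarrow> cmod (P z) < 1"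
    using peak_function[OF A] by blast
  obtain Q where Q: "Q \<in> disc_algebra" "\<And>z. z \<in> B \<Longrightarrow> Q z = 1" "\<And>z. z \<in> cball 0 1 \<Longrightarrow> z \<notin> B \<Longrightarrow> cmod (Q z) < 1"
    using peak_function[OF B] by blast
  have R: "Re (1 - f z) \<ge> 0 \<and> (z \<notin> C \<longrightarrow> Re (1 - f z) > 0)"
    if "\<And>z. z \<in> C \<Longrightarrow> f z = 1" "z \<notin> C \<Longrightarrow> cmod (f z) < 1" for f :: "complex \<Rightarrow> complex" and C z
    using that complex_Re_le_cmod[of "f z"] by (cases "z \<in> C") auto
  have nz: "(1 - Q z) + (1 - P z) \<noteq> 0" if z: "z \<in> cball 0 1" for z
  proof -
    have "Re ((1 - Q z) + (1 - P z)) > 0"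
      using R[of A P z] R[of B Q z] P(2) Q(2) P(3)[OF z] Q(3)[OF z] AB
      by (cases "z \<in> A") auto
    then show ?thesis by (metis less_irrefl zero_complex.sel(1))
  qed
  show thesis
  proof (rule that[of "\<lambda>z. (1 - Q z) / ((1 - Q z) + (1 - P z))"])
    show "(\<lambda>z. (1 - Q z) / ((1 - Q z) + (1 - P z))) \<in> disc_algebra"
      by (intro disc_algebra_divide disc_algebra_add disc_algebra_diff disc_algebra_const P Q nz)
  next
    fix z assume "z \<in> A"
    then have "z \<in> cball 0 1" using A by (auto simp: circle_null_def)
    then show "(1 - Q z) / ((1 - Q z) + (1 - P z)) = 1" using nz[of z] P(2)[OF \<open>z \<in> A\<close>] by simp
  qed (use Q in simp)
qed

text \<open>A high power of a peak function is 1 on \<open>E\<close> and uniformly small on any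
  compact subset of the closed disc that misses \<open>E\<close>. Besides \<open>K\<close>, the set
  where \<open>G\<close> reaches modulus \<open>M'\<close> is of this kind, because \<open>G\<close>
  is at most \<open>M\<close> on \<open>E\<close>; elsewhere the factor does not increase the
  modulus.\<close>

lemma disc_algebra_damping:
  assumes E: "circle_null E" and G: "G \<in> disc_algebra" "\<And>z. z \<in> E \<Longrightarrow> cmod (G z) \<le> M"
    and "M < M'" "0 < M'" and K: "compact K" "K \<subseteq> ball 0 1" and "\<eta> > 0"
  obtains G' where "G' \<in> disc_algebra" "\<And>z. z \<in> E \<Longrightarrow> G' z = G z"
    "\<And>z. z \<in> cball 0 1 \<Longrightarrow> cmod (G' z) \<le> M'" "\<And>z. z \<in> K \<Longrightarrow> cmod (G' z) \<le> \<eta>"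
proof -
  obtain P where P: "P \<in> disc_algebra" "\<And>z. z \<in> E \<Longrightarrow> P z = 1" "\<And>z. z \<in> cball 0 1 \<Longrightarrow> z \<notin> E \<Longrightarrow> cmod (P z) < 1"
    using peak_function[OF E] by blast
  have P1: "cmod (P z) \<le> 1" if "z \<in> cball 0 1" for z
    using P(2)[of z] P(3)[OF that] by (cases "z \<in> E") auto
  have Gc: "continuous_on (cball 0 1) G" and Pc: "continuous_on (cball 0 1) P"
    using G P by (auto simp: disc_algebra_def)
  define S where "S = K \<union> {z \<in> cball 0 1. M' \<le> cmod (G z)}"
  have "closed {z \<in> cball 0 1. M' \<le> cmod (G z)}"
    by (intro continuous_on_closed_Collect_le continuous_intros Gc) auto
  moreover have "bounded {z \<in> cball 0 1. M' \<le> cmod (G z)}"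
    by (rule bounded_subset[OF bounded_cball[of 0 1]]) auto
  ultimately have "compact {z \<in> cball 0 1. M' \<le> cmod (G z)}" by (simp add: compact_eq_bounded_closed)
  then have S: "compact S" unfolding S_def using K by blast
  have SD: "S \<subseteq> cball 0 1" using K by (auto simp: S_def)
  have SE: "z \<notin> E" if "z \<in> S" for z
  proof
    assume "z \<in> E"
    then have "cmod z = 1" using E by (auto simp: circle_null_def)
    then have "z \<notin> K" using K(2) by auto
    then show False using that G(2)[OF \<open>z \<in> E\<close>] \<open>M < M'\<close> by (auto simp: S_def)
  qed
  obtain q where q: "0 \<le> q" "q < 1" "\<And>z. z \<in> S \<Longrightarrow> cmod (P z) \<le> q"
  proof (cases "S = {}")
    case True
    then show thesis using that[of 0] by auto
  next
    case False
    have "continuous_on S (\<lambda>z. cmod (P z))" by (intro continuous_intros continuous_on_subset[OF Pc SD])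
    from continuous_attains_sup[OF S False this] obtain x where
      x: "x \<in> S" "\<And>y. y \<in> S \<Longrightarrow> cmod (P y) \<le> cmod (P x)" by blast
    then show thesis using that[of "cmod (P x)"] P(3)[of x] SD SE by auto
  qed
  have "compact (G ` cball 0 1)" using Gc by (intro compact_continuous_image) auto
  then obtain B where B: "B > 0" "\<And>z. z \<in> cball 0 1 \<Longrightarrow> cmod (G z) \<le> B"
    using compact_imp_bounded[of "G ` cball 0 1"] bounded_pos[of "G ` cball 0 1"] by auto
  define \<theta> where "\<theta> = min \<eta> M'"
  have th: "\<theta> > 0" "\<theta> \<le> \<eta>" "\<theta> \<le> M'" using \<open>\<eta> > 0\<close> \<open>0 < M'\<close> by (auto simp: \<theta>_def)
  obtain m where m: "q ^ m < \<theta> / B" using real_arch_pow_inv[of "\<theta> / B" q] q B th by auto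
  have small: "cmod (P z ^ m * G z) \<le> \<theta>" if z: "z \<in> S" for z
  proof -
    have "cmod (P z ^ m * G z) = cmod (P z) ^ m * cmod (G z)" by (simp add: norm_mult norm_power)
    also have "\<dots> \<le> q ^ m * B" using q(1) q(3)[OF z] B(2)[of z] z SD by (intro mult_mono power_mono) auto
    also have "\<dots> \<le> \<theta>" using m B by (simp add: pos_less_divide_eq)
    finally show ?thesis .
  qed
  show thesis
  proof (rule that[of "\<lambda>z. P z ^ m * G z"])
    show "(\<lambda>z. P z ^ m * G z) \<in> disc_algebra" by (intro disc_algebra_mult disc_algebra_power P G)
    show "P z ^ m * G z = G z" if "z \<in> E" for z using P(2)[OF that] by simp
    show "cmod (P z ^ m * G z) \<le> \<eta>" if "z \<in> K" for z
      using small[of z] that th by (auto simp: S_def)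
    show "cmod (P z ^ m * G z) \<le> M'" if z: "z \<in> cball 0 1" for z
    proof (cases "cmod (G z) < M'")
      case True
      have "cmod (P z ^ m * G z) \<le> 1 * cmod (G z)"
        unfolding norm_mult norm_power by (intro mult_right_mono power_le_one P1 z) auto
      then show ?thesis using True by simp
    next
      case False
      then have "z \<in> S" using z by (auto simp: S_def)
      then show ?thesis using small[of z] th(3) by simp
    qed
  qed
qed

text \<open>On small closed pieces of \<open>E\<close> the function \<open>g\<close> is constant up
  to \<open>M / 2\<close>, and indicators of the pieces assemble these constants. The sup norms of
  the indicators are uncontrolled, so the bound on the whole disc has to come from damping.\<close>

lemma disc_algebra_approx_on_null:
  assumes E: "circle_null E" and g: "continuous_on E g" "\<And>z. z \<in> E \<Longrightarrow> cmod (g z) \<le> M" and "M > 0"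
  shows "\<exists>G\<in>disc_algebra. (\<forall>z\<in>cball 0 1. cmod (G z) \<le> 2 * M) \<and> (\<forall>z\<in>E. cmod (g z - G z) \<le> M / 2)"
proof -
  have "\<exists>N. open N \<and> x \<in> N \<and> (\<forall>z\<in>E \<inter> N. dist (g z) (g x) < M / 2)" if x: "x \<in> E" for x
  proof -
    obtain d where "d > 0" "\<forall>z\<in>E. dist z x < d \<longrightarrow> dist (g z) (g x) < M / 2"
      using g(1) x \<open>M > 0\<close> unfolding continuous_on_iff by (meson half_gt_zero)
    then show ?thesis by (intro exI[of _ "ball x d"]) (auto simp: dist_commute)
  qed
  then have "\<forall>x\<in>E. \<exists>N. open N \<and> x \<in> N \<and> (\<forall>z\<in>E \<inter> N. dist (g z) (g x) < M / 2)" by blast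
  from bchoice[OF this] obtain N where
    N: "\<And>x. x \<in> E \<Longrightarrow> open (N x) \<and> x \<in> N x" "\<And>x z. x \<in> E \<Longrightarrow> z \<in> E \<Longrightarrow> z \<in> N x \<Longrightarrow> dist (g z) (g x) < M / 2"
    by blast
  obtain n y A where A: "\<And>i. i < n \<Longrightarrow> y i \<in> E" "\<And>i. i < n \<Longrightarrow> A i \<subseteq> N (y i)"
    "\<And>i. i < n \<Longrightarrow> closed (A i)" "disjoint_family_on A {..<n::nat}" "E = (\<Union>i<n. A i)"
    using circle_null_partition[OF E N(1)] by blast
  define B where "B i = (\<Union>j\<in>{..<n} - {i}. A j)" for i
  have "\<exists>p. p \<in> disc_algebra \<and> (\<forall>z\<in>A i. p z = 1) \<and> (\<forall>z\<in>B i. p z = 0)" if i: "i < n" for i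
  proof -
    have Ai: "circle_null (A i)" using i A by (intro circle_null_subset[OF E]) auto
    have Bi: "circle_null (B i)" using i A by (intro circle_null_subset[OF E]) (auto simp: B_def)
    have "A i \<inter> B i = {}" using A(4) i unfolding B_def disjoint_family_on_def by blast
    then show ?thesis using disc_algebra_indicator[OF Ai Bi] by metis
  qed
  then have "\<forall>i\<in>{..<n}. \<exists>p. p \<in> disc_algebra \<and> (\<forall>z\<in>A i. p z = 1) \<and> (\<forall>z\<in>B i. p z = 0)" by blast
  from bchoice[OF this] obtain p where
    p: "\<And>i. i < n \<Longrightarrow> p i \<in> disc_algebra" "\<And>i z. i < n \<Longrightarrow> z \<in> A i \<Longrightarrow> p i z = 1" "\<And>i z. i < n \<Longrightarrow> z \<in> B i \<Longrightarrow> p i z = 0"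
    by blast
  define G0 where "G0 z = (\<Sum>i<n. g (y i) * p i z)" for z
  have G0: "G0 \<in> disc_algebra"
    unfolding G0_def using p(1) by (intro disc_algebra_sum disc_algebra_mult disc_algebra_const) auto
  have G0A: "G0 z = g (y i)" if i: "i < n" "z \<in> A i" for i z
  proof -
    have "g (y j) * p j z = (if j = i then g (y i) else 0)" if "j < n" for j
      using p(2)[OF i] p(3)[OF that, of z] i by (auto simp: B_def)
    then have "G0 z = (\<Sum>j<n. if j = i then g (y i) else 0)" unfolding G0_def by (intro sum.cong) auto
    then show ?thesis using i by simp
  qed
  have "cmod (G0 z) \<le> M" if "z \<in> E" for z
  proof -
    have "\<exists>i<n. z \<in> A i" using that A(5) by blast
    then show ?thesis using G0A g(2) A(1) by metis
  qed
  then obtain G where G: "G \<in> disc_algebra" "\<And>z. z \<in> E \<Longrightarrow> G z = G0 z" "\<And>z. z \<in> cball 0 1 \<Longrightarrow> cmod (G z) \<le> 2 * M"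
    using disc_algebra_damping[OF E G0, of M "2 * M" "{}" 1] \<open>M > 0\<close> by auto
  have "cmod (g z - G z) \<le> M / 2" if z: "z \<in> E" for z
  proof -
    obtain i where i: "i < n" "z \<in> A i" using z A(5) by blast
    have "dist (g z) (g (y i)) < M / 2" using N(2)[OF A(1)[OF i(1)] z] A(2)[OF i(1)] i by blast
    then show ?thesis using G(2)[OF z] G0A[OF i] by (simp add: dist_norm)
  qed
  with G show ?thesis by (intro bexI[of _ G]) auto
qed

text \<open>Successive approximation: each step halves the error on \<open>E\<close> at the price of
  a correction of at most twice the current error bound. The corrections sum to at most
  \<open>4 * M\<close>, and the values on \<open>E\<close> become exact in the limit.\<close>

theorem Rudin_Carleson:
  assumes E: "circle_null E" and g: "continuous_on E g" "\<And>z. z \<in> E \<Longrightarrow> cmod (g z) \<le> M" and "M > 0"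
  obtains G where "G \<in> disc_algebra" "\<And>z. z \<in> E \<Longrightarrow> G z = g z" "\<And>z. z \<in> cball 0 1 \<Longrightarrow> cmod (G z) \<le> 4 * M"
proof -
  define Q where "Q n u \<longleftrightarrow> continuous_on E u \<and> (\<forall>z\<in>E. cmod (u z) \<le> M / 2^n)" for n and u :: "complex \<Rightarrow> complex"
  define S where "S n u v \<longleftrightarrow> (\<exists>G\<in>disc_algebra. (\<forall>z\<in>cball 0 1. cmod (G z) \<le> 2 * M / 2^n) \<and> v = (\<lambda>z. u z - G z))"
    for n and u v :: "complex \<Rightarrow> complex"
  have "\<exists>u. (\<forall>n. Q n (u n) \<and> S n (u n) (u (Suc n))) \<and> u 0 = g"
  proof -
    \<comment> \<open>\<open>u n\<close> is the error left on \<open>E\<close> after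
      \<open>n\<close> corrections; the clause for \<open>n = 0\<close> fixes the start of the
      dependent choice at \<open>g\<close>.\<close>
    have "\<exists>u. \<forall>n. (Q n (u n) \<and> (n = 0 \<longrightarrow> u n = g)) \<and> S n (u n) (u (Suc n))"
    proof (rule dependent_nat_choice)
      show "\<exists>u. Q 0 u \<and> (0 = (0::nat) \<longrightarrow> u = g)" using g by (auto simp: Q_def)
      fix u n assume "Q n u \<and> (n = 0 \<longrightarrow> u = g)"
      then have u: "continuous_on E u" "\<And>z. z \<in> E \<Longrightarrow> cmod (u z) \<le> M / 2^n" by (auto simp: Q_def)
      have "M / 2^n > 0" using \<open>M > 0\<close> by simp
      from disc_algebra_approx_on_null[OF E u this] obtain G where
        G: "G \<in> disc_algebra" "\<forall>z\<in>cball 0 1. cmod (G z) \<le> 2 * (M / 2^n)" "\<forall>z\<in>E. cmod (u z - G z) \<le> M / 2^n / 2"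
        by blast
      have "E \<subseteq> cball 0 1" using E sphere_cball[of "0::complex" 1] unfolding circle_null_def by blast
      then have "continuous_on E G"
        using G(1) continuous_on_subset[of "cball 0 1" G E] by (simp add: disc_algebra_def)
      then have "Q (Suc n) (\<lambda>z. u z - G z)" using u G(3) by (auto simp: Q_def field_simps intro!: continuous_intros)
      moreover have "S n u (\<lambda>z. u z - G z)" unfolding S_def using G by (intro bexI[of _ G]) auto
      ultimately show "\<exists>v. (Q (Suc n) v \<and> (Suc n = 0 \<longrightarrow> v = g)) \<and> S n u v" by blast
    qed
    then show ?thesis by blast
  qed
  then obtain u where u: "\<And>n. Q n (u n)" "\<And>n. S n (u n) (u (Suc n))" "u 0 = g" by blast
  have "\<forall>n. \<exists>G. G\<in>disc_algebra \<and> (\<forall>z\<in>cball 0 1. cmod (G z) \<le> 2 * M / 2^n) \<and> u (Suc n) = (\<lambda>z. u n z - G z)"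
    using u(2) unfolding S_def by blast
  from choice[OF this] obtain G where
    G: "\<And>n. G n \<in> disc_algebra" "\<And>n z. z \<in> cball 0 1 \<Longrightarrow> cmod (G n z) \<le> 2 * M / 2^n"
       "\<And>n. u (Suc n) = (\<lambda>z. u n z - G n z)" by blast
  have sums: "(\<lambda>n. 2 * M / 2^n) sums (4 * M)"
    using sums_mult[OF geometric_sums[of "1/2::real"], of "2 * M"] by (simp add: power_one_over field_simps)
  have ul: "uniform_limit (cball 0 1) (\<lambda>n z. \<Sum>i<n. G i z) (\<lambda>z. \<Sum>i. G i z) sequentially"
    using G(2) sums_summable[OF sums] by (intro Weierstrass_m_test) auto
  show thesis
  proof (rule that[of "\<lambda>z. \<Sum>i. G i z"])
    show "(\<lambda>z. \<Sum>i. G i z) \<in> disc_algebra"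
      by (rule disc_algebra_uniform_limit[OF _ ul]) (intro disc_algebra_sum G)
  next
    fix z :: complex assume z: "z \<in> cball 0 1"
    have "cmod (\<Sum>i. G i z) \<le> (\<Sum>i. 2 * M / 2^i)"
      using G(2)[OF z] sums_summable[OF sums] by (intro norm_suminf_le)
    then show "cmod (\<Sum>i. G i z) \<le> 4 * M" using sums_unique[OF sums] by simp
  next
    fix z assume z: "z \<in> E"
    have zb: "z \<in> cball 0 1" using z E by (auto simp: circle_null_def)
    have ps: "(\<Sum>i<n. G i z) = g z - u n z" for n
      by (induction n) (auto simp: u(3) G(3))
    have "(\<lambda>n. M / 2^n) \<longlonglongrightarrow> 0"
      using tendsto_mult[OF tendsto_const[of M] LIMSEQ_realpow_zero[of "1/2::real"]] by (simp add: power_one_over)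
    moreover have "eventually (\<lambda>n. cmod (u n z) \<le> M / 2^n) sequentially"
      using u(1) z by (auto simp: Q_def)
    ultimately have "(\<lambda>n. u n z) \<longlonglongrightarrow> 0" by (rule Lim_null_comparison[rotated])
    then have "(\<lambda>n. \<Sum>i<n. G i z) \<longlonglongrightarrow> g z - 0" unfolding ps by (intro tendsto_intros)
    moreover have "(\<lambda>n. \<Sum>i<n. G i z) \<longlonglongrightarrow> (\<Sum>i. G i z)" using tendsto_uniform_limitI[OF ul zb] .
    ultimately show "(\<Sum>i. G i z) = g z" using LIMSEQ_unique by fastforce
  qed
qed

section \<open>Holomorphic functions of several variables\<close>

text \<open>A basic open set of the product topology constrains each coordinate separately. From
  index \<open>n\<close> on both points vanish, so only finitely many radii count and their minimum
  is positive.\<close>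

lemma cspace_open_contains_polydisc:
  assumes V: "openin (top_of_set (cspace n)) V" and p: "p \<in> V"
  obtains \<epsilon> where "\<epsilon> > 0" "\<And>z. z \<in> cspace n \<Longrightarrow> (\<And>i. i < n \<Longrightarrow> cmod (z i - p i) < \<epsilon>) \<Longrightarrow> z \<in> V"
proof -
  obtain T where T: "open T" "V = cspace n \<inter> T" using V by (auto simp: openin_open)
  have pc: "p \<in> cspace n" "p \<in> T" using T p by auto
  obtain X where X: "p \<in> (\<Pi>\<^sub>E i\<in>UNIV. X i)" "\<And>i. open (X i)" "(\<Pi>\<^sub>E i\<in>UNIV. X i) \<subseteq> T"
    using product_topology_open_contains_basis[of "\<lambda>_. euclidean" UNIV T p] T(1) pc(2)
    unfolding open_fun_def by (metis open_openin)
  have "\<forall>i. \<exists>e>0. ball (p i) e \<subseteq> X i" using X open_contains_ball by (metis PiE_mem UNIV_I)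
  then obtain e where e: "\<And>i. e i > 0" "\<And>i. ball (p i) (e i) \<subseteq> X i" by metis
  define \<epsilon> where "\<epsilon> = Min (insert 1 (e ` {..<n}))"
  show thesis
  proof
    show "\<epsilon> > 0" unfolding \<epsilon>_def using e by (subst Min_gr_iff) auto
    fix z assume z: "z \<in> cspace n" "\<And>i. i < n \<Longrightarrow> cmod (z i - p i) < \<epsilon>"
    have "z i \<in> X i" for i
    proof (cases "i < n")
      case True
      then have "\<epsilon> \<le> e i" unfolding \<epsilon>_def by (intro Min_le) auto
      then have "z i \<in> ball (p i) (e i)" using z(2)[OF True] by (simp add: dist_norm norm_minus_commute)
      then show ?thesis using e by blast
    next
      case False
      then have "z i = p i" using z pc by (simp add: cspace_def)
      then show ?thesis using X(1) by auto
    qed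
    then have "z \<in> T" using X(3) by auto
    then show "z \<in> V" using T z by simp
  qed
qed

lemma cn_holomorphic_on_subset:
  "cn_holomorphic_on n V g \<Longrightarrow> U \<subseteq> V \<Longrightarrow> cn_holomorphic_on n U g"
  unfolding cn_holomorphic_on_def by (blast intro: continuous_on_subset)

lemma cn_holomorphic_map_subset:
  "cn_holomorphic_map n m V g \<Longrightarrow> U \<subseteq> V \<Longrightarrow> cn_holomorphic_map n m U g"
  unfolding cn_holomorphic_map_def by (blast intro: cn_holomorphic_on_subset)

lemma cn_holomorphic_map_continuous:
  assumes "cn_holomorphic_map n m V g"
  shows "continuous_on V g"
proof (rule continuous_on_coordinatewise_then_product)
  fix j
  show "continuous_on V (\<lambda>z. g z j)"
  proof (cases "j < m")
    case True
    then show ?thesis using assms by (auto simp: cn_holomorphic_map_def cn_holomorphic_on_def)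
  next
    case False
    then have "g z j = 0" if "z \<in> V" for z using assms that by (auto simp: cn_holomorphic_map_def cspace_def)
    then show ?thesis by (simp cong: continuous_on_cong)
  qed
qed

lemma Schwarz_bound:
  assumes f: "f holomorphic_on ball a r" "f a = 0" and b: "\<And>z. z \<in> ball a r \<Longrightarrow> cmod (f z) < b"
    and r: "r > 0" and b0: "b > 0" and z: "z \<in> ball a r"
  shows "cmod (f z) \<le> b / r * dist z a"
proof -
  define g where "g w = f (a + of_real r * w) / of_real b" for w
  have inb: "a + of_real r * w \<in> ball a r" if "cmod w < 1" for w
    using that r by (simp add: dist_norm norm_mult)
  have "(f \<circ> (\<lambda>w. a + of_real r * w)) holomorphic_on ball 0 1"
  proof (rule holomorphic_on_compose_gen[OF _ f(1)])
    show "(\<lambda>w. a + of_real r * w) ` ball 0 1 \<subseteq> ball a r" using inb by auto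
  qed (intro holomorphic_intros)
  then have "(\<lambda>w. f (a + of_real r * w)) holomorphic_on ball 0 1" by (simp add: o_def)
  then have "g holomorphic_on ball 0 1" unfolding g_def using b0 by (intro holomorphic_intros) auto
  moreover have "g 0 = 0" using f(2) by (simp add: g_def)
  moreover have "cmod (g w) < 1" if "cmod w < 1" for w
    using b[OF inb[OF that]] b0 by (simp add: g_def norm_divide)
  moreover have w: "cmod ((z - a) / of_real r) < 1"
    using z r by (simp add: norm_divide dist_norm norm_minus_commute)
  ultimately have "cmod (g ((z - a) / of_real r)) \<le> cmod ((z - a) / of_real r)"
    by (rule Schwarz_Lemma(1))
  then show ?thesis using r b0 by (simp add: g_def norm_divide dist_norm field_simps)
qed

text \<open>The idea: by the Schwarz lemma, the difference quotients in the first variable depend continuously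
  on the second one, uniformly.\<close>

lemma separately_holomorphic_diagonal:
  fixes \<Phi> :: "complex \<Rightarrow> complex \<Rightarrow> complex"
  assumes T: "open T" and c: "continuous_on (T \<times> T) (\<lambda>(t, u). \<Phi> t u)"
    and h1: "\<And>u. u \<in> T \<Longrightarrow> (\<lambda>t. \<Phi> t u) holomorphic_on T"
    and h2: "\<And>t. t \<in> T \<Longrightarrow> \<Phi> t holomorphic_on T"
  shows "(\<lambda>t. \<Phi> t t) holomorphic_on T"
proof -
  have "(\<lambda>t. \<Phi> t t) field_differentiable at a" if a: "a \<in> T" for a
  proof -
    obtain r where r: "r > 0" "cball a r \<subseteq> T" using T a open_contains_cball by blast
    have h1a: "(\<lambda>t. \<Phi> t a) field_differentiable at a" and h2a: "\<Phi> a field_differentiable at a"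
      using h1[OF a] h2[OF a] T a by (auto simp: holomorphic_on_open field_differentiable_def)
    then obtain D1 D2 where
      D1: "((\<lambda>t. (\<Phi> t a - \<Phi> a a) / (t - a)) \<longlongrightarrow> D1) (at a)" and
      D2: "((\<lambda>u. (\<Phi> a u - \<Phi> a a) / (u - a)) \<longlongrightarrow> D2) (at a)"
      by (auto simp: field_differentiable_def has_field_derivative_iff)
    have uc: "uniformly_continuous_on (cball a r \<times> cball a r) (\<lambda>(t, u). \<Phi> t u)"
      using r by (intro compact_uniformly_continuous continuous_on_subset[OF c] compact_Times) auto
    \<comment> \<open>The mixed second difference: the difference quotient along the diagonal is
      \<open>R\<close> plus the two partial difference quotients. For fixed \<open>u\<close> the
      numerator vanishes at \<open>t = a\<close> and is uniformly small, so the Schwarz lemma bounds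
      it by a small multiple of \<open>dist u a\<close>.\<close>
    define R where "R t = (\<Phi> t t - \<Phi> t a - (\<Phi> a t - \<Phi> a a)) / (t - a)" for t
    have "(R \<longlongrightarrow> 0) (at a)"
    proof (rule tendstoI)
      fix \<epsilon> :: real assume \<epsilon>: "\<epsilon> > 0"
      have "\<epsilon> * r / 4 > 0" using \<epsilon> r by simp
      with uc obtain d where d: "d > 0"
        "\<And>x y. x \<in> cball a r \<times> cball a r \<Longrightarrow> y \<in> cball a r \<times> cball a r \<Longrightarrow> dist y x < d \<Longrightarrow>
           dist (case y of (t, u) \<Rightarrow> \<Phi> t u) (case x of (t, u) \<Rightarrow> \<Phi> t u) < \<epsilon> * r / 4"
        unfolding uniformly_continuous_on_def by meson
      have "dist (R u) 0 < \<epsilon>" if u: "dist u a < min d r" "u \<noteq> a" for u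
      proof -
        define f where "f t = \<Phi> t u - \<Phi> t a - (\<Phi> a u - \<Phi> a a)" for t
        have uT: "u \<in> cball a r" using u by (simp add: dist_commute)
        have diff: "cmod (\<Phi> t u - \<Phi> t a) < \<epsilon> * r / 4" if "t \<in> cball a r" for t
          using d(2)[of "(t, a)" "(t, u)"] that uT u r by (simp add: dist_Pair_Pair dist_norm)
        have "f holomorphic_on ball a r"
          unfolding f_def using r uT a
          by (intro holomorphic_intros holomorphic_on_subset[OF h1]) auto
        moreover have "f a = 0" by (simp add: f_def)
        moreover have "cmod (f t) < \<epsilon> * r / 2" if "t \<in> ball a r" for t
        proof -
          have "cmod (f t) \<le> cmod (\<Phi> t u - \<Phi> t a) + cmod (\<Phi> a u - \<Phi> a a)"
            unfolding f_def by (rule norm_triangle_ineq4)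
          then show ?thesis using diff[of t] diff[of a] that r by simp
        qed
        ultimately have "cmod (f u) \<le> \<epsilon> * r / 2 / r * dist u a"
          using r \<epsilon> u by (intro Schwarz_bound) (auto simp: dist_commute)
        then have "cmod (f u) / dist u a \<le> \<epsilon> / 2" using r u by (simp add: divide_le_eq)
        moreover have "dist (R u) 0 = cmod (f u) / dist u a" by (simp add: R_def f_def norm_divide dist_norm)
        ultimately show ?thesis using \<epsilon> by linarith
      qed
      then show "\<forall>\<^sub>F x in at a. dist (R x) 0 < \<epsilon>"
        unfolding eventually_at using d(1) r(1) by (intro exI[of _ "min d r"]) auto
    qed
    then have "((\<lambda>t. R t + (\<Phi> t a - \<Phi> a a) / (t - a) + (\<Phi> a t - \<Phi> a a) / (t - a)) \<longlongrightarrow> 0 + D1 + D2) (at a)"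
      by (intro tendsto_intros D1 D2)
    moreover have "R t + (\<Phi> t a - \<Phi> a a) / (t - a) + (\<Phi> a t - \<Phi> a a) / (t - a) = (\<Phi> t t - \<Phi> a a) / (t - a)" for t
      by (simp add: R_def flip: add_divide_distrib)
    ultimately have "((\<lambda>t. \<Phi> t t) has_field_derivative (0 + D1 + D2)) (at a)"
      by (simp add: has_field_derivative_iff)
    then show ?thesis by (auto simp: field_differentiable_def)
  qed
  then show ?thesis using T by (simp add: holomorphic_on_def field_differentiable_at_within)
qed

text \<open>Holomorphy is defined as continuity plus separate holomorphy, which gives no immediate
  chain rule for a curve that moves all coordinates at once. The coordinates are therefore released
  one at a time, each release passing to the diagonal of a function of two variables.\<close>

lemma cn_holomorphic_along_curve:
  assumes V: "openin (top_of_set (cspace n)) V" and g: "cn_holomorphic_on n V g"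
    and T: "open T" and h: "h ` T \<subseteq> V" "\<And>i. i < n \<Longrightarrow> (\<lambda>t. h t i) holomorphic_on T"
  shows "(\<lambda>t. g (h t)) holomorphic_on T"
proof -
  have Vc: "V \<subseteq> cspace n" using openin_imp_subset[OF V] .
  have "(\<lambda>t. g (h t)) field_differentiable at a" if a: "a \<in> T" for a
  proof -
    obtain \<epsilon> where \<epsilon>: "\<epsilon> > 0" "\<And>z. z \<in> cspace n \<Longrightarrow> (\<And>i. i < n \<Longrightarrow> cmod (z i - h a i) < \<epsilon>) \<Longrightarrow> z \<in> V"
      using cspace_open_contains_polydisc[OF V, of "h a"] h a by blast
    \<comment> \<open>A product set: points mixing coordinates of \<open>h t\<close> with those of
      another point of \<open>B\<close> remain in \<open>B\<close>, hence in the domain of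
      \<open>g\<close>.\<close>
    define B where "B = {z \<in> cspace n. \<forall>i<n. cmod (z i - h a i) < \<epsilon>}"
    have BV: "B \<subseteq> V" using \<epsilon> by (auto simp: B_def)
    define W where "W = T \<inter> (\<Inter>i<n. {t \<in> T. cmod (h t i - h a i) < \<epsilon>})"
    have hc: "continuous_on T (\<lambda>t. h t i)" if "i < n" for i
      using h(2)[OF that] by (rule holomorphic_on_imp_continuous_on)
    have "open {t \<in> T. cmod (h t i - h a i) < \<epsilon>}" if "i < n" for i
    proof -
      have "open (T \<inter> (\<lambda>t. cmod (h t i - h a i)) -` {..<\<epsilon>})"
        by (intro continuous_open_preimage T continuous_intros hc that)
      moreover have "T \<inter> (\<lambda>t. cmod (h t i - h a i)) -` {..<\<epsilon>} = {t \<in> T. cmod (h t i - h a i) < \<epsilon>}" by auto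
      ultimately show ?thesis by simp
    qed
    then have W: "open W" unfolding W_def using T by (intro open_Int open_INT ballI) simp_all
    have aW: "a \<in> W" using a \<epsilon> by (auto simp: W_def)
    have WT: "W \<subseteq> T" by (auto simp: W_def)
    have hB: "h t \<in> B" if "t \<in> W" for t using that h(1) Vc by (auto simp: W_def B_def)
    \<comment> \<open>The first \<open>j\<close> coordinates follow the curve and the others stay
      frozen at \<open>z\<close>; the induction on \<open>j\<close> must allow arbitrary
      \<open>z\<close>, because the next coordinate is first varied independently.\<close>
    define M where "M j t z i = (if i < j then h t i else z i)" for j :: nat and t and z :: "nat \<Rightarrow> complex" and i
    have MB: "M j t z \<in> B" if "t \<in> W" "z \<in> B" for j t z
      using hB[OF that(1)] that(2) by (auto simp: M_def B_def cspace_def)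
    have upd: "z(i := w i) \<in> B" if "z \<in> B" "w \<in> B" for z w i
      using that by (auto simp: B_def cspace_def)
    have gB: "cn_holomorphic_on n B g" using cn_holomorphic_on_subset[OF g BV] .
    have "(\<lambda>t. g (M j t z)) holomorphic_on W" if "j \<le> n" "z \<in> B" for j z
      using that
    proof (induction j arbitrary: z)
      case 0
      then show ?case by (simp add: M_def)
    next
      case (Suc j)
      define \<Phi> where "\<Phi> t u = g (M j t (z(j := h u j)))" for t u
      have inB: "M j t (z(j := h u j)) \<in> B" if "t \<in> W" "u \<in> W" for t u
        using MB upd Suc.prems hB that by simp
      have "(\<lambda>t. \<Phi> t t) holomorphic_on W"
      proof (rule separately_holomorphic_diagonal[where \<Phi> = \<Phi>, OF W])
        have cont: "continuous_on (W \<times> W) (\<lambda>(t, u). M j t (z(j := h u j)))"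
          unfolding case_prod_beta
        proof (rule continuous_on_coordinatewise_then_product)
          fix i
          have cj: "continuous_on (W \<times> W) (\<lambda>x. h (snd x) j)"
            using continuous_on_compose2[OF continuous_on_subset[OF hc[of j] WT], of "W \<times> W" snd] Suc.prems continuous_on_snd[OF continuous_on_id, of "W \<times> W"]
            by (auto intro: continuous_intros)
          have ci: "continuous_on (W \<times> W) (\<lambda>x. h (fst x) i)" if "i < j"
            using continuous_on_compose2[OF continuous_on_subset[OF hc[of i] WT], of "W \<times> W" fst] Suc.prems that continuous_on_fst[OF continuous_on_id, of "W \<times> W"]
            by (auto intro: continuous_intros)
          show "continuous_on (W \<times> W) (\<lambda>x. M j (fst x) (z(j := h (snd x) j)) i)"
            using ci cj by (cases "i < j"; cases "i = j") (auto simp: M_def)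
        qed
        show "continuous_on (W \<times> W) (\<lambda>(t, u). \<Phi> t u)"
        proof -
          have "(\<lambda>(t, u). M j t (z(j := h u j))) ` (W \<times> W) \<subseteq> B" using inB by auto
          with continuous_on_compose2[OF _ cont, of B g] gB show ?thesis
            by (simp add: cn_holomorphic_on_def \<Phi>_def case_prod_unfold)
        qed
        show "(\<lambda>t. \<Phi> t u) holomorphic_on W" if "u \<in> W" for u
          unfolding \<Phi>_def using Suc.IH Suc.prems upd hB[OF that] by simp
        show "\<Phi> t holomorphic_on W" if t: "t \<in> W" for t
        proof -
          have "\<Phi> t field_differentiable at u" if u: "u \<in> W" for u
          proof -
            define y where "y = M j t (z(j := h u j))"
            have yj: "y j = h u j" by (simp add: y_def M_def)
            have "(\<lambda>s. g (y(j := s))) field_differentiable at (h u j)"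
            proof -
              have "y \<in> B" using inB[OF t u] by (simp add: y_def)
              then have "(\<lambda>s. g (y(j := s))) field_differentiable at (y j)"
                using gB Suc.prems(1) unfolding cn_holomorphic_on_def by auto
              then show ?thesis by (simp add: yj)
            qed
            moreover have "(\<lambda>v. h v j) field_differentiable at u"
              using h(2)[of j] Suc.prems(1) u WT T by (auto simp: holomorphic_on_open field_differentiable_def)
            ultimately have "((\<lambda>s. g (y(j := s))) \<circ> (\<lambda>v. h v j)) field_differentiable at u"
              by (intro field_differentiable_compose)
            moreover have "(\<lambda>s. g (y(j := s))) \<circ> (\<lambda>v. h v j) = \<Phi> t"
            proof
              fix v
              have "y(j := h v j) = M j t (z(j := h v j))" by (auto simp: y_def M_def)
              then show "((\<lambda>s. g (y(j := s))) \<circ> (\<lambda>v. h v j)) v = \<Phi> t v" by (simp add: \<Phi>_def)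
            qed
            ultimately show ?thesis by simp
          qed
          then show ?thesis by (simp add: holomorphic_on_def field_differentiable_at_within)
        qed
      qed
      moreover have "M j t (z(j := h t j)) = M (Suc j) t z" for t
        by (auto simp: M_def less_Suc_eq)
      ultimately show ?case by (simp add: \<Phi>_def)
    qed
    from this[of n "h a"] have "(\<lambda>t. g (M n t (h a))) holomorphic_on W" using hB aW by simp
    moreover have "M n t (h a) = h t" if "t \<in> W" for t
    proof
      fix i show "M n t (h a) i = h t i"
        using hB[OF that] hB[OF aW] by (cases "i < n") (auto simp: M_def B_def cspace_def)
    qed
    ultimately have "(\<lambda>t. g (h t)) holomorphic_on W" by (simp cong: holomorphic_cong)
    then show ?thesis using W aW by (auto simp: holomorphic_on_open field_differentiable_def)
  qed
  then show ?thesis by (simp add: holomorphic_on_def field_differentiable_at_within)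
qed

text \<open>Along a single coordinate line the inner map is a holomorphic curve, so the curve case
  applies to each variable in turn.\<close>

lemma cn_holomorphic_on_compose:
  assumes U: "openin (top_of_set (cspace k)) U" and V: "openin (top_of_set (cspace n)) V"
    and h: "cn_holomorphic_map k n U h" "h ` U \<subseteq> V" and g: "cn_holomorphic_on n V g"
  shows "cn_holomorphic_on k U (\<lambda>z. g (h z))"
  unfolding cn_holomorphic_on_def
proof (intro conjI ballI allI impI)
  show "continuous_on U (\<lambda>z. g (h z))"
    using continuous_on_compose2[of V g U h] g h cn_holomorphic_map_continuous[OF h(1)]
    by (auto simp: cn_holomorphic_on_def)
  fix z i assume z: "z \<in> U" and i: "i < k"
  obtain \<epsilon> where \<epsilon>: "\<epsilon> > 0" "\<And>w. w \<in> cspace k \<Longrightarrow> (\<And>i. i < k \<Longrightarrow> cmod (w i - z i) < \<epsilon>) \<Longrightarrow> w \<in> U"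
    using cspace_open_contains_polydisc[OF U z] by blast
  have zc: "z \<in> cspace k" using openin_imp_subset[OF U] z by blast
  have upd: "z(i := t) \<in> U" if "t \<in> ball (z i) \<epsilon>" for t
    using that zc i \<epsilon>(1) by (intro \<epsilon>(2)) (auto simp: cspace_def dist_norm norm_minus_commute)
  have "(\<lambda>t. g (h (z(i := t)))) holomorphic_on ball (z i) \<epsilon>"
  proof (rule cn_holomorphic_along_curve[OF V g open_ball])
    show "(\<lambda>t. h (z(i := t))) ` ball (z i) \<epsilon> \<subseteq> V" using upd h(2) by blast
    fix j assume j: "j < n"
    have "(\<lambda>t. h (z(i := t)) j) field_differentiable at s" if s: "s \<in> ball (z i) \<epsilon>" for s
    proof -
      have "(\<lambda>t. h ((z(i := s))(i := t)) j) field_differentiable at ((z(i := s)) i)"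
        using h(1) j upd[OF s] i unfolding cn_holomorphic_map_def cn_holomorphic_on_def by blast
      then show ?thesis by simp
    qed
    then show "(\<lambda>t. h (z(i := t)) j) holomorphic_on ball (z i) \<epsilon>"
      by (simp add: holomorphic_on_def field_differentiable_at_within)
  qed
  then show "(\<lambda>t. g (h (z(i := t)))) field_differentiable at (z i)"
    using \<epsilon>(1) by (auto simp: holomorphic_on_open field_differentiable_def)
qed

lemma cn_holomorphic_map_compose:
  assumes "openin (top_of_set (cspace k)) U" "openin (top_of_set (cspace n)) V"
    and "cn_holomorphic_map k n U h" "h ` U \<subseteq> V" and g: "cn_holomorphic_map n m V g"
  shows "cn_holomorphic_map k m U (\<lambda>z. g (h z))"
  using g cn_holomorphic_on_compose[OF assms(1-4)] assms(4)
  unfolding cn_holomorphic_map_def by (auto simp: image_subset_iff)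

section \<open>The polydisc as a Stein manifold\<close>

text \<open>The derivative at \<open>z\<close> involves the values at nearby points
  \<open>z(i := t)\<close>; openness of \<open>V\<close> in \<open>cspace n\<close> keeps these in
  \<open>V\<close>, where the two functions agree.\<close>

lemma cn_holomorphic_on_cong:
  assumes V: "openin (top_of_set (cspace n)) V" and eq: "\<And>z. z \<in> V \<Longrightarrow> f z = g z"
    and f: "cn_holomorphic_on n V f"
  shows "cn_holomorphic_on n V g"
  unfolding cn_holomorphic_on_def
proof (intro conjI ballI allI impI)
  show "continuous_on V g" using f eq by (simp add: cn_holomorphic_on_def cong: continuous_on_cong)
  fix z i assume z: "z \<in> V" and i: "i < n"
  obtain \<epsilon> where \<epsilon>: "\<epsilon> > 0" "\<And>w. w \<in> cspace n \<Longrightarrow> (\<And>i. i < n \<Longrightarrow> cmod (w i - z i) < \<epsilon>) \<Longrightarrow> w \<in> V"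
    using cspace_open_contains_polydisc[OF V z] by blast
  have zc: "z \<in> cspace n" using openin_imp_subset[OF V] z by blast
  obtain D where "((\<lambda>t. f (z(i := t))) has_field_derivative D) (at (z i))"
    using f z i by (auto simp: cn_holomorphic_on_def field_differentiable_def)
  then have "((\<lambda>t. g (z(i := t))) has_field_derivative D) (at (z i))"
  proof (rule has_field_derivative_transform_within_open[of _ _ _ "ball (z i) \<epsilon>"])
    fix t assume "t \<in> ball (z i) \<epsilon>"
    then have "z(i := t) \<in> V"
      using zc i \<epsilon>(1) by (intro \<epsilon>(2)) (auto simp: cspace_def dist_norm norm_minus_commute)
    then show "f (z(i := t)) = g (z(i := t))" by (rule eq)
  qed (use \<epsilon> in auto)
  then show "(\<lambda>t. g (z(i := t))) field_differentiable at (z i)" by (auto simp: field_differentiable_def)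
qed

lemma cn_holomorphic_map_cong:
  assumes "openin (top_of_set (cspace n)) V" "\<And>z. z \<in> V \<Longrightarrow> f z = g z"
    and "cn_holomorphic_map n m V f"
  shows "cn_holomorphic_map n m V g"
  unfolding cn_holomorphic_map_def
proof (intro conjI allI impI)
  show "g ` V \<subseteq> cspace m" using assms(2,3) by (auto simp: cn_holomorphic_map_def)
  show "cn_holomorphic_on n V (\<lambda>z. g z j)" if "j < m" for j
    by (rule cn_holomorphic_on_cong[OF assms(1), of "\<lambda>z. f z j"])
       (use assms that in \<open>auto simp: cn_holomorphic_map_def\<close>)
qed

lemma cn_holomorphic_map_local:
  assumes "\<And>z. z \<in> A \<Longrightarrow> \<exists>T. open T \<and> z \<in> T \<and> cn_holomorphic_map n m (A \<inter> T) f"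
  shows "cn_holomorphic_map n m A f"
proof -
  have "f z \<in> cspace m" if "z \<in> A" for z
    using assms[OF that] that by (auto simp: cn_holomorphic_map_def)
  moreover have "cn_holomorphic_on n A (\<lambda>z. f z j)" if j: "j < m" for j
  proof -
    have loc: "\<exists>T. open T \<and> z \<in> T \<and> cn_holomorphic_on n (A \<inter> T) (\<lambda>z. f z j)" if "z \<in> A" for z
      using assms[OF that] j unfolding cn_holomorphic_map_def by blast
    have "continuous (at z within A) (\<lambda>z. f z j)" if z: "z \<in> A" for z
    proof -
      obtain T where T: "open T" "z \<in> T" "cn_holomorphic_on n (A \<inter> T) (\<lambda>z. f z j)" using loc[OF z] by blast
      have "at z within A = at z within (A \<inter> T)" using T by (intro at_within_nhd) auto
      then show ?thesis using T z by (simp add: cn_holomorphic_on_def continuous_on_eq_continuous_within)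
    qed
    moreover have "(\<lambda>t. f (z(i := t)) j) field_differentiable at (z i)" if z: "z \<in> A" "i < n" for z i
      using loc[OF z(1)] z by (auto simp: cn_holomorphic_on_def)
    ultimately show ?thesis by (auto simp: cn_holomorphic_on_def continuous_on_eq_continuous_within)
  qed
  ultimately show ?thesis by (auto simp: cn_holomorphic_map_def)
qed

lemma cn_holomorphic_map_restrict_dim:
  "cn_holomorphic_map n m V f \<Longrightarrow> k \<le> n \<Longrightarrow> cn_holomorphic_map k m V f"
  by (auto simp: cn_holomorphic_map_def cn_holomorphic_on_def)

lemma cn_holomorphic_on_coordinate: "cn_holomorphic_on n V (\<lambda>z. z j)"
  unfolding cn_holomorphic_on_def
proof (intro conjI ballI allI impI)
  show "continuous_on V (\<lambda>z. z j)" by (rule continuous_on_subset[OF continuous_on_product_coordinates]) simp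
  fix z :: "nat \<Rightarrow> complex" and i
  show "(\<lambda>t. (z(i := t)) j) field_differentiable at (z i)" by (cases "i = j") auto
qed

lemma cn_holomorphic_on_const: "cn_holomorphic_on n V (\<lambda>z. c)"
  by (auto simp: cn_holomorphic_on_def)

lemma cn_holomorphic_on_entire:
  assumes "cn_holomorphic_on n V f" "g holomorphic_on UNIV"
  shows "cn_holomorphic_on n V (\<lambda>z. g (f z))"
  unfolding cn_holomorphic_on_def
proof (intro conjI ballI allI impI)
  show "continuous_on V (\<lambda>z. g (f z))"
    using assms holomorphic_on_imp_continuous_on[OF assms(2)] continuous_on_compose2[of UNIV g V f]
    by (auto simp: cn_holomorphic_on_def)
  fix z i assume "z \<in> V" "i < n"
  then have "(\<lambda>t. f (z(i := t))) field_differentiable at (z i)" using assms by (auto simp: cn_holomorphic_on_def)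
  moreover have "g field_differentiable at w" for w
    using assms(2) by (auto simp: holomorphic_on_def)
  ultimately have "(g \<circ> (\<lambda>t. f (z(i := t)))) field_differentiable at (z i)"
    by (intro field_differentiable_compose)
  then show "(\<lambda>t. g (f (z(i := t)))) field_differentiable at (z i)" by (simp add: o_def)
qed

lemma cn_holomorphic_on_affine: "cn_holomorphic_on n V (\<lambda>z. a + b * z j)"
  using cn_holomorphic_on_entire[OF cn_holomorphic_on_coordinate, of "\<lambda>w. a + b * w"]
  by (simp add: holomorphic_intros)

lemma cn_holomorphic_on_shift: "cn_holomorphic_on n V (\<lambda>z. z j + c)" "cn_holomorphic_on n V (\<lambda>z. z j - c)"
  using cn_holomorphic_on_affine[of n V c 1 j] cn_holomorphic_on_affine[of n V "- c" 1 j]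
  by (simp_all add: add.commute)

text \<open>Radius 2 leaves room: over the closed disc the coordinate \<open>z\<close> and the chart
  coordinates will have modulus at most 1, the slice coordinate at most 3/2.\<close>

definition polydisc :: "nat \<Rightarrow> (nat \<Rightarrow> complex) set" where
  "polydisc n = {z \<in> cspace n. \<forall>i. cmod (z i) < 2}"

definition polydisc_mfd :: "nat \<Rightarrow> (nat \<Rightarrow> complex) cmfd" where
  "polydisc_mfd n = \<lparr>cm_top = top_of_set (polydisc n), cm_atlas = {(n, polydisc n, \<lambda>z. z)}\<rparr>"

lemma polydisc_sel [simp]:
  "cm_top (polydisc_mfd n) = top_of_set (polydisc n)"
  "cm_atlas (polydisc_mfd n) = {(n, polydisc n, \<lambda>z. z)}"
  by (simp_all add: polydisc_mfd_def)

lemma open_Collect_coord: "open {z::nat \<Rightarrow> complex. P (z i)}" if "open {w. P w}"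
proof -
  have "open ((\<lambda>z::nat \<Rightarrow> complex. z i) -` {w. P w})"
    using that by (intro open_vimage) auto
  then show ?thesis by (simp add: vimage_def)
qed

lemma openin_polydisc: "openin (top_of_set (cspace n)) (polydisc n)"
proof -
  have "polydisc n = cspace n \<inter> (\<Inter>i\<in>{..<n}. {z. cmod (z i) < 2})"
  proof (intro equalityI subsetI)
    fix z assume z: "z \<in> cspace n \<inter> (\<Inter>i\<in>{..<n}. {z. cmod (z i) < 2})"
    have "cmod (z i) < 2" for i using z by (cases "i < n") (auto simp: cspace_def)
    then show "z \<in> polydisc n" using z by (auto simp: polydisc_def)
  qed (auto simp: polydisc_def)
  moreover have "open (\<Inter>i\<in>{..<n}. {z::nat \<Rightarrow> complex. cmod (z i) < 2})"
    by (intro open_INT ballI open_Collect_coord open_Collect_less continuous_intros) auto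
  ultimately show ?thesis by (auto simp: openin_open)
qed

lemma openin_polydisc_trans: "openin (top_of_set (polydisc n)) U \<Longrightarrow> openin (top_of_set (cspace n)) U"
  using openin_trans[OF _ openin_polydisc] by blast

lemma inv_into_translation:
  "w \<in> (\<lambda>z i. z i - v i) ` U \<Longrightarrow> inv_into U (\<lambda>z i. z i - (v i :: complex)) w = (\<lambda>i. w i + v i)"
proof -
  assume "w \<in> (\<lambda>z i. z i - v i) ` U"
  then obtain z where z: "z \<in> U" "w = (\<lambda>i. z i - v i)" by auto
  have "inj_on (\<lambda>z i. z i - v i) U" by (auto simp: inj_on_def fun_eq_iff)
  from inv_into_f_f[OF this z(1)] show ?thesis using z(2) by simp
qed

text \<open>A slice or a point is flattened by moving it to the origin, so translations restricted
  to small open sets are the charts that exhibit the submanifold.\<close>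

lemma translation_chart:
  assumes U: "openin (top_of_set (polydisc n)) U" and v: "v \<in> cspace n"
  shows "(n, U, \<lambda>z i. z i - v i) \<in> maximal_atlas (polydisc_mfd n)"
proof -
  let ?\<phi> = "\<lambda>(z::nat \<Rightarrow> complex) i. z i - v i" and ?\<psi> = "\<lambda>(z::nat \<Rightarrow> complex) i. z i + v i"
  have UP: "U \<subseteq> polydisc n" using openin_imp_subset[OF U] .
  have UC: "U \<subseteq> cspace n" using UP by (auto simp: polydisc_def)
  have c\<phi>: "continuous_on S ?\<phi>" and c\<psi>: "continuous_on S ?\<psi>" for S
    by (intro continuous_on_coordinatewise_then_product continuous_intros
        continuous_on_subset[OF continuous_on_product_coordinates]; simp)+
  have inv: "?\<psi> (?\<phi> z) = z" "?\<phi> (?\<psi> z) = z" for z by auto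
  have op: "openin (top_of_set (cspace n)) (?\<phi> ` U)"
  proof -
    obtain T where T: "open T" "U = cspace n \<inter> T" using openin_polydisc_trans[OF U] by (auto simp: openin_open)
    have "?\<phi> ` U = cspace n \<inter> ?\<psi> -` T"
    proof (intro equalityI subsetI)
      fix w assume w: "w \<in> cspace n \<inter> ?\<psi> -` T"
      then have "?\<psi> w \<in> U" using v T by (auto simp: cspace_def)
      then have "?\<phi> (?\<psi> w) \<in> ?\<phi> ` U" by (rule imageI)
      then show "w \<in> ?\<phi> ` U" by simp
    qed (use T v in \<open>auto simp: cspace_def\<close>)
    moreover have "open (?\<psi> -` T)" using T(1) c\<psi>[of UNIV] by (rule open_vimage)
    ultimately show ?thesis by (auto simp: openin_open)
  qed
  have "homeomorphic_map (top_of_set U) (top_of_set (?\<phi> ` U)) ?\<phi>"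
    unfolding homeomorphic_map_maps homeomorphic_maps_def
  proof (intro exI[of _ ?\<psi>] conjI)
    show "continuous_map (top_of_set U) (top_of_set (?\<phi> ` U)) ?\<phi>" using c\<phi> by simp
    show "continuous_map (top_of_set (?\<phi> ` U)) (top_of_set U) ?\<psi>" using c\<psi> inv(1) by auto
  qed auto
  moreover have "subtopology (top_of_set (polydisc n)) U = top_of_set U"
    using UP by (simp add: subtopology_subtopology inf.absorb2)
  ultimately have chart: "chart_on (top_of_set (polydisc n)) (n, U, ?\<phi>)"
    using U op by (simp add: chart_on_def)
  have "cn_holomorphic_map n n (?\<phi> ` U) ?\<psi>"
    using v inv(1) UC cn_holomorphic_on_shift(1)
    by (auto simp: cn_holomorphic_map_def)
  then have "cn_holomorphic_map n n (?\<phi> ` U) ((\<lambda>z. z) \<circ> inv_into U ?\<phi>)"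
    by (rule cn_holomorphic_map_cong[OF op, rotated]) (simp add: inv_into_translation)
  moreover have "cn_holomorphic_map n n U ?\<phi>"
    using v UC cn_holomorphic_on_shift(2)
    by (auto simp: cn_holomorphic_map_def cspace_def)
  then have "cn_holomorphic_map n n U (?\<phi> \<circ> inv_into (polydisc n) (\<lambda>z. z))"
    by (rule cn_holomorphic_map_cong[OF openin_polydisc_trans[OF U], rotated])
       (use UP in \<open>auto simp: inv_into_f_f[of "\<lambda>z. z"]\<close>)
  ultimately have "compatible (n, U, ?\<phi>) (n, polydisc n, \<lambda>z. z)"
    using UP by (simp add: compatible_def inf.absorb1)
  with chart show ?thesis by (simp add: maximal_atlas_def)
qed

lemma polydisc_chart: "(n, polydisc n, \<lambda>z. z) \<in> maximal_atlas (polydisc_mfd n)"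
  using translation_chart[of n "polydisc n" "\<lambda>_. 0"] by (simp add: cspace_def)

lemma second_countable_euclidean: "second_countable (euclidean :: 'a::second_countable_topology topology)"
proof -
  obtain B :: "'a set set" where B: "countable B" "topological_basis B" using ex_countable_basis by blast
  have "\<exists>V\<in>B. x \<in> V \<and> V \<subseteq> U" if U: "open U" "x \<in> U" for U x
  proof -
    obtain W where "W \<in> B" "x \<in> W" "W \<subseteq> U" by (rule topological_basisE[OF B(2) U])
    then show ?thesis by (intro bexI[of _ W] conjI)
  qed
  then show ?thesis unfolding second_countable_def using B(1) topological_basis_open[OF B(2)]
    by (intro exI[of _ B] conjI) (auto simp flip: open_openin)
qed

lemma complex_manifold_polydisc: "complex_manifold (polydisc_mfd n)"
  unfolding complex_manifold_def
proof (intro conjI)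
  show "Hausdorff_space (cm_top (polydisc_mfd n))" by (simp add: Hausdorff_space_subtopology)
  show "second_countable (cm_top (polydisc_mfd n))"
    by (simp add: second_countable_subtopology second_countable_euclidean)
qed (use polydisc_chart[of n] in \<open>auto simp: maximal_atlas_def\<close>)

lemma holomorphic_function_polydisc:
  assumes "cn_holomorphic_on n (polydisc n) f"
  shows "f \<in> holomorphic_functions (polydisc_mfd n)"
proof -
  have "cn_holomorphic_map n 1 (polydisc n) (\<lambda>z i. if i = 0 then f z else 0)"
    using assms by (auto simp: cn_holomorphic_map_def cspace_def)
  then have "cn_holomorphic_map n 1 (polydisc n) ((\<lambda>z i. if i = 0 then z else 0) \<circ> f \<circ> inv_into (polydisc n) (\<lambda>z. z))"
    by (rule cn_holomorphic_map_cong[OF openin_polydisc, rotated]) (simp add: inv_into_f_f[of "\<lambda>z. z"])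
  then show ?thesis using assms
    by (auto simp: holomorphic_map_on_def complex_plane_def cn_holomorphic_on_def subtopology_subtopology)
qed

lemma coordinate_polydisc: "(\<lambda>z. z j) \<in> holomorphic_functions (polydisc_mfd n)"
  by (rule holomorphic_function_polydisc[OF cn_holomorphic_on_coordinate])

lemma compact_box: "(\<And>i. compact (S i)) \<Longrightarrow> compact {z::nat \<Rightarrow> complex. \<forall>i. z i \<in> S i}"
proof -
  assume "\<And>i. compact (S i)"
  then have "compactin (product_topology (\<lambda>_. euclidean) UNIV) (PiE UNIV S)"
    by (subst compactin_PiE) auto
  then have "compact (PiE UNIV S)" by (simp add: euclidean_product_topology)
  moreover have "PiE UNIV S = {z. \<forall>i. z i \<in> S i}" by (auto simp: PiE_UNIV_domain)
  ultimately show ?thesis by simp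
qed

lemma holomorphic_hullD:
  assumes "p \<in> holomorphic_hull M K" "f \<in> holomorphic_functions M" "\<And>x. x \<in> K \<Longrightarrow> cmod (f x) \<le> B"
  shows "cmod (f p) \<le> B"
  using assms unfolding holomorphic_hull_def by blast

text \<open>The coordinate functions confine the hull to a smaller closed polydisc, compact inside
  the open one, and the hull is relatively closed as an intersection of sublevel sets.\<close>

lemma hull_compact_polydisc:
  assumes K: "compactin (top_of_set (polydisc n)) K"
  shows "compactin (top_of_set (polydisc n)) (holomorphic_hull (polydisc_mfd n) K)"
proof (cases "K = {}")
  case True
  \<comment> \<open>Over the empty set every bound is admissible, even \<open>-1\<close>, which no
    point satisfies.\<close>
  have "holomorphic_hull (polydisc_mfd n) K = {}"
    using holomorphic_hullD[OF _ coordinate_polydisc, of _ n K _ "-1"] True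
    by (metis (no_types, lifting) all_not_in_conv norm_ge_zero not_one_le_zero neg_0_le_iff_le order_trans)
  then show ?thesis by simp
next
  case False
  have KP: "compact K" "K \<subseteq> polydisc n" using K by (auto simp: compactin_subtopology)
  have "\<exists>r<2. \<forall>z\<in>K. cmod (z i) \<le> r" for i
  proof -
    have "continuous_on K (\<lambda>z. cmod (z i))"
      by (intro continuous_intros continuous_on_subset[OF continuous_on_product_coordinates]) simp
    from continuous_attains_sup[OF KP(1) False this] show ?thesis
      using KP(2) by (auto simp: polydisc_def)
  qed
  then have "\<forall>i. \<exists>r. r < 2 \<and> (\<forall>z\<in>K. cmod (z i) \<le> r)" by blast
  from choice[OF this] obtain r where r: "\<And>i. r i < 2" "\<And>i z. z \<in> K \<Longrightarrow> cmod (z i) \<le> r i" by blast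
  define C where "C = {z. \<forall>i. z i \<in> (if i < n then cball 0 (r i) else {0::complex})}"
  have "compact C" unfolding C_def by (rule compact_box) auto
  moreover have CP: "C \<subseteq> polydisc n"
  proof
    fix z assume z: "z \<in> C"
    have zi: "z i \<in> (if i < n then cball 0 (r i) else {0})" for i using z by (simp add: C_def)
    have "cmod (z i) < 2" for i using zi[of i] r(1)[of i] by (cases "i < n") auto
    moreover have "z i = 0" if "i \<ge> n" for i using zi[of i] that by simp
    ultimately show "z \<in> polydisc n" by (auto simp: polydisc_def cspace_def)
  qed
  ultimately have C: "compactin (top_of_set (polydisc n)) C" by (simp add: compactin_subtopology)
  have sub: "holomorphic_hull (polydisc_mfd n) K \<subseteq> C"
  proof
    fix p assume p: "p \<in> holomorphic_hull (polydisc_mfd n) K"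
    have "cmod (p i) \<le> r i" for i
      using holomorphic_hullD[OF p coordinate_polydisc] r(2) by blast
    moreover have "p i = 0" if "i \<ge> n" for i using p that by (auto simp: holomorphic_hull_def polydisc_def cspace_def)
    ultimately show "p \<in> C" by (auto simp: C_def)
  qed
  have "closedin (top_of_set (polydisc n)) (holomorphic_hull (polydisc_mfd n) K)"
  proof -
    let ?H = "{(f, B). f \<in> holomorphic_functions (polydisc_mfd n) \<and> (\<forall>x\<in>K. cmod (f x) \<le> B)}"
    have "closedin (top_of_set (polydisc n)) {p \<in> polydisc n. cmod (f p) \<le> B}" if "(f, B) \<in> ?H" for f B
    proof -
      have "continuous_map (top_of_set (polydisc n)) euclidean f"
        using that by (auto simp: holomorphic_map_on_def complex_plane_def subtopology_subtopology)
      then have "continuous_on (polydisc n) (\<lambda>p. cmod (f p))" by (intro continuous_intros) simp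
      then have "closedin (top_of_set (polydisc n)) (polydisc n \<inter> (\<lambda>p. cmod (f p)) -` {..B})"
        by (intro continuous_closedin_preimage) auto
      moreover have "polydisc n \<inter> (\<lambda>p. cmod (f p)) -` {..B} = {p \<in> polydisc n. cmod (f p) \<le> B}" by auto
      ultimately show ?thesis by simp
    qed
    then have "closedin (top_of_set (polydisc n)) (\<Inter>(insert (polydisc n) ((\<lambda>(f, B). {p \<in> polydisc n. cmod (f p) \<le> B}) ` ?H)))"
      by (intro closedin_Inter) auto
    moreover have "\<Inter>(insert (polydisc n) ((\<lambda>(f, B). {p \<in> polydisc n. cmod (f p) \<le> B}) ` ?H)) = holomorphic_hull (polydisc_mfd n) K"
      by (auto simp: holomorphic_hull_def)
    ultimately show ?thesis by simp
  qed
  then show ?thesis using closed_compactin[OF C sub] by blast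
qed

lemma stein_polydisc: "stein_manifold (polydisc_mfd n)"
  unfolding stein_manifold_def
proof (intro conjI allI impI ballI)
  show "complex_manifold (polydisc_mfd n)" by (rule complex_manifold_polydisc)
  show "compactin (cm_top (polydisc_mfd n)) (holomorphic_hull (polydisc_mfd n) K)"
    if "compactin (cm_top (polydisc_mfd n)) K" for K
    using hull_compact_polydisc that by simp
  show "\<exists>f\<in>holomorphic_functions (polydisc_mfd n). f p \<noteq> f q"
    if pq: "p \<in> points (polydisc_mfd n)" "q \<in> points (polydisc_mfd n)" "p \<noteq> q" for p q
  proof -
    obtain j where "p j \<noteq> q j" using pq(3) by (auto simp: fun_eq_iff)
    then show ?thesis using coordinate_polydisc[of j n] by (intro bexI[of _ "\<lambda>z. z j"]) auto
  qed
  fix p assume p: "p \<in> points (polydisc_mfd n)"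
  have "chart_on (top_of_set (polydisc n)) (n, polydisc n, \<lambda>z. z)"
    using polydisc_chart by (simp add: maximal_atlas_def)
  have eq: "(if i < n then x i else 0) = x i" if "x \<in> polydisc n" for x i
    using that by (auto simp: polydisc_def cspace_def)
  \<comment> \<open>The Stein condition prescribes a coordinate map that is 0 from index
    \<open>n\<close> on at every argument. It equals the identity only on the polydisc, so it is a
    different function and its membership in the maximal atlas is checked separately.\<close>
  define c where "c = (\<lambda>(x::nat \<Rightarrow> complex) i. if i < n then x i else 0)"
  have cx: "c x = x" if "x \<in> polydisc n" for x using eq[OF that] by (auto simp: c_def)
  have "(n, polydisc n, c) \<in> maximal_atlas (polydisc_mfd n)"
  proof -
    have im: "c ` polydisc n = polydisc n" using cx by force
    have iv: "inv_into (polydisc n) c x = x" if "x \<in> polydisc n" for x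
    proof -
      have "inj_on c (polydisc n)" using cx by (auto simp: inj_on_def)
      then show ?thesis using inv_into_f_f[of c "polydisc n" x] cx[OF that] that by simp
    qed
    have "homeomorphic_map (top_of_set (polydisc n)) (top_of_set (polydisc n)) c"
      by (rule homeomorphic_map_eq[of _ _ id]) (simp_all add: cx)
    then have 1: "chart_on (top_of_set (polydisc n)) (n, polydisc n, c)"
      using openin_polydisc by (simp add: chart_on_def im subtopology_subtopology)
    have "cn_holomorphic_map n n (polydisc n) (\<lambda>z. z)"
      using cn_holomorphic_on_coordinate by (auto simp: cn_holomorphic_map_def polydisc_def)
    then have "cn_holomorphic_map n n (polydisc n) ((\<lambda>z. z) \<circ> inv_into (polydisc n) c)"
      "cn_holomorphic_map n n (polydisc n) (c \<circ> inv_into (polydisc n) (\<lambda>z. z))"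
      by (rule cn_holomorphic_map_cong[OF openin_polydisc, rotated],
          simp add: iv cx inv_into_f_f[of "\<lambda>z. z"])+
    then show ?thesis using 1 by (simp add: maximal_atlas_def compatible_def im)
  qed
  then show "\<exists>n' U f. p \<in> U \<and> (\<forall>i<n'. f i \<in> holomorphic_functions (polydisc_mfd n)) \<and>
        (n', U, \<lambda>x i. if i < n' then f i x else 0) \<in> maximal_atlas (polydisc_mfd n)"
    using p coordinate_polydisc[of _ n] unfolding c_def
    by (intro exI[of _ n] exI[of _ "polydisc n"] exI[of _ "\<lambda>i z. z i"]) auto
qed

section \<open>Charts, slices and holomorphic maps\<close>

text \<open>The Oka property approximates with respect to some distance, the theorem with respect to
  a given one. Distances inducing the same topology need not be uniformly equivalent; near a compact
  set a Lebesgue number argument makes them comparable, with only the first point confined to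
  it.\<close>

lemma metric_compare:
  assumes d: "induces_topology d T" and d': "induces_topology d' T" and C: "compactin T C" and "\<epsilon> > 0"
  obtains \<delta> where "\<delta> > 0" "\<And>x y. x \<in> C \<Longrightarrow> y \<in> topspace T \<Longrightarrow> d' x y < \<delta> \<Longrightarrow> d x y < \<epsilon>"
proof -
  interpret D: Metric_space "topspace T" d using d by (simp add: induces_topology_def)
  interpret D': Metric_space "topspace T" d' using d' by (simp add: induces_topology_def)
  have DT: "D.mtopology = T" and DT': "D'.mtopology = T" using d d' by (simp_all add: induces_topology_def)
  have CT: "C \<subseteq> topspace T" using C by (rule compactin_subset_topspace)
  have "\<exists>\<rho>. \<rho> > 0 \<and> D'.mball x (2 * \<rho>) \<subseteq> D.mball x (\<epsilon> / 2)" if x: "x \<in> C" for x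
  proof -
    have "openin T (D.mball x (\<epsilon> / 2))" using D.openin_mball[of x "\<epsilon> / 2"] by (simp add: DT)
    then have "openin D'.mtopology (D.mball x (\<epsilon> / 2))" by (simp add: DT')
    moreover have "x \<in> D.mball x (\<epsilon> / 2)" using x CT \<open>\<epsilon> > 0\<close> by auto
    ultimately obtain r where "r > 0" "D'.mball x r \<subseteq> D.mball x (\<epsilon> / 2)"
      unfolding D'.openin_mtopology by blast
    then show ?thesis by (intro exI[of _ "r / 2"]) simp
  qed
  then have "\<forall>x\<in>C. \<exists>\<rho>. \<rho> > 0 \<and> D'.mball x (2 * \<rho>) \<subseteq> D.mball x (\<epsilon> / 2)" by blast
  from bchoice[OF this] obtain \<rho> where
    \<rho>: "\<And>x. x \<in> C \<Longrightarrow> \<rho> x > 0" "\<And>x. x \<in> C \<Longrightarrow> D'.mball x (2 * \<rho> x) \<subseteq> D.mball x (\<epsilon> / 2)" by blast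
  have op: "openin T (D'.mball x r)" for x r using D'.openin_mball[of x r] by (simp add: DT')
  have "\<exists>\<F>. finite \<F> \<and> \<F> \<subseteq> (\<lambda>x. D'.mball x (\<rho> x)) ` C \<and> C \<subseteq> \<Union>\<F>"
    by (rule compactinD[OF C]) (use op \<rho>(1) CT in auto)
  then obtain Y where Y: "finite Y" "Y \<subseteq> C" "C \<subseteq> (\<Union>x\<in>Y. D'.mball x (\<rho> x))"
    using finite_subset_image by (metis (no_types, lifting))
  define \<delta> where "\<delta> = Min (insert 1 (\<rho> ` Y))"
  show thesis
  proof
    show "\<delta> > 0" unfolding \<delta>_def using Y \<rho>(1) by (subst Min_gr_iff) auto
    fix x y assume x: "x \<in> C" and y: "y \<in> topspace T" and xy: "d' x y < \<delta>"
    obtain z where z: "z \<in> Y" "x \<in> D'.mball z (\<rho> z)" using Y(3) x by blast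
    have zC: "z \<in> C" using z Y by blast
    have "\<delta> \<le> \<rho> z" unfolding \<delta>_def using Y(1) z(1) by (intro Min_le) auto
    moreover have "d' z y \<le> d' z x + d' x y" using z zC x y CT by (intro D'.triangle) auto
    ultimately have "y \<in> D'.mball z (2 * \<rho> z)" "x \<in> D'.mball z (2 * \<rho> z)"
      using z xy y zC CT \<rho>(1)[OF zC] by auto
    then have "y \<in> D.mball z (\<epsilon> / 2)" "x \<in> D.mball z (\<epsilon> / 2)" using \<rho>(2)[OF zC] by blast+
    moreover have "d x y \<le> d x z + d z y" using zC x y CT by (intro D.triangle) auto
    ultimately show "d x y < \<epsilon>" using D.commute[of x z] by auto
  qed
qed

lemma chart_onD:
  assumes "chart_on T (m, V, \<psi>)"
  shows "openin T V" "inj_on \<psi> V" "openin (top_of_set (cspace m)) (\<psi> ` V)"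
    "continuous_map (subtopology T V) euclidean \<psi>"
    "continuous_map (top_of_set (\<psi> ` V)) T (inv_into V \<psi>)"
proof -
  show V: "openin T V" and "openin (top_of_set (cspace m)) (\<psi> ` V)"
    using assms by (auto simp: chart_on_def)
  have h: "homeomorphic_map (subtopology T V) (top_of_set (\<psi> ` V)) \<psi>" using assms by (auto simp: chart_on_def)
  have ts: "topspace (subtopology T V) = V" using openin_subset[OF V] by auto
  show inj: "inj_on \<psi> V" using homeomorphic_imp_injective_map[OF h] ts by simp
  show "continuous_map (subtopology T V) euclidean \<psi>"
    using homeomorphic_imp_continuous_map[OF h] by (simp add: continuous_map_in_subtopology)
  obtain g where g: "homeomorphic_maps (subtopology T V) (top_of_set (\<psi> ` V)) \<psi> g"
    using h by (auto simp: homeomorphic_map_maps)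
  have "continuous_map (top_of_set (\<psi> ` V)) (subtopology T V) g" using g by (simp add: homeomorphic_maps_def)
  moreover have "g w = inv_into V \<psi> w" if "w \<in> \<psi> ` V" for w
  proof -
    from that obtain x where x: "x \<in> V" "w = \<psi> x" by blast
    then have "g w = x" using g ts by (auto simp: homeomorphic_maps_def)
    then show ?thesis using inv_into_f_f[OF inj x(1)] x by simp
  qed
  ultimately have "continuous_map (top_of_set (\<psi> ` V)) (subtopology T V) (inv_into V \<psi>)"
    using continuous_map_eq[of "top_of_set (\<psi> ` V)" "subtopology T V" g] by simp
  then show "continuous_map (top_of_set (\<psi> ` V)) T (inv_into V \<psi>)"
    by (simp add: continuous_map_in_subtopology)
qed

lemma atlas_chart_on: "complex_manifold X \<Longrightarrow> C \<in> cm_atlas X \<Longrightarrow> chart_on (cm_top X) C"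
  by (auto simp: complex_manifold_def)

lemma ex_chart:
  assumes "complex_manifold X" "x \<in> points X"
  obtains m V \<psi> where "(m, V, \<psi>) \<in> cm_atlas X" "x \<in> V"
proof -
  have "x \<in> (\<Union>(n, U, \<phi>)\<in>cm_atlas X. U)" using assms by (simp add: complex_manifold_def)
  then show thesis using that by auto
qed

lemma inv_into_complex_coordinate:
  "w \<in> range (\<lambda>z i. if i = 0 then z else 0) \<Longrightarrow> inv (\<lambda>(z::complex) (i::nat). if i = 0 then z else 0) w = w 0"
proof -
  assume "w \<in> range (\<lambda>z i. if i = 0 then z else 0)"
  then obtain z where z: "w = (\<lambda>i. if i = 0 then z else 0)" by auto
  have "inj (\<lambda>(z::complex) (i::nat). if i = 0 then z else 0)" by (rule injI) (metis (mono_tags, lifting))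
  from inv_f_f[OF this, of z] show ?thesis using z by simp
qed

lemma openin_complex_coordinate:
  assumes "open A"
  shows "openin (top_of_set (cspace 1)) ((\<lambda>(z::complex) (i::nat). if i = 0 then z else 0) ` A)"
    (is "openin _ (?e ` A)")
proof -
  have "?e ` A = cspace 1 \<inter> (\<lambda>w. w 0) -` A"
  proof (intro equalityI subsetI)
    fix w assume "w \<in> cspace 1 \<inter> (\<lambda>w. w 0) -` A"
    then have "w = ?e (w 0)" "w 0 \<in> A" by (auto simp: cspace_def fun_eq_iff)
    then show "w \<in> ?e ` A" by (rule image_eqI)
  qed (auto simp: cspace_def)
  moreover have "open ((\<lambda>w::nat \<Rightarrow> complex. w 0) -` A)" using assms by (intro open_vimage) auto
  ultimately show ?thesis by (auto simp: openin_open)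
qed

text \<open>In charts of \<open>X\<close> this is the curve lemma; \<open>?e\<close> is the chart of
  \<open>complex_plane\<close>, writing a number as a point of \<open>cspace 1\<close>.\<close>

lemma holomorphic_compose_curve:
  assumes X: "complex_manifold X" and F: "holomorphic_map (polydisc_mfd n) X F"
    and S: "open S" and G: "\<And>z. z \<in> S \<Longrightarrow> G z \<in> polydisc n" "\<And>i. i < n \<Longrightarrow> (\<lambda>z. G z i) holomorphic_on S"
  shows "holomorphic_map_on complex_plane X S (\<lambda>z. F (G z))"
proof -
  let ?e = "\<lambda>(z::complex) (i::nat). if i = 0 then z else 0"
  have Gc: "continuous_on S G"
  proof (rule continuous_on_coordinatewise_then_product)
    fix i show "continuous_on S (\<lambda>z. G z i)"
    proof (cases "i < n")
      case True
      then show ?thesis using G(2) holomorphic_on_imp_continuous_on by blast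
    next
      case False
      then have "G z i = 0" if "z \<in> S" for z using G(1)[OF that] by (auto simp: polydisc_def cspace_def)
      then show ?thesis by (simp cong: continuous_on_cong)
    qed
  qed
  have Fc: "continuous_map (top_of_set (polydisc n)) (cm_top X) F"
    using F by (simp add: holomorphic_map_on_def subtopology_subtopology)
  have "continuous_map (top_of_set S) (top_of_set (polydisc n)) G" using Gc G(1) by auto
  from continuous_map_compose[OF this Fc] have FGc: "continuous_map (top_of_set S) (cm_top X) (\<lambda>z. F (G z))"
    by (simp add: o_def)
  have "cn_holomorphic_map 1 m (?e ` (UNIV \<inter> S \<inter> (\<lambda>z. F (G z)) -` V)) (\<psi> \<circ> (\<lambda>z. F (G z)) \<circ> inv_into UNIV ?e)"
    if C: "(m, V, \<psi>) \<in> cm_atlas X" for m V \<psi>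
  proof -
    have V: "openin (cm_top X) V" using chart_onD(1)[OF atlas_chart_on[OF X C]] .
    define A where "A = S \<inter> (\<lambda>z. F (G z)) -` V"
    define B where "B = polydisc n \<inter> F -` V"
    have "openin (top_of_set S) {z \<in> S. F (G z) \<in> V}"
      using openin_continuous_map_preimage[OF FGc V] by simp
    moreover have "{z \<in> S. F (G z) \<in> V} = A" by (auto simp: A_def)
    ultimately have A: "open A" using S openin_open_eq by auto
    have "openin (top_of_set (polydisc n)) {z \<in> polydisc n. F z \<in> V}"
      using openin_continuous_map_preimage[OF Fc V] by simp
    moreover have "{z \<in> polydisc n. F z \<in> V} = B" by (auto simp: B_def)
    ultimately have B: "openin (top_of_set (cspace n)) B" using openin_polydisc_trans by simp
    have "cn_holomorphic_map n m ((\<lambda>z. z) ` (polydisc n \<inter> polydisc n \<inter> F -` V)) (\<psi> \<circ> F \<circ> inv_into (polydisc n) (\<lambda>z. z))"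
      using F C by (auto simp: holomorphic_map_on_def)
    then have "cn_holomorphic_map n m B (\<psi> \<circ> F \<circ> inv_into (polydisc n) (\<lambda>z. z))" by (simp add: B_def)
    then have hB: "cn_holomorphic_map n m B (\<lambda>z. \<psi> (F z))"
      by (rule cn_holomorphic_map_cong[OF B, rotated]) (simp add: B_def inv_into_f_f[of "\<lambda>z. z"])
    have GA: "G ` A \<subseteq> B" using G(1) by (auto simp: A_def B_def)
    have hol: "(\<lambda>z. \<psi> (F (G z)) j) holomorphic_on A" if "j < m" for j
    proof (rule cn_holomorphic_along_curve[OF B _ A GA])
      show "cn_holomorphic_on n B (\<lambda>z. \<psi> (F z) j)" using hB that by (simp add: cn_holomorphic_map_def)
      show "(\<lambda>z. G z i) holomorphic_on A" if "i < n" for i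
        using G(2)[OF that] by (rule holomorphic_on_subset) (auto simp: A_def)
    qed
    have eop: "openin (top_of_set (cspace 1)) (?e ` A)" using A by (rule openin_complex_coordinate)
    have "cn_holomorphic_map 1 m (?e ` A) (\<lambda>w. \<psi> (F (G (w 0))))"
      unfolding cn_holomorphic_map_def cn_holomorphic_on_def
    proof (intro conjI allI impI ballI)
      show "(\<lambda>w. \<psi> (F (G (w 0)))) ` ?e ` A \<subseteq> cspace m"
      proof
        fix v assume "v \<in> (\<lambda>w. \<psi> (F (G (w 0)))) ` ?e ` A"
        then obtain z where "z \<in> A" "v = \<psi> (F (G z))" by auto
        moreover from this have "G z \<in> B" using GA by blast
        ultimately show "v \<in> cspace m" using hB by (auto simp: cn_holomorphic_map_def)
      qed
      fix j assume j: "j < m"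
      show "continuous_on (?e ` A) (\<lambda>w. \<psi> (F (G (w 0))) j)"
        by (rule continuous_on_compose2[OF holomorphic_on_imp_continuous_on[OF hol[OF j]]
              continuous_on_subset[OF continuous_on_product_coordinates[of 0]]]) auto
      fix w and i :: nat assume w: "w \<in> ?e ` A" and "i < 1"
      then have [simp]: "i = 0" by simp
      have "w 0 \<in> A" using w by auto
      then have "(\<lambda>z. \<psi> (F (G z)) j) field_differentiable at (w 0)"
        using hol[OF j] A by (auto simp: holomorphic_on_open field_differentiable_def)
      then show "(\<lambda>t. \<psi> (F (G ((w(i := t)) 0))) j) field_differentiable at (w i)" by simp
    qed
    then have "cn_holomorphic_map 1 m (?e ` A) (\<psi> \<circ> (\<lambda>z. F (G z)) \<circ> inv_into UNIV ?e)"
    proof (rule cn_holomorphic_map_cong[OF eop, rotated])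
      fix w assume "w \<in> ?e ` A"
      then have "w \<in> range ?e" by blast
      then show "\<psi> (F (G (w 0))) = (\<psi> \<circ> (\<lambda>z. F (G z)) \<circ> inv_into UNIV ?e) w"
        by (simp add: inv_into_complex_coordinate)
    qed
    then show ?thesis by (simp add: A_def)
  qed
  then show ?thesis using S FGc by (auto simp: holomorphic_map_on_def complex_plane_def)
qed

text \<open>Pullback of \<phi> along the projection to the first coordinate; it covers the region
  where the glued map ignores the remaining coordinates.\<close>

lemma holomorphic_of_first_coordinate:
  assumes \<phi>: "holomorphic_map_on complex_plane X W0 \<phi>" and W: "openin (top_of_set (polydisc n)) W"
    and f: "\<And>y. y \<in> W \<Longrightarrow> y 0 \<in> W0 \<and> f y = \<phi> (y 0)" and X: "complex_manifold X"
  shows "holomorphic_map_on (polydisc_mfd n) X W f"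
proof -
  let ?e = "\<lambda>(z::complex) (i::nat). if i = 0 then z else 0"
  have WP: "W \<subseteq> polydisc n" using openin_imp_subset[OF W] .
  have W0: "open W0" and \<phi>c: "continuous_map (top_of_set W0) (cm_top X) \<phi>"
    using \<phi> by (auto simp: holomorphic_map_on_def complex_plane_def)
  have "continuous_map (top_of_set W) (top_of_set W0) (\<lambda>y. y 0)"
    using f by (auto intro: continuous_on_subset[OF continuous_on_product_coordinates])
  from continuous_map_compose[OF this \<phi>c] have "continuous_map (top_of_set W) (cm_top X) (\<lambda>y. \<phi> (y 0))"
    by (simp add: o_def)
  then have fc: "continuous_map (top_of_set W) (cm_top X) f"
    using continuous_map_eq[of "top_of_set W" "cm_top X" "\<lambda>y. \<phi> (y 0)" f] f by simp
  have chart: "cn_holomorphic_map n m (polydisc n \<inter> W \<inter> f -` V) (\<psi> \<circ> f \<circ> inv_into (polydisc n) (\<lambda>z. z))"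
    if C: "(m, V, \<psi>) \<in> cm_atlas X" for m V \<psi>
  proof -
    have V: "openin (cm_top X) V" using chart_onD(1)[OF atlas_chart_on[OF X C]] .
    define A where "A = {z \<in> W0. \<phi> z \<in> V}"
    have "openin (top_of_set W0) A" unfolding A_def using openin_continuous_map_preimage[OF \<phi>c V] by simp
    then have A: "open A" using W0 openin_open_eq by auto
    define B where "B = {y \<in> W. f y \<in> V}"
    have "openin (top_of_set W) B" unfolding B_def using openin_continuous_map_preimage[OF fc V] by simp
    then have B: "openin (top_of_set (cspace n)) B"
      using openin_trans[OF _ openin_polydisc_trans[OF W]] by blast
    have eop: "openin (top_of_set (cspace 1)) (?e ` A)" using A by (rule openin_complex_coordinate)
    have "cn_holomorphic_map 1 m (?e ` (UNIV \<inter> W0 \<inter> \<phi> -` V)) (\<psi> \<circ> \<phi> \<circ> inv_into UNIV ?e)"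
      using \<phi> C by (auto simp: holomorphic_map_on_def complex_plane_def)
    moreover have "UNIV \<inter> W0 \<inter> \<phi> -` V = A" by (auto simp: A_def)
    ultimately have 1: "cn_holomorphic_map 1 m (?e ` A) (\<psi> \<circ> \<phi> \<circ> inv_into UNIV ?e)" by simp
    have 2: "cn_holomorphic_map n 1 B (\<lambda>y. ?e (y 0))"
      using cn_holomorphic_on_coordinate[of n B 0] by (auto simp: cn_holomorphic_map_def cspace_def)
    have 3: "(\<lambda>y. ?e (y 0)) ` B \<subseteq> ?e ` A" using f by (auto simp: A_def B_def)
    from cn_holomorphic_map_compose[OF B eop 2 3 1]
    have "cn_holomorphic_map n m B (\<lambda>y. (\<psi> \<circ> \<phi> \<circ> inv_into UNIV ?e) (?e (y 0)))" .
    then have "cn_holomorphic_map n m B (\<psi> \<circ> f \<circ> inv_into (polydisc n) (\<lambda>z. z))"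
    proof (rule cn_holomorphic_map_cong[OF B, rotated])
      fix y assume y: "y \<in> B"
      then have "inv_into (polydisc n) (\<lambda>z. z) y = y"
        using WP by (intro inv_into_f_f[of "\<lambda>z. z"]) (auto simp: B_def)
      moreover have "f y = \<phi> (y 0)" using f y by (simp add: B_def)
      ultimately show "(\<psi> \<circ> \<phi> \<circ> inv_into UNIV ?e) (?e (y 0)) = (\<psi> \<circ> f \<circ> inv_into (polydisc n) (\<lambda>z. z)) y"
        by (simp add: inv_into_complex_coordinate)
    qed
    moreover have "polydisc n \<inter> W \<inter> f -` V = B" using WP by (auto simp: B_def)
    ultimately show ?thesis by simp
  qed
  have "subtopology (top_of_set (polydisc n)) W = top_of_set W"
    using WP by (simp add: subtopology_subtopology inf.absorb2)
  then show ?thesis using W fc chart by (auto simp: holomorphic_map_on_def)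
qed

text \<open>Coordinate functions cut out the disc factors, and an entire function of
  \<open>y 0\<close> cuts out the factor \<open>K\<close>; the hypothesis \<open>sep\<close> is what
  \<open>no_holes_separation\<close> supplies.\<close>

lemma holomorphically_convex_polydisc:
  assumes K: "compact K" "K \<subseteq> ball 0 1" and n: "n > 0" and \<rho>: "\<And>i. 0 \<le> \<rho> i \<and> \<rho> i < (2::real)"
    and sep: "\<And>p. p \<notin> K \<Longrightarrow> \<exists>g B. g holomorphic_on UNIV \<and> (\<forall>z\<in>K. cmod (g z) \<le> B) \<and> B < cmod (g p)"
  shows "holomorphically_convex_compact (polydisc_mfd n) {y \<in> cspace n. y 0 \<in> K \<and> (\<forall>i>0. cmod (y i) \<le> \<rho> i)}"
    (is "holomorphically_convex_compact _ ?K")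
proof -
  have "?K = {y. \<forall>i. y i \<in> (if i = 0 then K else if i < n then cball 0 (\<rho> i) else {0})}" (is "_ = ?B")
  proof (intro equalityI subsetI)
    fix y assume y: "y \<in> ?B"
    then have yi: "y i \<in> (if i = 0 then K else if i < n then cball 0 (\<rho> i) else {0})" for i by blast
    have "y i = 0" if "i \<ge> n" for i using yi[of i] that n by simp
    moreover have "cmod (y i) \<le> \<rho> i" if "i > 0" for i using yi[of i] that \<rho>[of i] by (auto split: if_splits)
    moreover have "y 0 \<in> K" using yi[of 0] by simp
    ultimately show "y \<in> ?K" by (auto simp: cspace_def)
  qed (auto simp: cspace_def)
  moreover have "compact ?B" using K by (intro compact_box) auto
  ultimately have Kc: "compact ?K" by simp
  have KP: "?K \<subseteq> polydisc n"
  proof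
    fix y assume y: "y \<in> ?K"
    have "cmod (y i) < 2" for i
    proof (cases "i = 0")
      case True
      then have "y i \<in> ball 0 1" using y K(2) by blast
      then show ?thesis by simp
    next
      case False
      then have "cmod (y i) \<le> \<rho> i" using y by blast
      then show ?thesis using \<rho>[of i] by linarith
    qed
    then show "y \<in> polydisc n" using y by (simp add: polydisc_def)
  qed
  have "holomorphic_hull (polydisc_mfd n) ?K \<subseteq> ?K"
  proof
    fix p assume p: "p \<in> holomorphic_hull (polydisc_mfd n) ?K"
    then have pc: "p \<in> cspace n" by (simp add: holomorphic_hull_def polydisc_def)
    have "cmod (p i) \<le> \<rho> i" if "i > 0" for i
      by (rule holomorphic_hullD[OF p coordinate_polydisc]) (use that in auto)
    moreover have "p 0 \<in> K"
    proof (rule ccontr)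
      assume "p 0 \<notin> K"
      then obtain g B where g: "g holomorphic_on UNIV" "\<forall>z\<in>K. cmod (g z) \<le> B" "B < cmod (g (p 0))" using sep by blast
      have "cmod (g (p 0)) \<le> B"
        by (rule holomorphic_hullD[OF p holomorphic_function_polydisc[OF cn_holomorphic_on_entire[OF cn_holomorphic_on_coordinate g(1)]]])
           (use g(2) in auto)
      then show False using g(3) by simp
    qed
    ultimately show "p \<in> ?K" using pc by simp
  qed
  moreover have "?K \<subseteq> holomorphic_hull (polydisc_mfd n) ?K"
    using KP by (auto simp: holomorphic_hull_def)
  ultimately show ?thesis using Kc KP by (simp add: holomorphically_convex_compact_def compactin_subtopology)
qed

text \<open>The slicing coordinate is the last one, so translating its value to 0 flattens a slice
  onto \<open>cspace k\<close>. The additional point is a component of dimension 0 and serves to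
  prescribe the value at one interior point of the disc.\<close>

lemma closed_submanifold_slices:
  fixes S :: "complex set"
  assumes S: "finite S" and p: "p \<in> polydisc (Suc k)" "p k \<notin> S"
  shows "closed_submanifold (polydisc_mfd (Suc k)) (insert p {y \<in> polydisc (Suc k). y k \<in> S})"
proof -
  let ?P = "polydisc (Suc k)"
  let ?L = "insert p {y \<in> ?P. y k \<in> S}"
  have "closed {y::nat \<Rightarrow> complex. y k \<in> S}"
  proof -
    have "closed ((\<lambda>y::nat \<Rightarrow> complex. y k) -` S)"
      using S by (intro closed_vimage finite_imp_closed) auto
    then show ?thesis by (simp add: vimage_def)
  qed
  then have "closed (insert p {y. y k \<in> S})" by (rule closed_insert)
  moreover have "?L = ?P \<inter> insert p {y. y k \<in> S}" using p by auto
  ultimately have cl: "closedin (top_of_set ?P) ?L" by (auto simp: closedin_closed)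
  have "\<exists>k' n U \<phi>. q \<in> U \<and> adapted_chart (polydisc_mfd (Suc k)) ?L k' (n, U, \<phi>)" if q: "q \<in> ?L" for q
  proof -
    \<comment> \<open>Removes every value of the last coordinate on \<open>?L\<close> except that of
      \<open>q\<close>, so the chart domain meets only the slice, or the isolated point, through
      \<open>q\<close>.\<close>
    define T where "T = - (insert (p k) S - {q k})"
    define U where "U = {y \<in> ?P. y k \<in> T}"
    have "open T" unfolding T_def using S by (intro open_Compl finite_imp_closed) auto
    then have "open {y::nat \<Rightarrow> complex. y k \<in> T}" by (intro open_Collect_coord) auto
    moreover have "U = ?P \<inter> {y. y k \<in> T}" by (auto simp: U_def)
    ultimately have U: "openin (top_of_set ?P) U" by (auto simp: openin_open)
    have qU: "q \<in> U" using q p by (auto simp: U_def T_def)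
    have qP: "q \<in> ?P" using q p by auto
    show ?thesis
    proof (cases "q k \<in> S")
      case True
      define v where "v i = (if i = k then q k else 0)" for i
      have v: "v \<in> cspace (Suc k)" by (auto simp: v_def cspace_def)
      have UL: "U \<inter> ?L = {y \<in> ?P. y k = q k}" using True p by (auto simp: U_def T_def)
      have "(\<lambda>z i. z i - v i) ` (U \<inter> ?L) = (\<lambda>z i. z i - v i) ` U \<inter> cspace k"
      proof (intro equalityI subsetI)
        fix w assume "w \<in> (\<lambda>z i. z i - v i) ` (U \<inter> ?L)"
        then obtain z where z: "z \<in> U" "z \<in> ?P" "z k = q k" "w = (\<lambda>i. z i - v i)" unfolding UL
          using True by (auto simp: U_def T_def)
        then have "w i = 0" if "i \<ge> k" for i
          using that by (cases "i = k") (auto simp: v_def polydisc_def cspace_def)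
        then show "w \<in> (\<lambda>z i. z i - v i) ` U \<inter> cspace k" using z by (auto simp: cspace_def)
      next
        fix w assume w: "w \<in> (\<lambda>z i. z i - v i) ` U \<inter> cspace k"
        then obtain z where z: "z \<in> U" "w = (\<lambda>i. z i - v i)" by auto
        have "w k = 0" using w by (simp add: cspace_def)
        then have "z k = q k" using z by (simp add: v_def)
        then have "z \<in> U \<inter> ?L" unfolding UL using z(1) by (auto simp: U_def)
        then show "w \<in> (\<lambda>z i. z i - v i) ` (U \<inter> ?L)" using z(2) by blast
      qed
      then have "adapted_chart (polydisc_mfd (Suc k)) ?L k (Suc k, U, \<lambda>z i. z i - v i)"
        using translation_chart[OF U v] by (simp add: adapted_chart_def)
      then show ?thesis using qU by blast
    next
      case False
      then have qp: "q = p" using q by auto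
      have v: "p \<in> cspace (Suc k)" using p by (simp add: polydisc_def)
      have UL: "U \<inter> ?L = {p}" using qU qp p False by (auto simp: U_def T_def)
      have "(\<lambda>z i. z i - p i) ` (U \<inter> ?L) = (\<lambda>z i. z i - p i) ` U \<inter> cspace 0"
        unfolding UL using qU qp by (auto simp: cspace_def fun_eq_iff intro!: image_eqI[of _ _ p])
      then have "adapted_chart (polydisc_mfd (Suc k)) ?L 0 (Suc k, U, \<lambda>z i. z i - p i)"
        using translation_chart[OF U v] by (simp add: adapted_chart_def)
      then show ?thesis using qU by blast
    qed
  qed
  then show ?thesis using cl by (simp add: closed_submanifold_def)
qed

text \<open>The induced atlas consists of all adapted charts, so an arbitrary one must be treated.
  Coordinate \<open>k\<close> takes finitely many values on the submanifold, hence the inverse chart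
  stays locally in one slice or at \<open>p\<close>. At \<open>p\<close> it is constant; on a slice
  \<open>f\<close> is given by \<open>h\<close> in one chart of \<open>X\<close>, and transition
  maps carry this to every other chart.\<close>

lemma holomorphic_on_slices:
  assumes X: "complex_manifold X" and f: "continuous_map (top_of_set (polydisc n)) (cm_top X) f"
    and S: "finite S" and p: "p \<in> polydisc n" "p k \<notin> S"
    and loc: "\<And>\<sigma>. \<sigma> \<in> S \<Longrightarrow> \<exists>m V \<psi> h. (m, V, \<psi>) \<in> cm_atlas X \<and> cn_holomorphic_map n m (polydisc n) h \<and>
        (\<forall>y\<in>polydisc n. y k = \<sigma> \<longrightarrow> f y \<in> V \<and> \<psi> (f y) = h y)"
  shows "holomorphic_map (induced_structure (polydisc_mfd n) (insert p {y \<in> polydisc n. y k \<in> S})) X f"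
proof -
  let ?P = "polydisc n"
  define L where "L = insert p {y \<in> ?P. y k \<in> S}"
  have LP: "L \<subseteq> ?P" using p by (auto simp: L_def)
  have top: "cm_top (induced_structure (polydisc_mfd n) L) = top_of_set L"
    using LP by (simp add: induced_structure_def subtopology_subtopology inf.absorb2)
  have fL: "continuous_map (top_of_set L) (cm_top X) f"
    using continuous_map_from_subtopology_mono[OF f LP] .
  have chart: "cn_holomorphic_map k' m' (\<phi> ` (U \<inter> L \<inter> L \<inter> f -` V')) (\<psi>' \<circ> f \<circ> inv_into (U \<inter> L) \<phi>)"
    if ad: "adapted_chart (polydisc_mfd n) L k' (n', U, \<phi>)" and C': "(m', V', \<psi>') \<in> cm_atlas X"
    for k' n' U \<phi> m' V' \<psi>'
  proof -
    have ch: "chart_on (top_of_set ?P) (n', U, \<phi>)" and comp: "compatible (n', U, \<phi>) (n, ?P, \<lambda>z. z)"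
      and k': "k' \<le> n'" and UL: "\<phi> ` (U \<inter> L) = \<phi> ` U \<inter> cspace k'"
      using ad by (auto simp: adapted_chart_def maximal_atlas_def)
    note chD = chart_onD[OF ch]
    note C'D = chart_onD[OF atlas_chart_on[OF X C']]
    define \<kappa> where "\<kappa> = inv_into U \<phi>"
    have UP: "U \<subseteq> ?P" using openin_imp_subset[OF chD(1)] .
    have \<kappa>U: "\<kappa> w \<in> U" "\<phi> (\<kappa> w) = w" if "w \<in> \<phi> ` U" for w
      using that by (auto simp: \<kappa>_def inv_into_into f_inv_into_f)
    have \<kappa>\<phi>: "\<kappa> (\<phi> x) = x" if "x \<in> U" for x using inv_into_f_f[OF chD(2) that] by (simp add: \<kappa>_def)
    have \<kappa>hol: "cn_holomorphic_map n' n (\<phi> ` U) \<kappa>"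
      using comp UP by (simp add: compatible_def \<kappa>_def inf.absorb1 o_def)
    define A0 where "A0 = \<phi> ` U \<inter> cspace k'"
    have "cspace k' \<subseteq> cspace n'" using k' by (auto simp: cspace_def)
    then have A0: "openin (top_of_set (cspace k')) A0"
      using chD(3) unfolding A0_def by (auto simp: openin_open)
    have \<kappa>hol0: "cn_holomorphic_map k' n A0 \<kappa>"
      by (rule cn_holomorphic_map_restrict_dim[OF cn_holomorphic_map_subset[OF \<kappa>hol] k']) (simp add: A0_def)
    have \<kappa>L: "\<kappa> w \<in> L" if "w \<in> A0" for w
    proof -
      have "w \<in> \<phi> ` (U \<inter> L)" using that UL by (simp add: A0_def)
      then show ?thesis using \<kappa>\<phi> by auto
    qed
    have \<kappa>c: "continuous_on A0 \<kappa>" by (rule cn_holomorphic_map_continuous[OF \<kappa>hol0])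
    have "continuous_map (top_of_set A0) (top_of_set ?P) \<kappa>" using \<kappa>c \<kappa>L LP by auto
    from continuous_map_compose[OF this f] have f\<kappa>: "continuous_map (top_of_set A0) (cm_top X) (\<lambda>w. f (\<kappa> w))"
      by (simp add: o_def)
    define A where "A = {w \<in> A0. f (\<kappa> w) \<in> V'}"
    have "openin (top_of_set A0) A"
      unfolding A_def using openin_continuous_map_preimage[OF f\<kappa> C'D(1)] by simp
    then have A: "openin (top_of_set (cspace k')) A" using openin_trans[OF _ A0] by blast
    have AA0: "A \<subseteq> A0" by (auto simp: A_def)
    have Aeq: "\<phi> ` (U \<inter> L \<inter> L \<inter> f -` V') = A"
    proof (intro equalityI subsetI)
      fix w assume "w \<in> \<phi> ` (U \<inter> L \<inter> L \<inter> f -` V')"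
      then obtain x where x: "x \<in> U" "x \<in> L" "f x \<in> V'" "w = \<phi> x" by auto
      then have "w \<in> A0" using UL unfolding A0_def by blast
      then show "w \<in> A" using x \<kappa>\<phi>[OF x(1)] by (simp add: A_def)
    next
      fix w assume w: "w \<in> A"
      then have "w \<in> \<phi> ` U" using AA0 by (auto simp: A0_def)
      then have "\<kappa> w \<in> U \<inter> L \<inter> L \<inter> f -` V'" "w = \<phi> (\<kappa> w)"
        using \<kappa>U \<kappa>L w by (auto simp: A_def)
      then show "w \<in> \<phi> ` (U \<inter> L \<inter> L \<inter> f -` V')" by blast
    qed
    have "cn_holomorphic_map k' m' A (\<lambda>w. \<psi>' (f (\<kappa> w)))"
    proof (rule cn_holomorphic_map_local)
      fix w0 assume w0: "w0 \<in> A"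
      define \<sigma> where "\<sigma> = \<kappa> w0 k"
      define T where "T = - (insert (p k) S - {\<sigma>})"
      have "open T" unfolding T_def using S by (intro open_Compl finite_imp_closed) auto
      have "continuous_on A0 (\<lambda>w. \<kappa> w k)"
        using continuous_on_compose2[OF continuous_on_product_coordinates[of k] \<kappa>c] by simp
      then have "openin (top_of_set A0) (A0 \<inter> (\<lambda>w. \<kappa> w k) -` T)"
        using continuous_openin_preimage_gen \<open>open T\<close> by blast
      then obtain R where R: "open R" "A0 \<inter> (\<lambda>w. \<kappa> w k) -` T = A0 \<inter> R" by (auto simp: openin_open)
      have ART: "A \<inter> R = {w \<in> A. \<kappa> w k \<in> T}" using R(2) AA0 by blast
      have w0R: "w0 \<in> A \<inter> R" unfolding ART using w0 by (auto simp: T_def \<sigma>_def)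
      have AR: "openin (top_of_set (cspace k')) (A \<inter> R)" using A R(1) by (simp add: openin_Int_open)
      have sl: "\<kappa> w k = \<sigma>" if "w \<in> A \<inter> R" for w
      proof -
        have "w \<in> A" "\<kappa> w k \<in> T" using that ART by blast+
        moreover have "\<kappa> w \<in> L" using \<kappa>L \<open>w \<in> A\<close> AA0 by blast
        ultimately show ?thesis by (auto simp: L_def T_def)
      qed
      have "cn_holomorphic_map k' m' (A \<inter> R) (\<lambda>w. \<psi>' (f (\<kappa> w)))"
      proof (cases "\<sigma> \<in> S")
        case True
        from loc[OF this] obtain m V \<psi> h where C: "(m, V, \<psi>) \<in> cm_atlas X"
          and h: "cn_holomorphic_map n m ?P h" "\<And>y. y \<in> ?P \<Longrightarrow> y k = \<sigma> \<Longrightarrow> f y \<in> V \<and> \<psi> (f y) = h y" by blast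
        note CD = chart_onD[OF atlas_chart_on[OF X C]]
        have \<kappa>P: "\<kappa> w \<in> ?P" if "w \<in> A \<inter> R" for w using that \<kappa>L AA0 LP by blast
        have 1: "cn_holomorphic_map k' m (A \<inter> R) (\<lambda>w. h (\<kappa> w))"
          by (rule cn_holomorphic_map_compose[OF AR openin_polydisc cn_holomorphic_map_subset[OF \<kappa>hol0] _ h(1)])
             (use AA0 \<kappa>P in auto)
        have 2: "(\<lambda>w. h (\<kappa> w)) ` (A \<inter> R) \<subseteq> \<psi> ` (V \<inter> V')"
        proof
          fix u assume "u \<in> (\<lambda>w. h (\<kappa> w)) ` (A \<inter> R)"
          then obtain w where w: "w \<in> A \<inter> R" "u = h (\<kappa> w)" by blast
          have "f (\<kappa> w) \<in> V" "\<psi> (f (\<kappa> w)) = h (\<kappa> w)" using h(2)[OF \<kappa>P[OF w(1)] sl[OF w(1)]] by auto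
          moreover have "f (\<kappa> w) \<in> V'" using w(1) by (simp add: A_def)
          ultimately show "u \<in> \<psi> ` (V \<inter> V')" using w(2) by (metis IntI image_eqI)
        qed
        have 3: "openin (top_of_set (cspace m)) (\<psi> ` (V \<inter> V'))"
        proof -
          have "openin (top_of_set (\<psi> ` V)) {u \<in> \<psi> ` V. inv_into V \<psi> u \<in> V'}"
            using openin_continuous_map_preimage[OF CD(5) C'D(1)] by simp
          moreover have "{u \<in> \<psi> ` V. inv_into V \<psi> u \<in> V'} = \<psi> ` (V \<inter> V')"
            using inv_into_f_f[OF CD(2)] by auto
          ultimately show ?thesis using openin_trans[OF _ CD(3)] by simp
        qed
        have "compatible (m, V, \<psi>) (m', V', \<psi>')" using X C C' by (auto simp: complex_manifold_def)
        then have 4: "cn_holomorphic_map m m' (\<psi> ` (V \<inter> V')) (\<psi>' \<circ> inv_into V \<psi>)" by (simp add: compatible_def)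
        from cn_holomorphic_map_compose[OF AR 3 1 2 4]
        show ?thesis
        proof (rule cn_holomorphic_map_cong[OF AR, rotated])
          fix w assume w: "w \<in> A \<inter> R"
          have "f (\<kappa> w) \<in> V" "\<psi> (f (\<kappa> w)) = h (\<kappa> w)" using h(2)[OF \<kappa>P[OF w] sl[OF w]] by auto
          then show "(\<psi>' \<circ> inv_into V \<psi>) (h (\<kappa> w)) = \<psi>' (f (\<kappa> w))"
            using inv_into_f_f[OF CD(2), of "f (\<kappa> w)"] by simp
        qed
      next
        case False
        have "\<kappa> w = p" if "w \<in> A \<inter> R" for w
        proof -
          have "\<kappa> w \<in> L" using that \<kappa>L AA0 by blast
          then show ?thesis using False sl[OF that] by (auto simp: L_def)
        qed
        moreover have "\<psi>' (f p) \<in> cspace m'"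
        proof -
          have "f (\<kappa> w0) \<in> V'" using w0 by (simp add: A_def)
          then have "\<psi>' (f (\<kappa> w0)) \<in> cspace m'" using openin_imp_subset[OF C'D(3)] by blast
          then show ?thesis using calculation[OF w0R] by simp
        qed
        ultimately have const: "cn_holomorphic_map k' m' (A \<inter> R) (\<lambda>w. \<psi>' (f p))" and \<kappa>p: "\<And>w. w \<in> A \<inter> R \<Longrightarrow> \<kappa> w = p"
          using cn_holomorphic_on_const by (auto simp: cn_holomorphic_map_def)
        show ?thesis by (rule cn_holomorphic_map_cong[OF AR _ const]) (simp only: \<kappa>p)
      qed
      then show "\<exists>T. open T \<and> w0 \<in> T \<and> cn_holomorphic_map k' m' (A \<inter> T) (\<lambda>w. \<psi>' (f (\<kappa> w)))"
        using R(1) w0R by blast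
    qed
    then have "cn_holomorphic_map k' m' A (\<psi>' \<circ> f \<circ> inv_into (U \<inter> L) \<phi>)"
    proof (rule cn_holomorphic_map_cong[OF A, rotated])
      fix w assume w: "w \<in> A"
      have "w \<in> \<phi> ` U" using w AA0 by (auto simp: A0_def)
      then have "\<kappa> w \<in> U \<inter> L" "w = \<phi> (\<kappa> w)" using \<kappa>U \<kappa>L w AA0 by auto
      then have "inv_into (U \<inter> L) \<phi> w = \<kappa> w"
        using inv_into_f_f[of \<phi> "U \<inter> L" "\<kappa> w"] inj_on_subset[OF chD(2)] by auto
      then show "\<psi>' (f (\<kappa> w)) = (\<psi>' \<circ> f \<circ> inv_into (U \<inter> L) \<phi>) w" by simp
    qed
    then show ?thesis by (simp only: Aeq)
  qed
  have "points (induced_structure (polydisc_mfd n) L) = L" using top by simp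
  moreover have "subtopology (top_of_set L) L = top_of_set L" by (simp add: subtopology_subtopology)
  moreover have "cm_atlas (induced_structure (polydisc_mfd n) L) =
      {(k, U \<inter> L, \<phi>) |k n' U \<phi>. adapted_chart (polydisc_mfd n) L k (n', U, \<phi>)}"
    by (simp add: induced_structure_def)
  ultimately have "holomorphic_map (induced_structure (polydisc_mfd n) L) X f"
    unfolding holomorphic_map_on_def top using fL chart by auto
  then show ?thesis by (simp only: L_def)
qed

section \<open>The Oka property on the polydisc\<close>

text \<open>Two homotopies joined at the constant \<open>\<phi> e\<close>: for \<tau> from 0 to 1/2
  the argument of \<phi> moves along the segment from \<open>y 0\<close> to \<open>e\<close>, and
  for \<tau> from 1/2 to 1 the map \<open>q\<close> is spread out from the origin to
  \<open>q y\<close>. The closest point is taken because \<open>y 0\<close> may leave the closed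
  unit disc and \<tau> may be negative.\<close>

lemma glue_homotopy:
  assumes \<phi>: "continuous_map (top_of_set (cball 0 1)) T \<phi>"
    and q: "continuous_map (top_of_set (polydisc n)) T q" "q (\<lambda>_. 0) = \<phi> e" and e: "e \<in> cball 0 1"
    and \<tau>: "continuous_on (polydisc n) \<tau>" "\<And>y. y \<in> polydisc n \<Longrightarrow> \<tau> y \<le> 1"
  shows "continuous_map (top_of_set (polydisc n)) T (\<lambda>y. if \<tau> y \<le> 1/2
    then \<phi> (closest_point (cball 0 1) ((1 - 2 * of_real (\<tau> y)) * y 0 + 2 * of_real (\<tau> y) * e))
    else q (\<lambda>j. of_real (2 * \<tau> y - 1) * y j))"
proof (rule continuous_map_cases_le)
  let ?P = "polydisc n"
  have coord: "continuous_on A (\<lambda>y::nat \<Rightarrow> complex. y j)" for A j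
    by (rule continuous_on_subset[OF continuous_on_product_coordinates]) simp
  show "continuous_map (top_of_set ?P) euclideanreal \<tau>" "continuous_map (top_of_set ?P) euclideanreal (\<lambda>_. 1/2)"
    using \<tau> by auto
  have "continuous_on ?P (\<lambda>y. closest_point (cball 0 1) ((1 - 2 * of_real (\<tau> y)) * y 0 + 2 * of_real (\<tau> y) * e))"
    by (rule continuous_on_compose2[OF continuous_on_closest_point[of "cball 0 1" UNIV]])
       (auto intro!: continuous_intros coord \<tau>(1))
  moreover have "closest_point (cball 0 1) w \<in> cball 0 1" for w :: complex
    by (rule closest_point_in_set) auto
  ultimately have "continuous_map (top_of_set ?P) (top_of_set (cball 0 1))
      (\<lambda>y. closest_point (cball 0 1) ((1 - 2 * of_real (\<tau> y)) * y 0 + 2 * of_real (\<tau> y) * e))"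
    by (auto simp del: mem_cball)
  from continuous_map_compose[OF this \<phi>]
  show "continuous_map (subtopology (top_of_set ?P) {y \<in> topspace (top_of_set ?P). \<tau> y \<le> 1/2}) T
     (\<lambda>y. \<phi> (closest_point (cball 0 1) ((1 - 2 * of_real (\<tau> y)) * y 0 + 2 * of_real (\<tau> y) * e)))"
    by (simp add: o_def continuous_map_from_subtopology)
  define B where "B = {y \<in> ?P. 1/2 \<le> \<tau> y}"
  have "(\<lambda>j. of_real (2 * \<tau> y - 1) * y j) \<in> ?P" if y: "y \<in> B" for y
  proof -
    have t: "\<bar>2 * \<tau> y - 1\<bar> \<le> 1" using y \<tau>(2)[of y] by (auto simp: B_def)
    have "cmod (of_real (2 * \<tau> y - 1) * y j) < 2" for j
    proof -
      have "cmod (of_real (2 * \<tau> y - 1) * y j) \<le> 1 * cmod (y j)"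
        unfolding norm_mult norm_of_real using t by (intro mult_right_mono) auto
      also have "\<dots> < 2" using y by (simp add: B_def polydisc_def)
      finally show ?thesis .
    qed
    then show ?thesis using y by (auto simp: B_def polydisc_def cspace_def)
  qed
  moreover have "continuous_on B (\<lambda>y j. of_real (2 * \<tau> y - 1) * y j)"
    by (intro continuous_on_coordinatewise_then_product continuous_intros coord continuous_on_subset[OF \<tau>(1)])
       (auto simp: B_def)
  ultimately have "continuous_map (top_of_set B) (top_of_set ?P) (\<lambda>y j. of_real (2 * \<tau> y - 1) * y j)" by auto
  from continuous_map_compose[OF this q(1)]
  have "continuous_map (top_of_set B) T (\<lambda>y. q (\<lambda>j. of_real (2 * \<tau> y - 1) * y j))" by (simp add: o_def)
  moreover have "subtopology (top_of_set ?P) {y \<in> topspace (top_of_set ?P). 1/2 \<le> \<tau> y} = top_of_set B"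
  proof -
    have "?P \<inter> {y \<in> ?P. 1/2 \<le> \<tau> y} = B" by (auto simp: B_def)
    then show ?thesis by (simp add: subtopology_subtopology)
  qed
  ultimately show "continuous_map (subtopology (top_of_set ?P) {y \<in> topspace (top_of_set ?P). 1/2 \<le> \<tau> y}) T
     (\<lambda>y. q (\<lambda>j. of_real (2 * \<tau> y - 1) * y j))" by simp
  show "\<phi> (closest_point (cball 0 1) ((1 - 2 * of_real (\<tau> y)) * y 0 + 2 * of_real (\<tau> y) * e)) =
      q (\<lambda>j. of_real (2 * \<tau> y - 1) * y j)" if "\<tau> y = 1/2" for y
    by (simp add: that q(2) closest_point_self[OF e])
qed

text \<open>The closed \<delta>-neighbourhoods of the slices are disjoint. On each of them
  \<open>\<tau> i\<close> falls from 1 on the slice to 0 on the rim, where the homotopy has reached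
  the outer map, so finitely many closed pieces can be pasted.\<close>

lemma glue_pieces:
  fixes s :: "nat \<Rightarrow> complex" and q :: "nat \<Rightarrow> (nat \<Rightarrow> complex) \<Rightarrow> 'a"
  assumes \<phi>: "continuous_map (top_of_set (cball 0 1)) T \<phi>"
    and q: "\<And>i. i < l \<Longrightarrow> continuous_map (top_of_set (polydisc n)) T (q i)"
       "\<And>i. i < l \<Longrightarrow> q i (\<lambda>_. 0) = \<phi> (e i)" and e: "\<And>i. i < l \<Longrightarrow> e i \<in> cball 0 1"
    and \<delta>: "\<delta> > 0" and sep: "\<And>i j. i < l \<Longrightarrow> j < l \<Longrightarrow> i \<noteq> j \<Longrightarrow> 2 * \<delta> < dist (s i) (s j)"
  obtains f where "continuous_map (top_of_set (polydisc n)) T f"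
    "\<And>y. y \<in> polydisc n \<Longrightarrow> (\<And>i. i < l \<Longrightarrow> \<delta> \<le> dist (y k) (s i)) \<Longrightarrow> f y = \<phi> (closest_point (cball 0 1) (y 0))"
    "\<And>i y. i < l \<Longrightarrow> y \<in> polydisc n \<Longrightarrow> y k = s i \<Longrightarrow> f y = q i y"
proof -
  let ?P = "polydisc n"
  have coord: "continuous_on A (\<lambda>y::nat \<Rightarrow> complex. y j)" for A j
    by (rule continuous_on_subset[OF continuous_on_product_coordinates]) simp
  define \<tau> where "\<tau> i y = 1 - dist (y k) (s i) / \<delta>" for i and y :: "nat \<Rightarrow> complex"
  \<comment> \<open>Index \<open>l\<close> stands for the outer piece, away from all slices; the
    indices below \<open>l\<close> are the neighbourhoods of the slices.\<close>
  define h where "h i y = (if i = l then \<phi> (closest_point (cball 0 1) (y 0))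
    else if \<tau> i y \<le> 1/2 then \<phi> (closest_point (cball 0 1) ((1 - 2 * of_real (\<tau> i y)) * y 0 + 2 * of_real (\<tau> i y) * e i))
    else q i (\<lambda>j. of_real (2 * \<tau> i y - 1) * y j))" for i and y :: "nat \<Rightarrow> complex"
  define C where "C i = (if i = l then {y \<in> ?P. \<forall>i<l. \<delta> \<le> dist (y k) (s i)} else {y \<in> ?P. dist (y k) (s i) \<le> \<delta>})" for i
  have cl: "closedin (top_of_set ?P) (C i)" if "i \<le> l" for i
  proof -
    have 1: "closed {y::nat \<Rightarrow> complex. \<delta> \<le> dist (y k) (s i)}" "closed {y::nat \<Rightarrow> complex. dist (y k) (s i) \<le> \<delta>}" for i
      by (intro closed_Collect_le continuous_intros coord)+
    have "C i = ?P \<inter> (if i = l then (\<Inter>i<l. {y. \<delta> \<le> dist (y k) (s i)}) else {y. dist (y k) (s i) \<le> \<delta>})"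
      by (auto simp: C_def)
    moreover have "closed (if i = l then (\<Inter>i<l. {y::nat \<Rightarrow> complex. \<delta> \<le> dist (y k) (s i)}) else {y. dist (y k) (s i) \<le> \<delta>})"
      using 1 by auto
    ultimately show ?thesis by (metis closedin_closed)
  qed
  have cont: "continuous_map (top_of_set ?P) T (h i)" if i: "i \<le> l" for i
  proof (cases "i = l")
    case True
    have "continuous_on ?P (\<lambda>y. closest_point (cball 0 1) (y 0))"
      by (rule continuous_on_compose2[OF continuous_on_closest_point[of "cball 0 1" UNIV]]) (auto intro!: coord)
    moreover have "closest_point (cball 0 1) w \<in> cball 0 1" for w :: complex
      by (rule closest_point_in_set) auto
    ultimately have "continuous_map (top_of_set ?P) (top_of_set (cball 0 1)) (\<lambda>y. closest_point (cball 0 1) (y 0))"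
      by (auto simp del: mem_cball)
    from continuous_map_compose[OF this \<phi>] show ?thesis using True by (simp add: h_def[abs_def] o_def)
  next
    case False
    then have "i < l" using i by simp
    have "continuous_on ?P (\<tau> i)" unfolding \<tau>_def using \<delta> by (intro continuous_intros coord) auto
    moreover have "\<tau> i y \<le> 1" for y using \<delta> by (simp add: \<tau>_def)
    ultimately show ?thesis
      using glue_homotopy[OF \<phi> q(1)[OF \<open>i < l\<close>] q(2)[OF \<open>i < l\<close>] e[OF \<open>i < l\<close>], of "\<tau> i"] False by (simp add: h_def[abs_def])
  qed
  have zero: "h i y = \<phi> (closest_point (cball 0 1) (y 0))" if "dist (y k) (s i) = \<delta>" for i y
    using that \<delta> by (simp add: h_def \<tau>_def)
  have agree0: "h i y = h j y" if ij: "i < j" "j \<le> l" and y: "y \<in> C i" "y \<in> C j" for i j y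
  proof -
    have yi: "dist (y k) (s i) \<le> \<delta>" using ij y by (simp add: C_def)
    have "j = l"
    proof (rule ccontr)
      assume "j \<noteq> l"
      then have "dist (y k) (s j) \<le> \<delta>" using y by (simp add: C_def)
      then have "dist (s i) (s j) \<le> 2 * \<delta>" using yi dist_triangle3[of "s i" "s j" "y k"] by simp
      then show False using sep[of i j] ij \<open>j \<noteq> l\<close> by simp
    qed
    then have "\<delta> \<le> dist (y k) (s i)" using y ij by (simp add: C_def)
    then show ?thesis using zero[of y i] yi \<open>j = l\<close> by (simp add: h_def)
  qed
  have agree: "h i y = h j y" if "i \<le> l" "j \<le> l" "y \<in> C i" "y \<in> C j" for i j y
  proof (cases i j rule: linorder_cases)
    case less
    show ?thesis by (rule agree0[OF less that(2-4)])
  next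
    case greater
    show ?thesis by (rule agree0[OF greater that(1,4,3), symmetric])
  qed simp
  have cover: "\<exists>i\<le>l. y \<in> C i" if "y \<in> ?P" for y
  proof (cases "\<forall>i<l. \<delta> \<le> dist (y k) (s i)")
    case True
    then have "y \<in> C l" using that by (simp add: C_def)
    then show ?thesis by blast
  next
    case False
    then obtain i where "i < l" "\<not> \<delta> \<le> dist (y k) (s i)" by blast
    then have "y \<in> C i" using that by (simp add: C_def)
    then show ?thesis using \<open>i < l\<close> by (intro exI[of _ i]) simp
  qed
  obtain f where f: "continuous_map (top_of_set ?P) T f" "\<And>y i. i \<in> {..l} \<Longrightarrow> y \<in> topspace (top_of_set ?P) \<inter> C i \<Longrightarrow> f y = h i y"
  proof (rule pasting_lemma_exists_closed[of "{..l}" "top_of_set ?P" C T h])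
    show "topspace (top_of_set ?P) \<subseteq> \<Union> (C ` {..l})" using cover by auto
    show "closedin (top_of_set ?P) (C i)" if "i \<in> {..l}" for i using cl that by simp
    show "continuous_map (subtopology (top_of_set ?P) (C i)) T (h i)" if "i \<in> {..l}" for i
      using continuous_map_from_subtopology[OF cont] that by simp
    show "h i y = h j y" if "i \<in> {..l}" "j \<in> {..l}" "y \<in> topspace (top_of_set ?P) \<inter> C i \<inter> C j" for i j y
      by (rule agree) (use that in auto)
  qed simp_all
  show thesis
  proof (rule that[OF f(1)])
    fix y assume y: "y \<in> ?P" "\<And>i. i < l \<Longrightarrow> \<delta> \<le> dist (y k) (s i)"
    then have "f y = h l y" by (intro f(2)) (auto simp: C_def)
    then show "f y = \<phi> (closest_point (cball 0 1) (y 0))" by (simp add: h_def)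
  next
    fix i y assume y: "i < l" "y \<in> ?P" "y k = s i"
    then have "f y = h i y" using \<delta> by (intro f(2)) (auto simp: C_def)
    then show "f y = q i y" using y by (simp add: h_def \<tau>_def)
  qed
qed

lemma bchoice5:
  "\<forall>x\<in>E. \<exists>a b c d e. P x a b c d e \<Longrightarrow> \<exists>a b c d e. \<forall>x\<in>E. P x (a x) (b x) (c x) (d x) (e x)"
  by metis

text \<open>In units of \<open>r\<close> around the centre, the box \<open>2 * r\<close> is exactly
  what polydisc coordinates of modulus below 2 can reach, so the inverse chart is defined on all of
  the polydisc. The bound \<open>r / 4\<close> compensates the factor 4 lost in
  \<open>Rudin_Carleson\<close>.\<close>

lemma chart_box_neighbourhood:
  assumes X: "complex_manifold X" and \<phi>: "continuous_map (top_of_set (cball 0 1)) (cm_top X) \<phi>"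
    and x: "x \<in> cball 0 1"
  shows "\<exists>m V \<psi> r N. (m, V, \<psi>) \<in> cm_atlas X \<and> \<phi> x \<in> V \<and> r > 0 \<and>
    (\<forall>u\<in>cspace m. (\<forall>j<m. cmod (u j - \<psi> (\<phi> x) j) < 2 * r) \<longrightarrow> u \<in> \<psi> ` V) \<and>
    open N \<and> x \<in> N \<and> (\<forall>z\<in>cball 0 1 \<inter> N. \<phi> z \<in> V \<and> (\<forall>j<m. cmod (\<psi> (\<phi> z) j - \<psi> (\<phi> x) j) < r / 4))"
proof -
  have "\<phi> x \<in> points X" using \<phi> x continuous_map_image_subset_topspace by fastforce
  then obtain m V \<psi> where C: "(m, V, \<psi>) \<in> cm_atlas X" "\<phi> x \<in> V" using ex_chart[OF X] by blast
  note CD = chart_onD[OF atlas_chart_on[OF X C(1)]]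
  obtain \<epsilon> where \<epsilon>: "\<epsilon> > 0" "\<And>u. u \<in> cspace m \<Longrightarrow> (\<And>j. j < m \<Longrightarrow> cmod (u j - \<psi> (\<phi> x) j) < \<epsilon>) \<Longrightarrow> u \<in> \<psi> ` V"
    using cspace_open_contains_polydisc[OF CD(3) imageI[OF C(2)]] by blast
  define r where "r = \<epsilon> / 2"
  define O' where "O' = (\<Inter>j<m. {u. cmod (u j - \<psi> (\<phi> x) j) < r / 4})"
  have "open O'" unfolding O'_def
    by (intro open_INT ballI open_Collect_coord open_Collect_less continuous_intros) auto
  then have "openin (subtopology (cm_top X) V) {y \<in> topspace (subtopology (cm_top X) V). \<psi> y \<in> O'}"
    using openin_continuous_map_preimage[OF CD(4), of O'] by simp
  then have "openin (cm_top X) {y \<in> topspace (subtopology (cm_top X) V). \<psi> y \<in> O'}"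
    using openin_trans_full[OF _ CD(1)] by blast
  moreover have "topspace (subtopology (cm_top X) V) = V" using openin_subset[OF CD(1)] by auto
  ultimately have V': "openin (cm_top X) {y \<in> V. \<psi> y \<in> O'}" by (simp only:)
  from openin_continuous_map_preimage[OF \<phi> V']
  obtain N where N: "open N" "{z \<in> cball 0 1. \<phi> z \<in> {y \<in> V. \<psi> y \<in> O'}} = cball 0 1 \<inter> N"
    unfolding topspace_euclidean_subtopology by (auto simp only: openin_open)
  have "r > 0" using \<epsilon> by (simp add: r_def)
  have "x \<in> N"
  proof -
    have "x \<in> {z \<in> cball 0 1. \<phi> z \<in> {y \<in> V. \<psi> y \<in> O'}}" using x C(2) \<open>r > 0\<close> by (simp add: O'_def)
    then show ?thesis using N(2) by blast
  qed
  moreover have "\<phi> z \<in> V \<and> (\<forall>j<m. cmod (\<psi> (\<phi> z) j - \<psi> (\<phi> x) j) < r / 4)" if "z \<in> cball 0 1 \<inter> N" for z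
  proof -
    have "z \<in> {z \<in> cball 0 1. \<phi> z \<in> {y \<in> V. \<psi> y \<in> O'}}" using that N(2) by blast
    then show ?thesis by (simp add: O'_def)
  qed
  moreover have "\<forall>u\<in>cspace m. (\<forall>j<m. cmod (u j - \<psi> (\<phi> x) j) < 2 * r) \<longrightarrow> u \<in> \<psi> ` V"
    using \<epsilon>(2) by (simp add: r_def)
  ultimately show ?thesis using C N(1) \<open>r > 0\<close>
    by (intro exI[of _ m] exI[of _ V] exI[of _ \<psi>] exI[of _ r] exI[of _ N]) blast
qed

theorem mainTheorem2:
  fixes X :: "'a cmfd" and d :: "'a \<Rightarrow> 'a \<Rightarrow> real"
    and E K :: "complex set" and c :: complex and \<phi> :: "complex \<Rightarrow> 'a"
  assumes "oka_manifold X"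
    and "induces_topology d (cm_top X)"
    and "closed E" and "E \<subseteq> sphere 0 1" and "E \<in> null_sets arc_length"
    and "compact K" and "K \<subseteq> ball 0 1"
    and "\<forall>C \<in> components (ball 0 1 - K).
           \<not> compactin (top_of_set (ball 0 1)) (top_of_set (ball 0 1) closure_of C)"
    and "c \<in> ball 0 1"
    and "continuous_map (top_of_set (cball 0 1)) (cm_top X) \<phi>"
    and "\<exists>W. K \<subseteq> W \<and> W \<subseteq> ball 0 1 \<and> holomorphic_map_on complex_plane X W \<phi>"
  shows "\<forall>\<epsilon>>0. \<exists>F. continuous_map (top_of_set (cball 0 1)) (cm_top X) F \<and>
           holomorphic_map_on complex_plane X (ball 0 1) F \<and>
           (\<forall>z\<in>K. d (F z) (\<phi> z) < \<epsilon>) \<and> (\<forall>z\<in>E. F z = \<phi> z) \<and> F c = \<phi> c"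
proof (intro allI impI)
  fix \<epsilon> :: real assume \<epsilon>: "\<epsilon> > 0"
  note \<phi> = assms(10)
  have E: "circle_null E" using assms(3-5) by (simp add: circle_null_def)
  have EC: "E \<subseteq> cball 0 1" using assms(4) sphere_cball by blast
  have X: "complex_manifold X" using assms(1) by (simp add: oka_manifold_def)
  have KC: "K \<subseteq> cball 0 1" using assms(7) ball_subset_cball by blast

  \<comment> \<open>Pieces of \<open>E\<close>, their charts, and the inverse charts on the
    polydisc\<close>
  have "\<forall>x\<in>E. \<exists>m V \<psi> r N. (m, V, \<psi>) \<in> cm_atlas X \<and> \<phi> x \<in> V \<and> r > 0 \<and>
    (\<forall>u\<in>cspace m. (\<forall>j<m. cmod (u j - \<psi> (\<phi> x) j) < 2 * r) \<longrightarrow> u \<in> \<psi> ` V) \<and>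
    open N \<and> x \<in> N \<and> (\<forall>z\<in>cball 0 1 \<inter> N. \<phi> z \<in> V \<and> (\<forall>j<m. cmod (\<psi> (\<phi> z) j - \<psi> (\<phi> x) j) < r / 4))"
    by (intro ballI chart_box_neighbourhood[OF X \<phi>] subsetD[OF EC])
  from bchoice5[OF this] obtain m V \<psi> r N where loc: "\<forall>x\<in>E. (m x, V x, \<psi> x) \<in> cm_atlas X \<and> \<phi> x \<in> V x \<and> r x > 0 \<and>
    (\<forall>u\<in>cspace (m x). (\<forall>j<m x. cmod (u j - \<psi> x (\<phi> x) j) < 2 * r x) \<longrightarrow> u \<in> \<psi> x ` V x) \<and>
    open (N x) \<and> x \<in> N x \<and>
    (\<forall>z\<in>cball 0 1 \<inter> N x. \<phi> z \<in> V x \<and> (\<forall>j<m x. cmod (\<psi> x (\<phi> z) j - \<psi> x (\<phi> x) j) < r x / 4))"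
    by (elim exE)
  have "open (N x) \<and> x \<in> N x" if "x \<in> E" for x using loc that by blast
  from circle_null_partition[OF E this] obtain l :: nat and y A where
    y: "\<And>i. i < l \<Longrightarrow> y i \<in> E" and A: "\<And>i. i < l \<Longrightarrow> A i \<subseteq> N (y i)" "\<And>i. i < l \<Longrightarrow> closed (A i)"
      "disjoint_family_on A {..<l}" "E = (\<Union>i<l. A i)" by blast
  define a where "a i = \<psi> (y i) (\<phi> (y i))" for i
  have chart: "(m (y i), V (y i), \<psi> (y i)) \<in> cm_atlas X" and rpos: "r (y i) > 0" and yV: "\<phi> (y i) \<in> V (y i)"
    and box: "\<And>u. u \<in> cspace (m (y i)) \<Longrightarrow> (\<And>j. j < m (y i) \<Longrightarrow> cmod (u j - a i j) < 2 * r (y i)) \<Longrightarrow> u \<in> \<psi> (y i) ` V (y i)"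
    if "i < l" for i
    using bspec[OF loc y[OF that]] by (auto simp: a_def)
  have near: "\<phi> z \<in> V (y i)" "\<And>j. j < m (y i) \<Longrightarrow> cmod (\<psi> (y i) (\<phi> z) j - a i j) < r (y i) / 4"
    if "i < l" "z \<in> A i" for i z
  proof -
    have "z \<in> cball 0 1 \<inter> N (y i)" using that A(1,4) EC by blast
    then show "\<phi> z \<in> V (y i)" "\<And>j. j < m (y i) \<Longrightarrow> cmod (\<psi> (y i) (\<phi> z) j - a i j) < r (y i) / 4"
      using bspec[OF loc y[OF that(1)]] by (auto simp: a_def)
  qed
  note cD = chart_onD[OF atlas_chart_on[OF X chart]]

  \<comment> \<open>Chart dimensions may differ between components of \<open>X\<close>, hence a
    common bound \<open>M\<close>. Coordinate 0 is \<open>z\<close>, coordinates 1 to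
    \<open>M\<close> hold chart coordinates, and coordinate \<open>k = M + 1\<close> selects the
    slice.\<close>
  define M where "M = Max (insert 0 ((\<lambda>i. m (y i)) ` {..<l}))"
  define k where "k = Suc M"
  have mM: "m (y i) \<le> M" if "i < l" for i unfolding M_def using that by (intro Max_ge) auto
  let ?P = "polydisc (Suc k)"

  \<comment> \<open>Undoes the normalisation of the chart coordinates by centre and radius;
    \<open>Suc j\<close> skips coordinate 0, and coordinates beyond the dimension of the chart are
    ignored.\<close>
  define u where "u i Y j = (if j < m (y i) then a i j + of_real (r (y i)) * Y (Suc j) else 0)"
    for i j and Y :: "nat \<Rightarrow> complex"
  define q where "q i Y = inv_into (V (y i)) (\<psi> (y i)) (u i Y)" for i Y
  have uV: "u i Y \<in> \<psi> (y i) ` V (y i)" if "i < l" "Y \<in> ?P" for i Y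
  proof (rule box[OF that(1)])
    show "u i Y \<in> cspace (m (y i))" by (auto simp: u_def cspace_def)
    fix j assume "j < m (y i)"
    moreover have "cmod (Y (Suc j)) < 2" using that(2) by (simp add: polydisc_def)
    ultimately show "cmod (u i Y j - a i j) < 2 * r (y i)"
      using rpos[OF that(1)] by (simp add: u_def norm_mult)
  qed
  have uhol: "cn_holomorphic_map (Suc k) (m (y i)) ?P (u i)" for i
    unfolding cn_holomorphic_map_def
  proof (intro conjI allI impI)
    show "u i ` ?P \<subseteq> cspace (m (y i))" by (auto simp: u_def cspace_def)
    show "cn_holomorphic_on (Suc k) ?P (\<lambda>Y. u i Y j)" if "j < m (y i)" for j
      using that by (simp add: u_def cn_holomorphic_on_affine)
  qed
  have qc: "continuous_map (top_of_set ?P) (cm_top X) (q i)" if i: "i < l" for i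
  proof -
    have "continuous_map (top_of_set ?P) (top_of_set (\<psi> (y i) ` V (y i))) (u i)"
      using cn_holomorphic_map_continuous[OF uhol] uV[OF i] by auto
    from continuous_map_compose[OF this cD(5)[OF i]] show ?thesis by (simp add: q_def[abs_def] o_def)
  qed
  have aC: "a i \<in> cspace (m (y i))" if "i < l" for i
    using openin_imp_subset[OF cD(3)[OF that]] yV[OF that] by (auto simp: a_def)
  have q0: "q i (\<lambda>_. 0) = \<phi> (y i)" if i: "i < l" for i
  proof -
    have "u i (\<lambda>_. 0) = \<psi> (y i) (\<phi> (y i))"
      using aC[OF i] by (auto simp: u_def a_def cspace_def fun_eq_iff)
    then show ?thesis using inv_into_f_f[OF cD(2)[OF i] yV[OF i]] by (simp add: q_def)
  qed
  have yC: "y i \<in> cball 0 1" if "i < l" for i using y[OF that] EC by blast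

  \<comment> \<open>The slice values start at 1/2 and stay below 1, with spacing
    \<open>3 * \<delta>\<close>, which exceeds the required \<open>2 * \<delta>\<close>. As \<delta>
    is at most 1/6, every number of modulus at most 1/3 keeps distance \<delta> from all of them.
    The summand 1 in \<open>real l + 1\<close> covers empty \<open>E\<close>.\<close>
  define \<delta> :: real where "\<delta> = 1 / (6 * (real l + 1))"
  define s :: "nat \<Rightarrow> complex" where "s i = of_real (1/2 + real i / (2 * (real l + 1)))" for i
  have \<delta>: "\<delta> > 0" "\<delta> \<le> 1/6" by (auto simp: \<delta>_def divide_le_eq)
  have sep: "2 * \<delta> < dist (s i) (s j)" if "i \<noteq> j" for i j
  proof -
    have "dist (s i) (s j) = \<bar>real i - real j\<bar> / (2 * (real l + 1))"
      unfolding s_def dist_of_real dist_real_def by (simp flip: diff_divide_distrib)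
    moreover have "1 \<le> \<bar>real i - real j\<bar>" using that by linarith
    then have "1 / (2 * (real l + 1)) \<le> \<bar>real i - real j\<bar> / (2 * (real l + 1))"
      by (intro divide_right_mono) auto
    moreover have "2 * \<delta> < 1 / (2 * (real l + 1))" by (simp add: \<delta>_def field_simps)
    ultimately show ?thesis by linarith
  qed
  have snorm: "1/2 \<le> cmod (s i)" "i < l \<Longrightarrow> cmod (s i) \<le> 1" for i
  proof -
    have eq: "cmod (s i) = 1/2 + real i / (2 * (real l + 1))" unfolding s_def norm_of_real by simp
    then show "1/2 \<le> cmod (s i)" by simp
    assume "i < l"
    then have "real i / (2 * (real l + 1)) \<le> 1/2" by (simp add: divide_le_eq)
    then show "cmod (s i) \<le> 1" using eq by linarith
  qed
  have sfar: "\<delta> \<le> dist w (s i)" if "cmod w \<le> 1/3" for w i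
    using that snorm(1)[of i] \<delta>(2) norm_triangle_ineq2[of "s i" w] by (simp add: dist_norm norm_minus_commute)

  obtain f where fc: "continuous_map (top_of_set ?P) (cm_top X) f"
    and f0: "\<And>Y. Y \<in> ?P \<Longrightarrow> (\<And>i. i < l \<Longrightarrow> \<delta> \<le> dist (Y k) (s i)) \<Longrightarrow> f Y = \<phi> (closest_point (cball 0 1) (Y 0))"
    and fq: "\<And>i Y. i < l \<Longrightarrow> Y \<in> ?P \<Longrightarrow> Y k = s i \<Longrightarrow> f Y = q i Y"
    using glue_pieces[where l = l and q = q and e = y and s = s and n = "Suc k" and k = k, OF \<phi> qc q0 yC \<delta>(1) sep]
    by blast
  have f\<phi>: "f Y = \<phi> (Y 0)" if "Y \<in> ?P" "cmod (Y k) \<le> 1/3" "Y 0 \<in> cball 0 1" for Y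
    using f0[OF that(1) sfar[OF that(2)]] closest_point_self[OF that(3)] by simp

  \<comment> \<open>Disc algebra functions with prescribed values on \<open>E\<close>, and the map
    \<open>G\<close>\<close>
  define idx where "idx z = (THE i. i < l \<and> z \<in> A i)" for z
  have idx: "idx z = i" if "i < l" "z \<in> A i" for i z
    unfolding idx_def using that A(3) by (intro the_equality) (auto simp: disjoint_family_on_def)
  have piecewise: "continuous_on E g" if "\<And>i. i < l \<Longrightarrow> continuous_on (A i) g" for g :: "complex \<Rightarrow> complex"
    unfolding A(4) using that A(2) by (intro continuous_on_closed_Union) auto

  \<comment> \<open>Chart coordinates of \<phi> along \<open>E\<close> in units of the radius: the
    bound \<open>r / 4\<close> becomes 1/4, so the extensions have modulus at most 1.\<close>
  define w where "w j z = (let i = idx z in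
      if j < m (y i) then (\<psi> (y i) (\<phi> z) j - a i j) / of_real (r (y i)) else 0)" for j z
  have wA: "w j z = (if j < m (y i) then (\<psi> (y i) (\<phi> z) j - a i j) / of_real (r (y i)) else 0)"
    if "i < l" "z \<in> A i" for i j z
    using idx[OF that] by (simp add: w_def)
  have "\<exists>G\<in>disc_algebra. (\<forall>z\<in>E. G z = w j z) \<and> (\<forall>z\<in>cball 0 1. cmod (G z) \<le> 1)" for j
  proof -
    have "continuous_on E (w j)"
    proof (rule piecewise)
      fix i assume i: "i < l"
      have "continuous_map (top_of_set (A i)) (cm_top X) \<phi>"
        using continuous_map_from_subtopology_mono[OF \<phi>, of "A i"] A(4) EC i by blast
      then have "continuous_map (top_of_set (A i)) (subtopology (cm_top X) (V (y i))) \<phi>"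
        using near(1)[OF i] by (auto simp: continuous_map_in_subtopology)
      from continuous_map_compose[OF this cD(4)[OF i]]
      have "continuous_on (A i) (\<lambda>z. \<psi> (y i) (\<phi> z))" by (simp add: o_def)
      then have "continuous_on (A i) (\<lambda>z. \<psi> (y i) (\<phi> z) j)" by (rule continuous_on_product_then_coordinatewise)
      then have "continuous_on (A i) (\<lambda>z. if j < m (y i) then (\<psi> (y i) (\<phi> z) j - a i j) / of_real (r (y i)) else 0)"
        using rpos[OF i] by (cases "j < m (y i)") (auto intro!: continuous_intros)
      then show "continuous_on (A i) (w j)" by (simp add: wA[OF i] cong: continuous_on_cong)
    qed
    moreover have "cmod (w j z) \<le> 1/4" if z: "z \<in> E" for z
    proof -
      obtain i where i: "i < l" "z \<in> A i" using z A(4) by blast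
      show ?thesis
        using near(2)[OF i, of j] rpos[OF i(1)] by (auto simp: wA[OF i] norm_divide divide_le_eq)
    qed
    ultimately obtain G where "G \<in> disc_algebra" "\<And>z. z \<in> E \<Longrightarrow> G z = w j z" "\<And>z. z \<in> cball 0 1 \<Longrightarrow> cmod (G z) \<le> 4 * (1/4)"
      using Rudin_Carleson[OF E, of "w j" "1/4"] by (metis zero_less_divide_1_iff zero_less_numeral)
    then show ?thesis by (intro bexI[of _ G]) auto
  qed
  then have "\<forall>j. \<exists>G. G \<in> disc_algebra \<and> (\<forall>z\<in>E. G z = w j z) \<and> (\<forall>z\<in>cball 0 1. cmod (G z) \<le> 1)" by blast
  from choice[OF this] obtain g where g: "\<And>j. g j \<in> disc_algebra" "\<And>j z. z \<in> E \<Longrightarrow> g j z = w j z"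
    "\<And>j z. z \<in> cball 0 1 \<Longrightarrow> cmod (g j z) \<le> 1" by blast

  have "continuous_on E (\<lambda>z. s (idx z))"
  proof (rule piecewise)
    fix i assume "i < l"
    then show "continuous_on (A i) (\<lambda>z. s (idx z))" using idx by (simp cong: continuous_on_cong)
  qed
  moreover have sE: "cmod (s (idx z)) \<le> 1" if z: "z \<in> E" for z
  proof -
    obtain i where "i < l" "z \<in> A i" using z A(4) by blast
    then show ?thesis using idx snorm(2) by simp
  qed
  ultimately obtain p0 where p0: "p0 \<in> disc_algebra" "\<And>z. z \<in> E \<Longrightarrow> p0 z = s (idx z)"
    using Rudin_Carleson[OF E, of "\<lambda>z. s (idx z)" 1] by (metis zero_less_one)
  \<comment> \<open>\<open>Rudin_Carleson\<close> bounds \<open>p0\<close> on the disc only by 4,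
    too much for the polydisc. Damping brings this down to 3/2 and also makes the slice coordinate
    small on \<open>K\<close> and at \<open>c\<close>, leaving its values on \<open>E\<close>
    unchanged.\<close>
  have "cmod (p0 z) \<le> 1" if "z \<in> E" for z using p0(2) sE that by simp
  moreover have "compact (insert c K)" "insert c K \<subseteq> ball 0 1" using assms(6,7,9) by auto
  ultimately obtain p where p: "p \<in> disc_algebra" "\<And>z. z \<in> E \<Longrightarrow> p z = p0 z"
    "\<And>z. z \<in> cball 0 1 \<Longrightarrow> cmod (p z) \<le> 3/2" "\<And>z. z \<in> insert c K \<Longrightarrow> cmod (p z) \<le> 1/4"
    using disc_algebra_damping[OF E p0(1), of 1 "3/2" "insert c K" "1/4"] by auto

  \<comment> \<open>Coordinate \<open>i\<close> carries \<open>g (i - 1)\<close>, matching the shift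
    by \<open>Suc\<close> in \<open>u\<close>.\<close>
  define G where "G z i = (if i = 0 then z else if i \<le> M then g (i - 1) z else if i = k then p z else 0)" for z i
  have Gda: "(\<lambda>z. G z i) \<in> disc_algebra" for i
    using g(1) p(1) by (cases "i = 0"; cases "i \<le> M"; cases "i = k")
      (auto simp: G_def disc_algebra_const, simp_all add: disc_algebra_def holomorphic_intros)
  have GP: "G z \<in> ?P" if z: "z \<in> cball 0 1" for z
  proof -
    have "cmod (g (i - 1) z) < 2" for i using g(3)[OF z, of "i - 1"] by linarith
    moreover have "cmod (p z) < 2" using p(3)[OF z] by linarith
    moreover have "cmod z < 2" using z by simp
    ultimately show ?thesis by (auto simp: G_def polydisc_def cspace_def k_def)
  qed
  have Gk: "G z k = p z" and G0: "G z 0 = z" for z by (auto simp: G_def k_def)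
  have Gcont: "continuous_map (top_of_set (cball 0 1)) (top_of_set ?P) G"
  proof -
    have "continuous_on (cball 0 1) G"
      using Gda by (intro continuous_on_coordinatewise_then_product) (auto simp: disc_algebra_def)
    then show ?thesis using GP by auto
  qed
  \<comment> \<open>On \<open>A i\<close> the slice coordinate is \<open>s i\<close>, so
    \<open>f\<close> is the inverse chart there, and \<open>u i\<close> turns the normalised
    coordinates \<open>w\<close> back into those of \<open>\<phi> z\<close>.\<close>
  have fE: "f (G z) = \<phi> z" "G z k \<in> s ` {..<l}" if z: "z \<in> E" for z
  proof -
    have zC: "z \<in> cball 0 1" using z EC by blast
    obtain i where i: "i < l" "z \<in> A i" using z A(4) by blast
    have Gs: "G z k = s i" using p(2)[OF z] p0(2)[OF z] idx[OF i] by (simp add: Gk)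
    then show "G z k \<in> s ` {..<l}" using i by blast
    have "u i (G z) = \<psi> (y i) (\<phi> z)"
    proof
      fix j
      show "u i (G z) j = \<psi> (y i) (\<phi> z) j"
      proof (cases "j < m (y i)")
        case True
        then have "Suc j \<le> M" using mM[OF i(1)] by simp
        then have "G z (Suc j) = w j z" using g(2)[OF z] by (simp add: G_def)
        then show ?thesis using True rpos[OF i(1)] by (simp add: u_def wA[OF i])
      next
        case False
        have "\<psi> (y i) (\<phi> z) \<in> cspace (m (y i))" using openin_imp_subset[OF cD(3)[OF i(1)]] near(1)[OF i] by blast
        then show ?thesis using False by (simp add: u_def cspace_def)
      qed
    qed
    then have "q i (G z) = \<phi> z" using inv_into_f_f[OF cD(2)[OF i(1)] near(1)[OF i]] by (simp add: q_def)
    then show "f (G z) = \<phi> z" using fq[OF i(1) GP[OF zC] Gs] by simp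
  qed

  \<comment> \<open>The submanifold and the convex compact set for the Oka property\<close>
  define S where "S = s ` {..<l}"
  \<comment> \<open>The slice coordinate at \<open>c\<close> is at most 1/4 in modulus, while slice
    values are at least 1/2; thus \<open>G c\<close> is an isolated point of
    \<open>L\<close>.\<close>
  have pS: "G c k \<notin> S"
  proof
    assume "G c k \<in> S"
    then obtain i where "p c = s i" by (auto simp: S_def Gk)
    then show False using p(4)[of c] snorm(1)[of i] by simp
  qed
  have cC: "c \<in> cball 0 1" using assms(9) by auto
  define L where "L = insert (G c) {Y \<in> ?P. Y k \<in> S}"
  have L: "closed_submanifold (polydisc_mfd (Suc k)) L"
    unfolding L_def by (rule closed_submanifold_slices[OF _ GP[OF cC] pS]) (simp add: S_def)
  have fL: "holomorphic_map (induced_structure (polydisc_mfd (Suc k)) L) X f"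
    unfolding L_def
  proof (rule holomorphic_on_slices[OF X fc _ GP[OF cC] pS])
    fix \<sigma> assume "\<sigma> \<in> S"
    then obtain i where i: "i < l" "\<sigma> = s i" by (auto simp: S_def)
    have "f Y \<in> V (y i) \<and> \<psi> (y i) (f Y) = u i Y" if "Y \<in> ?P" "Y k = \<sigma>" for Y
    proof -
      have "f Y = inv_into (V (y i)) (\<psi> (y i)) (u i Y)" using fq[OF i(1) that(1)] that(2) i(2) by (simp add: q_def)
      then show ?thesis using inv_into_into[OF uV[OF i(1) that(1)]] f_inv_into_f[OF uV[OF i(1) that(1)]] by simp
    qed
    then show "\<exists>m V \<psi> h. (m, V, \<psi>) \<in> cm_atlas X \<and> cn_holomorphic_map (Suc k) m ?P h \<and>
        (\<forall>Y\<in>?P. Y k = \<sigma> \<longrightarrow> f Y \<in> V \<and> \<psi> (f Y) = h Y)"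
      using chart[OF i(1)] uhol[of i] by blast
  qed (simp add: S_def)

  \<comment> \<open>The radii are the bounds known for \<open>G\<close> on \<open>K\<close>: 1 for
    the chart coordinates and 1/4 for the slice coordinate.\<close>
  define \<rho> :: "nat \<Rightarrow> real" where "\<rho> i = (if i = k then 1/4 else 1)" for i
  define K' where "K' = {Y \<in> cspace (Suc k). Y 0 \<in> K \<and> (\<forall>i>0. cmod (Y i) \<le> \<rho> i)}"
  have K': "holomorphically_convex_compact (polydisc_mfd (Suc k)) K'"
    unfolding K'_def
  proof (rule holomorphically_convex_polydisc[OF assms(6,7)])
    fix x assume "x \<notin> K"
    from no_holes_separation[OF assms(6,7,8) this] obtain g B where
      "g holomorphic_on UNIV" "\<And>z. z \<in> K \<Longrightarrow> cmod (g z) \<le> B" "B < cmod (g x)" by blast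
    then show "\<exists>g B. g holomorphic_on UNIV \<and> (\<forall>z\<in>K. cmod (g z) \<le> B) \<and> B < cmod (g x)" by blast
  qed (auto simp: \<rho>_def)
  have K'P: "K' \<subseteq> ?P"
    using K' by (simp add: holomorphically_convex_compact_def compactin_subtopology)
  have K'k: "cmod (Y k) \<le> 1/4" "Y 0 \<in> K" if "Y \<in> K'" for Y
  proof -
    have "k > 0" by (simp add: k_def)
    then have "cmod (Y k) \<le> \<rho> k" using that unfolding K'_def by blast
    then show "cmod (Y k) \<le> 1/4" by (simp add: \<rho>_def)
    show "Y 0 \<in> K" using that by (simp add: K'_def)
  qed
  obtain W0 where W0: "K \<subseteq> W0" "W0 \<subseteq> ball 0 1" "holomorphic_map_on complex_plane X W0 \<phi>"
    using assms(11) by blast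
  have fK: "holomorphic_near (polydisc_mfd (Suc k)) X K' f"
    unfolding holomorphic_near_def
  \<comment> \<open>The gap between 1/4 and 1/3 provides an open neighbourhood of \<open>K'\<close>
    on which no slice interferes. Since \<open>W0\<close> lies in the unit disc, the closest point
    map is the identity there and \<open>f\<close> is \<phi> of the first coordinate.\<close>
  proof (intro exI[of _ "{Y \<in> ?P. Y 0 \<in> W0 \<and> cmod (Y k) < 1/3}"] conjI)
    show "K' \<subseteq> {Y \<in> ?P. Y 0 \<in> W0 \<and> cmod (Y k) < 1/3}"
    proof
      fix Y assume Y: "Y \<in> K'"
      then show "Y \<in> {Y \<in> ?P. Y 0 \<in> W0 \<and> cmod (Y k) < 1/3}"
        using K'P K'k[OF Y] W0(1) by auto
    qed
    show "holomorphic_map_on (polydisc_mfd (Suc k)) X {Y \<in> ?P. Y 0 \<in> W0 \<and> cmod (Y k) < 1/3} f"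
    proof (rule holomorphic_of_first_coordinate[OF W0(3) _ _ X])
      have "open W0" using W0(3) by (simp add: holomorphic_map_on_def complex_plane_def)
      then have "open ({Y::nat \<Rightarrow> complex. Y 0 \<in> W0} \<inter> {Y. cmod (Y k) < 1/3})"
        by (intro open_Int open_Collect_coord open_Collect_less continuous_intros) auto
      moreover have "{Y \<in> ?P. Y 0 \<in> W0 \<and> cmod (Y k) < 1/3} = ?P \<inter> ({Y. Y 0 \<in> W0} \<inter> {Y. cmod (Y k) < 1/3})" by auto
      ultimately show "openin (top_of_set ?P) {Y \<in> ?P. Y 0 \<in> W0 \<and> cmod (Y k) < 1/3}"
        unfolding openin_open by blast
      fix Y assume Y: "Y \<in> {Y \<in> ?P. Y 0 \<in> W0 \<and> cmod (Y k) < 1/3}"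
      then have "Y 0 \<in> cball 0 1" using W0(2) ball_subset_cball by blast
      then show "Y 0 \<in> W0 \<and> f Y = \<phi> (Y 0)" using Y f\<phi>[of Y] by auto
    qed
  qed

  \<comment> \<open>Application of the Oka property and restriction to the image of
    \<open>G\<close>\<close>
  obtain d' where d': "induces_topology d' (cm_top X)" and
    oka: "\<And>(Y :: (nat \<Rightarrow> complex) cmfd) K L f. stein_manifold Y \<Longrightarrow> holomorphically_convex_compact Y K \<Longrightarrow>
           closed_submanifold Y L \<Longrightarrow> continuous_map (cm_top Y) (cm_top X) f \<Longrightarrow>
           holomorphic_near Y X K f \<Longrightarrow> holomorphic_map (induced_structure Y L) X f \<Longrightarrow>
           (\<forall>\<epsilon>>0. \<exists>F. holomorphic_map Y X F \<and> (\<forall>y\<in>L. F y = f y) \<and> (\<forall>y\<in>K. d' (F y) (f y) < \<epsilon>))"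
    using assms(1) unfolding oka_manifold_def by (elim conjE exE) simp
  \<comment> \<open>On \<open>K'\<close> the map \<open>f\<close> takes values in this compact set,
    so closeness for \<open>d'\<close> can be converted into closeness for \<open>d\<close> with a
    single \<eta>.\<close>
  have "compactin (cm_top X) (\<phi> ` K)"
    using assms(6) KC by (intro image_compactin[OF _ \<phi>]) (simp add: compactin_subtopology)
  from metric_compare[OF assms(2) d' this \<epsilon>] obtain \<eta> where
    \<eta>: "\<eta> > 0" "\<And>x y. x \<in> \<phi> ` K \<Longrightarrow> y \<in> points X \<Longrightarrow> d' x y < \<eta> \<Longrightarrow> d x y < \<epsilon>" by blast
  have "continuous_map (cm_top (polydisc_mfd (Suc k))) (cm_top X) f" using fc by simp
  from oka[OF stein_polydisc K' L this fK fL] \<eta>(1) obtain F where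
    F: "holomorphic_map (polydisc_mfd (Suc k)) X F" "\<forall>Y\<in>L. F Y = f Y" "\<forall>Y\<in>K'. d' (F Y) (f Y) < \<eta>" by blast
  have Fc: "continuous_map (top_of_set ?P) (cm_top X) F"
    using F(1) by (simp add: holomorphic_map_on_def subtopology_subtopology)
  interpret D: Metric_space "points X" d using assms(2) by (simp add: induces_topology_def)
  interpret D': Metric_space "points X" d' using d' by (simp add: induces_topology_def)
  have FG: "continuous_map (top_of_set (cball 0 1)) (cm_top X) (\<lambda>z. F (G z))"
    using continuous_map_compose[OF Gcont Fc] by (simp add: o_def)
  show "\<exists>F. continuous_map (top_of_set (cball 0 1)) (cm_top X) F \<and>
           holomorphic_map_on complex_plane X (ball 0 1) F \<and>
           (\<forall>z\<in>K. d (F z) (\<phi> z) < \<epsilon>) \<and> (\<forall>z\<in>E. F z = \<phi> z) \<and> F c = \<phi> c"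
  proof (intro exI[of _ "\<lambda>z. F (G z)"] conjI ballI)
    show "continuous_map (top_of_set (cball 0 1)) (cm_top X) (\<lambda>z. F (G z))" by (rule FG)
    show "holomorphic_map_on complex_plane X (ball 0 1) (\<lambda>z. F (G z))"
    proof (rule holomorphic_compose_curve[OF X F(1) open_ball])
      show "G z \<in> ?P" if "z \<in> ball 0 1" for z using GP that by auto
      show "(\<lambda>z. G z i) holomorphic_on ball 0 1" for i using Gda[of i] by (simp add: disc_algebra_def)
    qed
  next
    fix z assume z: "z \<in> K"
    then have zC: "z \<in> cball 0 1" using KC by blast
    have GK: "G z \<in> K'"
      using z p(4)[of z] g(3)[OF zC] GP[OF zC] by (auto simp: K'_def \<rho>_def G_def polydisc_def k_def)
    have "f (G z) = \<phi> z"
      using f\<phi>[OF GP[OF zC]] K'k[OF GK] zC by (simp add: G0)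
    then have "d' (\<phi> z) (F (G z)) < \<eta>" using F(3) GK D'.commute by metis
    moreover have "F (G z) \<in> points X"
      using continuous_map_image_subset_topspace[OF FG] zC by auto
    ultimately have "d (\<phi> z) (F (G z)) < \<epsilon>" using \<eta>(2) z by blast
    then show "d (F (G z)) (\<phi> z) < \<epsilon>" using D.commute by metis
  next
    fix z assume z: "z \<in> E"
    then have "G z \<in> L" using fE(2)[OF z] GP[of z] EC by (auto simp: L_def S_def)
    then show "F (G z) = \<phi> z" using F(2) fE(1)[OF z] by simp
  next
    have "f (G c) = \<phi> c"
      using f\<phi>[OF GP[OF cC]] p(4)[of c] cC by (simp add: G0 Gk)
    then show "F (G c) = \<phi> c" using F(2) by (simp add: L_def)
  qed
qed

end
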